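(* Let $d>k\ge 1$ be integers, $p>1$, and let $a,b,\gamma\in\mathbb{R}$ satisfy $$k+a>0,\qquad d+a-p>b,\qquad k+a-p>b-\gamma,$$ and assume $\gamma>b$. Then $S_{b,\gamma}=\widetilde{S_{b,\gamma}}$. Moreover, for fixed $d,k,p,a,b$, the function $\gamma\mapsto S_{b,\gamma}$ is continuous and strictly increasing on the set of $\gamma>b$ satisfying $k+a-p>b-\gamma$.
   Context: Write $\mathbb{R}^d\equiv\mathbb{R}^k\times\mathbb{R}^{d-k}\ni (y,x)\equiv z$, and let $\Pi(y,x)=(y,0)$ be the orthogonal projection onto $\mathbb{R}^k\times\{0\}$. $S_{b,\gamma}$ is the best constant in the inequality $S_{b,\gamma}\int_{\mathbb{R}^d}|y|^{a-p-b+\gamma}|z|^{-\gamma}|u|^p\,dz\le\int_{\mathbb{R}^d}|y|^{a}|z|^{-b}|\nabla u|^p\,dz$, $u\in C_c^\infty(\mathbb{R}^d)$; i.e. the infimum over $u\in C_c^\infty(\mathbb{R}^d)\setminus\{0\}$ of the quotient of the right-hand integral by the left-hand integral. Put $\mathrm{H}_b=\frac{d+a-p-b}{p}>0$. The space $W^{1,p}(\mathbb{S}^{d-1};|\Pi\sigma|^a d\sigma)$ is the completion of $C^\infty(\mathbb{S}^{d-1})$ with respect to the norm $\|\varphi\|_{1,p}^p=\int_{\mathbb{S}^{d-1}}|\Pi\sigma|^a(|\nabla_\sigma\varphi|^p+|\varphi|^p)\,d\sigma$, where $\nabla_\sigma$ is the gradient on the unit sphere $\mathbb{S}^{d-1}$.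 Define $$\widetilde{S_{b,\gamma}}=\inf_{\varphi\in W^{1,p}(\mathbb{S}^{d-1};|\Pi\sigma|^a d\sigma)\setminus\{0\}}\ \frac{\int_{\mathbb{S}^{d-1}}|\Pi\sigma|^{a}\big[|\nabla_\sigma\varphi|^2+\mathrm{H}_b^2\varphi^2\big]^{p/2}\,d\sigma}{\int_{\mathbb{S}^{d-1}}|\Pi\sigma|^{a-p-b+\gamma}|\varphi|^p\,d\sigma}.$$ *)

theory Defs
  imports "HOL-Analysis.Analysis"
begin

text \<open>
  \<open>\<real>\<^sup>d = \<real>\<^sup>k \<times> \<real>\<^sup>d\<^sup>-\<^sup>k\<close> is the product type \<open>(real^'k) \<times> (real^'m)\<close>, so that \<open>k = CARD('k)\<close>,
  \<open>d - k = CARD('m)\<close> and \<open>d > k \<ge> 1\<close> holds automatically; \<open>norm\<close> on the product is Euclidean.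
  All integrals have nonnegative integrands and are taken in \<^typ>\<open>ennreal\<close>.
  Negative powers take the value \<open>0 powr t = 0\<close> at the singular set \<open>y = 0\<close>, which is a null set
  for Lebesgue measure and for the surface measure.
\<close>

section \<open>Smooth functions and gradients\<close>

text \<open>For open \<open>S\<close>; all partial derivatives of order at most \<open>n\<close> exist and are continuous.\<close>

primrec Ck_on :: "nat \<Rightarrow> 'a::euclidean_space set \<Rightarrow> ('a \<Rightarrow> real) \<Rightarrow> bool" where
  "Ck_on 0 S f \<longleftrightarrow> continuous_on S f"
| "Ck_on (Suc n) S f \<longleftrightarrow>
     (\<forall>x\<in>S. f differentiable (at x)) \<and>
     (\<forall>i\<in>Basis. Ck_on n S (\<lambda>x. frechet_derivative f (at x) i))"

definition smooth_on :: "'a::euclidean_space set \<Rightarrow> ('a \<Rightarrow> real) \<Rightarrow> bool" where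
  "smooth_on S f \<longleftrightarrow> (\<forall>n. Ck_on n S f)"

definition test_functions :: "('a::euclidean_space \<Rightarrow> real) set" where
  "test_functions = {u. smooth_on UNIV u \<and> compact (closure {z. u z \<noteq> 0})}"

definition gradient :: "('a::euclidean_space \<Rightarrow> real) \<Rightarrow> 'a \<Rightarrow> 'a" where
  "gradient f x = (\<Sum>i\<in>Basis. frechet_derivative f (at x) i *\<^sub>R i)"

section \<open>The best constant on the whole space\<close>

definition weighted_energy ::
    "real \<Rightarrow> real \<Rightarrow> real \<Rightarrow> ((real^'k) \<times> (real^'m) \<Rightarrow> real) \<Rightarrow> ennreal" where
  "weighted_energy p a b u =
     (\<integral>\<^sup>+ z. ennreal (norm (fst z) powr a * norm z powr (- b) * norm (gradient u z) powr p) \<partial>lborel)"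

definition weighted_mass ::
    "real \<Rightarrow> real \<Rightarrow> real \<Rightarrow> real \<Rightarrow> ((real^'k) \<times> (real^'m) \<Rightarrow> real) \<Rightarrow> ennreal" where
  "weighted_mass p a b \<gamma> u =
     (\<integral>\<^sup>+ z. ennreal (norm (fst z) powr (a - p - b + \<gamma>) * norm z powr (- \<gamma>) * \<bar>u z\<bar> powr p) \<partial>lborel)"

definition S_const ::
    "'k::finite itself \<Rightarrow> 'm::finite itself \<Rightarrow> real \<Rightarrow> real \<Rightarrow> real \<Rightarrow> real \<Rightarrow> ennreal" where
  "S_const _ _ p a b \<gamma> =
     (INF u \<in> (test_functions :: ((real^'k) \<times> (real^'m) \<Rightarrow> real) set) - {\<lambda>_. 0}.
        weighted_energy p a b u / weighted_mass p a b \<gamma> u)"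

section \<open>The unit sphere\<close>

text \<open>
  The surface measure of \<open>A \<subseteq> sphere 0 1\<close> is \<open>d\<close> times the Lebesgue measure of the cone
  \<open>{r *\<^sub>R \<sigma> | 0 < r < 1, \<sigma> \<in> A}\<close>.
\<close>

definition sphere_measure :: "'a::euclidean_space measure" where
  "sphere_measure =
     scale_measure (ennreal (real DIM('a)))
       (distr (restrict_space lborel (ball 0 1 - {0})) (restrict_space borel (sphere 0 1)) sgn)"

text \<open>
  Functions on the sphere are represented by functions on the ambient space of which only the
  values on \<open>sphere 0 1\<close> matter. Smoothness and the tangential gradient are those of the extension
  \<open>z \<mapsto> \<phi> (z / \<bar>z\<bar>)\<close>, whose gradient at points of the sphere is tangential.
\<close>

definition smooth_sphere :: "('a::euclidean_space \<Rightarrow> real) \<Rightarrow> bool" where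
  "smooth_sphere \<phi> \<longleftrightarrow> smooth_on (- {0}) (\<phi> \<circ> sgn)"

definition sphere_gradient :: "('a::euclidean_space \<Rightarrow> real) \<Rightarrow> 'a \<Rightarrow> 'a" where
  "sphere_gradient \<phi> \<sigma> = gradient (\<phi> \<circ> sgn) \<sigma>"

definition proj_y :: "(real^'k) \<times> (real^'m) \<Rightarrow> (real^'k) \<times> (real^'m)" where
  "proj_y z = (fst z, 0)"

text \<open>
  The completion of the smooth functions is realised as the closure of
  \<open>{(\<phi>, \<nabla>\<phi>) | \<phi> smooth}\<close> in \<open>L\<^sup>p \<times> L\<^sup>p\<close> with weight \<open>\<bar>\<Pi>\<sigma>\<bar>\<^sup>a\<close>: \<open>W1p_sphere p a \<phi> G\<close> means that \<open>\<phi>\<close> belongs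
  to the completion with \<open>G\<close> as its gradient. Away from the null set \<open>\<Pi>\<sigma> = 0\<close> the weight is
  locally bounded above and below, so \<open>G\<close> is there the distributional gradient and is
  determined by \<open>\<phi>\<close> almost everywhere; hence an element of the completion is
  nonzero iff \<open>\<phi>\<close> is not almost everywhere zero.
\<close>

definition W1p_sphere ::
    "real \<Rightarrow> real \<Rightarrow> ((real^'k) \<times> (real^'m) \<Rightarrow> real) \<Rightarrow>
     ((real^'k) \<times> (real^'m) \<Rightarrow> (real^'k) \<times> (real^'m)) \<Rightarrow> bool" where
  "W1p_sphere p a \<phi> G \<longleftrightarrow>
     \<phi> \<in> borel_measurable sphere_measure \<and> G \<in> borel_measurable sphere_measure \<and>
     (\<exists>\<psi>. (\<forall>n::nat. smooth_sphere (\<psi> n)) \<and>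
        (\<lambda>n. \<integral>\<^sup>+ \<sigma>. ennreal (norm (proj_y \<sigma>) powr a *
            (norm (sphere_gradient (\<psi> n) \<sigma> - G \<sigma>) powr p + \<bar>\<psi> n \<sigma> - \<phi> \<sigma>\<bar> powr p))
            \<partial>sphere_measure) \<longlonglongrightarrow> 0)"

definition Hb :: "real \<Rightarrow> real \<Rightarrow> real \<Rightarrow> real \<Rightarrow> real" where
  "Hb d p a b = (d + a - p - b) / p"

definition sphere_energy ::
    "real \<Rightarrow> real \<Rightarrow> real \<Rightarrow> ((real^'k) \<times> (real^'m) \<Rightarrow> real) \<Rightarrow>
     ((real^'k) \<times> (real^'m) \<Rightarrow> (real^'k) \<times> (real^'m)) \<Rightarrow> ennreal" where
  "sphere_energy p a b \<phi> G =
     (\<integral>\<^sup>+ \<sigma>. ennreal (norm (proj_y \<sigma>) powr a *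
        ((norm (G \<sigma>))\<^sup>2 + (Hb (real DIM((real^'k) \<times> (real^'m))) p a b)\<^sup>2 * (\<phi> \<sigma>)\<^sup>2) powr (p / 2))
        \<partial>sphere_measure)"

definition sphere_mass ::
    "real \<Rightarrow> real \<Rightarrow> real \<Rightarrow> real \<Rightarrow> ((real^'k) \<times> (real^'m) \<Rightarrow> real) \<Rightarrow> ennreal" where
  "sphere_mass p a b \<gamma> \<phi> =
     (\<integral>\<^sup>+ \<sigma>. ennreal (norm (proj_y \<sigma>) powr (a - p - b + \<gamma>) * \<bar>\<phi> \<sigma>\<bar> powr p) \<partial>sphere_measure)"

definition S_sphere_const ::
    "'k::finite itself \<Rightarrow> 'm::finite itself \<Rightarrow> real \<Rightarrow> real \<Rightarrow> real \<Rightarrow> real \<Rightarrow> ennreal" where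
  "S_sphere_const _ _ p a b \<gamma> =
     (INF (\<phi>, G) \<in> {(\<phi> :: (real^'k) \<times> (real^'m) \<Rightarrow> real, G).
          W1p_sphere p a \<phi> G \<and> \<not> (AE \<sigma> in sphere_measure. \<phi> \<sigma> = 0)}.
        sphere_energy p a b \<phi> G / sphere_mass p a b \<gamma> \<phi>)"

end

theory Submission
  imports Defs "HOL-Real_Asymp.Real_Asymp"
begin

text \<open>
  In logarithmic polar coordinates \<open>z = e\<^sup>t \<sigma>\<close>, put \<open>H = H\<^sub>b\<close>. For \<open>S \<le> S~\<close> one tests with
  \<open>\<bar>z\<bar>\<^sup>-\<^sup>H \<chi>(\<epsilon> ln \<bar>z\<bar>) \<phi>(\<sigma>)\<close> and lets \<open>\<epsilon> \<rightarrow> 0\<close>. For \<open>S \<ge> S~\<close> one uses on the sphere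
  \<open>\<phi>(\<sigma>) = (\<integral> e\<^sup>p\<^sup>H\<^sup>t \<bar>u(e\<^sup>t \<sigma>)\<bar>\<^sup>p dt)\<^sup>1\<^sup>/\<^sup>p\<close>: differentiating \<open>\<phi>\<^sup>p\<close>, integrating by parts in \<open>t\<close> and Hoelder's
  inequality give the pointwise bound of \<open>(\<bar>\<nabla>\<phi>\<bar>\<^sup>2 + H\<^sup>2 \<phi>\<^sup>2)\<^sup>p\<^sup>/\<^sup>2\<close> by \<open>\<integral> e\<^sup>p\<^sup>H\<^sup>t \<bar>e\<^sup>t \<nabla>u(e\<^sup>t \<sigma>)\<bar>\<^sup>p dt\<close>.

  By Hoelder's inequality the weighted mass is log-convex in \<open>\<gamma>\<close>, so \<open>ln S\<close> is concave and hence
  continuous, and being nondecreasing it is strictly increasing unless it is eventually constant.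
  Positivity of \<open>S\<close> and the exclusion of the latter case both follow from the divergence theorem for
  the fields \<open>(A y, B x)\<close> times the weight of the mass; neither compactness nor the existence of
  minimisers is needed.
\<close>

section \<open>Calculus of smooth functions\<close>

text \<open>Three obstacles shape the details. The averaged function is in general smooth neither
  where u vanishes along a ray nor over an unbounded range of t, so rays are cut to a compact
  interval and u^2 is regularised. Integrating by parts over [-N, N] leaves a term at -N, which has
  the favourable sign and is discarded, and one at N of order \<epsilon>^p, which is divided by a
  lower bound for the average. The mass weight can be more singular on y = 0 than |y|^a, so
  convergence in the completion does not by itself control the masses; the inequality is passed to
  the limit where |y| is bounded below, and monotone convergence does the rest. In
  \<open>ennreal\<close> a quotient with infinite denominator is 0, so finiteness of the mass on the
  completion has to be established, and here positivity of S enters the equality of the two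
  constants. The recurring shift from \<gamma> to \<gamma> + 2 comes from differentiating
  |z|^(-\<gamma>) along (A y, B x), which produces the factor |y|^2 / |z|^2.\<close>

lemma has_derivative_frechetI:
  "(f has_derivative f') (at x) \<Longrightarrow> frechet_derivative f (at x) = f'"
  using frechet_derivative_at by metis

lemma frechet_has_derivative:
  "f differentiable at x \<Longrightarrow> (f has_derivative frechet_derivative f (at x)) (at x)"
  by (simp add: frechet_derivative_works)

lemma linear_real_eq_sum_Basis:
  fixes f :: "'a::euclidean_space \<Rightarrow> real"
  assumes "linear f"
  shows "f h = (\<Sum>i\<in>Basis. (h \<bullet> i) * f i)"
proof -
  have "f h = f (\<Sum>i\<in>Basis. (h \<bullet> i) *\<^sub>R i)" by (simp add: euclidean_representation)
  then show ?thesis using assms by (simp add: linear_sum linear_cmul)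
qed

lemma frechet_derivative_eq_gradient:
  assumes "f differentiable at x"
  shows "frechet_derivative f (at x) h = gradient f x \<bullet> h"
  unfolding gradient_def inner_sum_left
  by (subst linear_real_eq_sum_Basis[OF linear_frechet_derivative[OF assms]])
    (simp add: inner_commute mult.commute)

text \<open>\<open>frechet_derivative f (at x)\<close> sees f on a whole neighbourhood of x, so
  agreement on S passes to the derivatives because S is open.\<close>

lemma Ck_on_cong:
  assumes "open S" "\<And>x. x \<in> S \<Longrightarrow> f x = g x"
  shows "Ck_on n S f \<longleftrightarrow> Ck_on n S g"
proof -
  have imp: "Ck_on n S f \<Longrightarrow> (\<And>x. x \<in> S \<Longrightarrow> f x = g x) \<Longrightarrow> Ck_on n S g" for n and f g :: "'a \<Rightarrow> real"
  proof (induction n arbitrary: f g)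
    case 0
    then show ?case using continuous_on_cong by (metis Ck_on.simps(1))
  next
    case (Suc n)
    have d: "(g has_derivative frechet_derivative f (at x)) (at x)" if "x \<in> S" for x
      using has_derivative_transform_within_open[OF frechet_has_derivative assms(1) that] Suc.prems that
      by (metis Ck_on.simps(2))
    have "Ck_on n S (\<lambda>x. frechet_derivative g (at x) i)" if "i \<in> Basis" for i
      using Suc.IH[of "\<lambda>x. frechet_derivative f (at x) i"] Suc.prems that has_derivative_frechetI[OF d] by auto
    then show ?case using d by (auto intro: differentiableI)
  qed
  show ?thesis using imp[of n f g] imp[of n g f] assms(2) by auto
qed

text \<open>The derivative may be given by any formula valid on S, whatever
  \<open>frechet_derivative\<close> is elsewhere; the closure proofs by induction on n enter
  here.\<close>

lemma Ck_on_SucI: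
  assumes "open S" "\<And>x. x \<in> S \<Longrightarrow> (f has_derivative f' x) (at x)"
    "\<And>i. i \<in> Basis \<Longrightarrow> Ck_on n S (\<lambda>x. f' x i)"
  shows "Ck_on (Suc n) S f"
proof -
  have "Ck_on n S (\<lambda>x. frechet_derivative f (at x) i)" if "i \<in> Basis" for i
    using Ck_on_cong[OF assms(1), of "\<lambda>x. frechet_derivative f (at x) i" "\<lambda>x. f' x i" n]
      assms(3)[OF that] has_derivative_frechetI[OF assms(2)] by simp
  then show ?thesis using assms(2) by (auto intro: differentiableI)
qed

lemma Ck_on_SucD: "Ck_on (Suc n) S f \<Longrightarrow> Ck_on n S f"
proof (induction n arbitrary: f)
  case 0
  then show ?case
    by (auto intro!: continuous_at_imp_continuous_on differentiable_imp_continuous_within)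
next
  case (Suc n)
  then show ?case by (metis Ck_on.simps(2))
qed

declare Ck_on.simps(2) [simp del]

lemma Ck_on_Suc_differentiable: "Ck_on (Suc n) S f \<Longrightarrow> x \<in> S \<Longrightarrow> f differentiable at x"
  by (simp add: Ck_on.simps)

lemma Ck_on_Suc_partial:
  "Ck_on (Suc n) S f \<Longrightarrow> i \<in> Basis \<Longrightarrow> Ck_on n S (\<lambda>x. frechet_derivative f (at x) i)"
  by (simp add: Ck_on.simps)

lemma Ck_on_continuous: "Ck_on n S f \<Longrightarrow> continuous_on S f"
proof (induction n)
  case (Suc n)
  then show ?case using Ck_on_SucD by blast
qed simp

lemma Ck_on_const: "Ck_on n S (\<lambda>x. c)"
proof (induction n arbitrary: c)
  case (Suc n)
  then show ?case by (simp add: Ck_on.simps)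
qed simp

lemma Ck_on_bounded_linear:
  assumes "bounded_linear f"
  shows "Ck_on n S f"
proof (cases n)
  case 0
  then show ?thesis using assms by (simp add: linear_continuous_on)
next
  case (Suc m)
  have "frechet_derivative f (at x) = f" for x
    by (rule has_derivative_frechetI) (rule bounded_linear_imp_has_derivative[OF assms])
  then show ?thesis using Suc bounded_linear_imp_differentiable[OF assms] by (simp add: Ck_on.simps Ck_on_const)
qed

lemma Ck_on_add:
  assumes "open S" "Ck_on n S f" "Ck_on n S g"
  shows "Ck_on n S (\<lambda>x. f x + g x)"
  using assms(2,3)
proof (induction n arbitrary: f g)
  case 0
  then show ?case by (auto intro: continuous_intros)
next
  case (Suc n)
  show ?case
  proof (rule Ck_on_SucI[OF assms(1), where f' = "\<lambda>x i. frechet_derivative f (at x) i + frechet_derivative g (at x) i"])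
    show "((\<lambda>x. f x + g x) has_derivative (\<lambda>i. frechet_derivative f (at x) i + frechet_derivative g (at x) i)) (at x)"
      if "x \<in> S" for x
      using Suc.prems that by (intro has_derivative_add frechet_has_derivative) (auto dest: Ck_on_Suc_differentiable)
  qed (use Suc Ck_on_Suc_partial in blast)
qed

lemma Ck_on_mult:
  assumes "open S" "Ck_on n S f" "Ck_on n S g"
  shows "Ck_on n S (\<lambda>x. f x * g x)"
  using assms(2,3)
proof (induction n arbitrary: f g)
  case 0
  then show ?case by (auto intro: continuous_intros)
next
  case (Suc n)
  show ?case
  proof (rule Ck_on_SucI[OF assms(1), where f' = "\<lambda>x i. f x * frechet_derivative g (at x) i + frechet_derivative f (at x) i * g x"])
    show "((\<lambda>x. f x * g x) has_derivative (\<lambda>i. f x * frechet_derivative g (at x) i + frechet_derivative f (at x) i * g x)) (at x)"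
      if "x \<in> S" for x
      using Suc.prems that by (intro has_derivative_mult frechet_has_derivative) (auto dest: Ck_on_Suc_differentiable)
    show "Ck_on n S (\<lambda>x. f x * frechet_derivative g (at x) i + frechet_derivative f (at x) i * g x)"
      if "i \<in> Basis" for i
      using Suc.prems[THEN Ck_on_SucD] Suc.prems[THEN Ck_on_Suc_partial, OF that]
      by (intro Ck_on_add assms(1) Suc.IH)
  qed
qed

lemma Ck_on_sum:
  assumes "open S" "finite I" "\<And>i. i \<in> I \<Longrightarrow> Ck_on n S (f i)"
  shows "Ck_on n S (\<lambda>x. \<Sum>i\<in>I. f i x)"
  using assms(2,3)
  by (induction I rule: finite_induct) (auto intro: Ck_on_const Ck_on_add assms(1))

text \<open>By the chain rule a partial derivative of f (g x) is a sum of products of partial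
  derivatives of the components of g with partial derivatives of f composed with g. The latter fall
  under the induction hypothesis, which is why f is generalised.\<close>

lemma Ck_on_compose:
  fixes f :: "'b::euclidean_space \<Rightarrow> real" and g :: "'a::euclidean_space \<Rightarrow> 'b"
  assumes "open S" "g ` S \<subseteq> T"
    and "\<And>b. b \<in> Basis \<Longrightarrow> Ck_on n S (\<lambda>x. g x \<bullet> b)" and "Ck_on n T f"
  shows "Ck_on n S (\<lambda>x. f (g x))"
  using assms(3,4)
proof (induction n arbitrary: f)
  case 0
  have "continuous_on S g"
    using 0 by (subst continuous_on_componentwise) auto
  then show ?case using 0 assms(2) continuous_on_compose2 by (metis Ck_on.simps(1))
next
  case (Suc n)
  define g' where "g' x h = (\<Sum>b\<in>Basis. frechet_derivative (\<lambda>x. g x \<bullet> b) (at x) h *\<^sub>R b)" for x h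
  have dg: "(g has_derivative g' x) (at x)" if "x \<in> S" for x
  proof (subst has_derivative_componentwise_within, rule ballI)
    fix b :: 'b assume b: "b \<in> Basis"
    have "((\<lambda>x. g x \<bullet> b) has_derivative frechet_derivative (\<lambda>x. g x \<bullet> b) (at x)) (at x)"
      using Suc.prems(1)[OF b] that by (intro frechet_has_derivative) (rule Ck_on_Suc_differentiable)
    moreover have "(\<lambda>h. g' x h \<bullet> b) = frechet_derivative (\<lambda>x. g x \<bullet> b) (at x)"
      using b by (auto simp: g'_def inner_sum_left inner_Basis if_distrib cong: if_cong)
    ultimately show "((\<lambda>x. g x \<bullet> b) has_derivative (\<lambda>h. g' x h \<bullet> b)) (at x)" by simp
  qed
  have df: "f differentiable at (g x)" if "x \<in> S" for x using Suc.prems that assms(2) Ck_on_Suc_differentiable by blast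
  show ?case
  proof (rule Ck_on_SucI[OF assms(1), where f' = "\<lambda>x h. frechet_derivative f (at (g x)) (g' x h)"])
    show "((\<lambda>x. f (g x)) has_derivative (\<lambda>h. frechet_derivative f (at (g x)) (g' x h))) (at x)"
      if "x \<in> S" for x
      using diff_chain_at[OF dg[OF that] frechet_has_derivative[OF df[OF that]]] by (simp add: o_def)
    fix i :: 'a assume i: "i \<in> Basis"
    have "frechet_derivative f (at (g x)) (g' x i) =
        (\<Sum>b\<in>Basis. frechet_derivative (\<lambda>x. g x \<bullet> b) (at x) i * frechet_derivative f (at (g x)) b)"
      if "x \<in> S" for x
      unfolding g'_def using linear_frechet_derivative[OF df[OF that]]
      by (simp add: linear_sum linear_cmul)
    then have "Ck_on n S (\<lambda>x. frechet_derivative f (at (g x)) (g' x i)) \<longleftrightarrow>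
       Ck_on n S (\<lambda>x. \<Sum>b\<in>Basis. frechet_derivative (\<lambda>x. g x \<bullet> b) (at x) i * frechet_derivative f (at (g x)) b)"
      by (rule Ck_on_cong[OF assms(1)])
    also have \<dots>
    proof (intro Ck_on_sum Ck_on_mult assms(1) finite_Basis)
      fix b :: 'b assume b: "b \<in> Basis"
      show "Ck_on n S (\<lambda>x. frechet_derivative (\<lambda>x. g x \<bullet> b) (at x) i)"
        using Suc.prems(1)[OF b] i by (rule Ck_on_Suc_partial)
      show "Ck_on n S (\<lambda>x. frechet_derivative f (at (g x)) b)"
        by (rule Suc.IH[OF Ck_on_SucD[OF Suc.prems(1)] Ck_on_Suc_partial[OF Suc.prems(2) b]])
    qed
    finally show "Ck_on n S (\<lambda>x. frechet_derivative f (at (g x)) (g' x i))" .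
  qed
qed

lemma Ck_on_compose_real:
  fixes f :: "real \<Rightarrow> real"
  assumes "open S" "g ` S \<subseteq> T" "Ck_on n S g" "Ck_on n T f"
  shows "Ck_on n S (\<lambda>x. f (g x))"
  using Ck_on_compose[of S g T n f] assms by simp

lemma Ck_on_Un:
  assumes "open S" "open T" "Ck_on n S f" "Ck_on n T f"
  shows "Ck_on n (S \<union> T) f"
  using assms(3,4) by (induction n arbitrary: f) (auto simp: Ck_on.simps intro: continuous_on_open_Un assms)

lemma Ck_on_real_SucI:
  fixes f :: "real \<Rightarrow> real"
  assumes "open S" "\<And>x. x \<in> S \<Longrightarrow> (f has_real_derivative f' x) (at x)" "Ck_on n S f'"
  shows "Ck_on (Suc n) S f"
  using assms by (intro Ck_on_SucI[where f' = "\<lambda>x h. f' x * h"]) (auto simp: has_field_derivative_def)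

lemma Ck_on_exp: "Ck_on n UNIV (exp :: real \<Rightarrow> real)"
proof (induction n)
  case (Suc n)
  then show ?case by (rule Ck_on_real_SucI[OF open_UNIV DERIV_exp])
qed (auto intro!: continuous_on_exp continuous_on_id)

lemma Ck_on_powr: "Ck_on n {0<..} (\<lambda>x::real. x powr c)"
proof (induction n arbitrary: c)
  case 0
  have "continuous_on {0<..} (\<lambda>x::real. x powr c)"
    by (intro continuous_on_powr continuous_on_id continuous_on_const) auto
  then show ?case by simp
next
  case (Suc n)
  show ?case
    by (rule Ck_on_real_SucI[where f' = "\<lambda>x. c * x powr (c - 1)"])
      (auto intro!: has_real_derivative_powr Ck_on_mult Ck_on_const Suc)
qed

lemma Ck_on_ln: "Ck_on n {0<..} (ln :: real \<Rightarrow> real)"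
proof (cases n)
  case 0
  have "continuous_on {0<..} (ln :: real \<Rightarrow> real)"
    by (intro continuous_on_ln continuous_on_id) auto
  then show ?thesis using 0 by simp
next
  case (Suc m)
  have "Ck_on m {0<..} (\<lambda>x::real. x powr - 1)" by (rule Ck_on_powr)
  then have "Ck_on (Suc m) {0<..} (ln :: real \<Rightarrow> real)"
    by (rule Ck_on_real_SucI[rotated 2]) (auto intro!: derivative_eq_intros simp: powr_minus divide_simps)
  then show ?thesis using Suc by simp
qed

lemma smooth_on_cong: "open S \<Longrightarrow> (\<And>x. x \<in> S \<Longrightarrow> f x = g x) \<Longrightarrow> smooth_on S f \<longleftrightarrow> smooth_on S g"
  unfolding smooth_on_def using Ck_on_cong by blast

lemma smooth_on_const: "smooth_on S (\<lambda>x. c)"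
  unfolding smooth_on_def using Ck_on_const by blast

lemma smooth_on_add: "open S \<Longrightarrow> smooth_on S f \<Longrightarrow> smooth_on S g \<Longrightarrow> smooth_on S (\<lambda>x. f x + g x)"
  unfolding smooth_on_def using Ck_on_add by blast

lemma smooth_on_mult: "open S \<Longrightarrow> smooth_on S f \<Longrightarrow> smooth_on S g \<Longrightarrow> smooth_on S (\<lambda>x. f x * g x)"
  unfolding smooth_on_def using Ck_on_mult by blast

lemma smooth_on_compose:
  fixes g :: "'a::euclidean_space \<Rightarrow> 'b::euclidean_space"
  assumes "open S" "g ` S \<subseteq> T" "\<And>b. b \<in> Basis \<Longrightarrow> smooth_on S (\<lambda>x. g x \<bullet> b)" "smooth_on T f"
  shows "smooth_on S (\<lambda>x. f (g x))"
  using Ck_on_compose[OF assms(1,2)] assms(3,4) unfolding smooth_on_def by blast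

lemma smooth_on_compose_real:
  fixes f :: "real \<Rightarrow> real"
  assumes "open S" "g ` S \<subseteq> T" "smooth_on S g" "smooth_on T f"
  shows "smooth_on S (\<lambda>x. f (g x))"
  using Ck_on_compose_real[OF assms(1,2)] assms(3,4) unfolding smooth_on_def by blast

lemma smooth_on_bounded_linear: "bounded_linear f \<Longrightarrow> smooth_on S f"
  unfolding smooth_on_def using Ck_on_bounded_linear by blast

lemma smooth_on_exp: "smooth_on UNIV (exp :: real \<Rightarrow> real)"
  unfolding smooth_on_def using Ck_on_exp by blast

lemma smooth_on_powr: "smooth_on {0<..} (\<lambda>x::real. x powr c)"
  unfolding smooth_on_def using Ck_on_powr by blast

lemma smooth_on_ln: "smooth_on {0<..} (ln :: real \<Rightarrow> real)"
  unfolding smooth_on_def using Ck_on_ln by blast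

lemma smooth_on_Un: "open S \<Longrightarrow> open T \<Longrightarrow> smooth_on S f \<Longrightarrow> smooth_on T f \<Longrightarrow> smooth_on (S \<union> T) f"
  unfolding smooth_on_def using Ck_on_Un by blast

lemma smooth_on_differentiable: "smooth_on S f \<Longrightarrow> x \<in> S \<Longrightarrow> f differentiable at x"
  unfolding smooth_on_def using Ck_on_Suc_differentiable by blast

lemma smooth_on_partial: "smooth_on S f \<Longrightarrow> i \<in> Basis \<Longrightarrow> smooth_on S (\<lambda>x. frechet_derivative f (at x) i)"
  unfolding smooth_on_def using Ck_on_Suc_partial by blast

lemma smooth_on_continuous: "smooth_on S f \<Longrightarrow> continuous_on S f"
  unfolding smooth_on_def using Ck_on_continuous by blast

lemma smooth_on_norm: "smooth_on (- {0}) (norm :: 'a::euclidean_space \<Rightarrow> real)"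
proof -
  have "smooth_on (- {0}) (\<lambda>x::'a. x \<bullet> x)"
  proof -
    have "Ck_on n (- {0}) (\<lambda>x::'a. \<Sum>b\<in>Basis. (x \<bullet> b) * (x \<bullet> b))" for n
      by (intro Ck_on_sum Ck_on_mult) (auto intro: Ck_on_bounded_linear bounded_linear_inner_left)
    then show ?thesis unfolding smooth_on_def by (subst euclidean_inner) blast
  qed
  then have "smooth_on (- {0}) (\<lambda>x::'a. (x \<bullet> x) powr (1/2))"
    by (rule smooth_on_compose_real[where f = "\<lambda>x. x powr (1/2)" and T = "{0<..}", rotated 2, OF _ smooth_on_powr]) auto
  then show ?thesis by (simp add: powr_half_sqrt norm_eq_sqrt_inner[abs_def])
qed

lemma smooth_on_sgn:
  "smooth_on (- {0}) (\<lambda>x::'a::euclidean_space. sgn x \<bullet> b)"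
proof -
  have "smooth_on (- {0}) (\<lambda>x::'a. norm x powr (- 1))"
    by (rule smooth_on_compose_real[where f = "\<lambda>x. x powr (- 1)" and T = "{0<..}", rotated 2, OF smooth_on_norm smooth_on_powr]) auto
  then have "smooth_on (- {0}) (\<lambda>x::'a. norm x powr (- 1) * (x \<bullet> b))"
    by (rule smooth_on_mult[rotated]) (auto intro: smooth_on_bounded_linear bounded_linear_inner_left)
  then show ?thesis
    by (simp add: sgn_div_norm powr_minus)
qed

section \<open>Differentiation under the integral sign\<close>

lemma has_derivative_param_integral:
  fixes f :: "real \<times> 'a::euclidean_space \<Rightarrow> real"
  assumes "open S" "Ck_on (Suc 0) (UNIV \<times> S) f" "x \<in> S"
  shows "((\<lambda>x. integral {c..d} (\<lambda>t. f (t, x))) has_derivative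
    (\<lambda>h. integral {c..d} (\<lambda>t. frechet_derivative f (at (t, x)) (0, h)))) (at x)"
proof -
  \<comment> \<open>\<open>leibniz_rule\<close> wants the derivative as a bounded linear map
    depending continuously on (x, t); it is assembled from the partial derivatives in the directions
    (0, i).\<close>
  define fx where "fx x t = (\<Sum>i\<in>Basis. frechet_derivative f (at (t, x)) (0, i) *\<^sub>R blinfun_inner_left (i::'a))" for x t
  have fx_apply: "fx x t h = frechet_derivative f (at (t, x)) (0, h)" if "x \<in> S" for x t h
  proof -
    have d: "f differentiable at (t, x)"
      using that by (intro Ck_on_Suc_differentiable[OF assms(2)]) simp
    have "linear (\<lambda>h. frechet_derivative f (at (t, x)) (0, h))"
      using linear_compose[OF _ linear_frechet_derivative[OF d], of "\<lambda>h. (0, h)"]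
      by (simp add: o_def linear_iff)
    from linear_real_eq_sum_Basis[OF this, of h]
    show ?thesis by (simp add: fx_def blinfun.sum_left blinfun.scaleR_left mult.commute)
  qed
  have df: "((\<lambda>x. f (t, x)) has_derivative fx x t) (at x)" if "x \<in> S" for x t
  proof -
    have d: "f differentiable at (t, x)"
      using that by (intro Ck_on_Suc_differentiable[OF assms(2)]) simp
    have "((\<lambda>x. f (t, x)) has_derivative (\<lambda>h. frechet_derivative f (at (t, x)) (0, h))) (at x)"
      by (rule has_derivative_compose[of "\<lambda>x. (t, x)" "\<lambda>h. (0, h)" x UNIV f])
        (use frechet_has_derivative[OF d] in \<open>auto intro!: derivative_eq_intros\<close>)
    moreover have "(\<lambda>h. frechet_derivative f (at (t, x)) (0, h)) = blinfun_apply (fx x t)"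
      by (simp add: fun_eq_iff fx_apply that)
    ultimately show ?thesis by simp
  qed
  have contf: "continuous_on (UNIV \<times> S) f" using assms(2) Ck_on_continuous by blast
  have int: "(\<lambda>t. f (t, x)) integrable_on cbox c d" if "x \<in> S" for x
    by (rule integrable_continuous, rule continuous_on_compose2[OF contf])
      (use that in \<open>auto intro!: continuous_intros\<close>)
  have contD: "continuous_on (UNIV \<times> S) (\<lambda>z. frechet_derivative f (at z) (0, i))" if "i \<in> Basis" for i
    using assms(2) that by (intro Ck_on_continuous[of 0] Ck_on_Suc_partial) (auto simp: Basis_prod_def)
  have contfx: "continuous_on (S \<times> cbox c d) (\<lambda>(x, t). fx x t)"
    unfolding fx_def case_prod_beta
  proof (intro continuous_on_sum continuous_on_scaleR continuous_on_const)
    fix i :: 'a assume "i \<in> Basis"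
    from contD[OF this]
    show "continuous_on (S \<times> cbox c d) (\<lambda>p. frechet_derivative f (at (snd p, fst p)) (0, i))"
      by (rule continuous_on_compose2[where f = "\<lambda>p. (snd p, fst p)"])
        (auto intro!: continuous_on_Pair continuous_on_fst continuous_on_snd continuous_on_id)
  qed
  obtain e where e: "e > 0" "ball x e \<subseteq> S" using assms(1,3) openE by blast
  have "((\<lambda>x. integral (cbox c d) (\<lambda>t. f (t, x))) has_derivative integral (cbox c d) (fx x)) (at x within ball x e)"
  proof (rule leibniz_rule)
    show "((\<lambda>x. f (t, x)) has_derivative fx y t) (at y within ball x e)" if "y \<in> ball x e" for y t
      by (rule has_derivative_at_withinI, rule df) (use e(2) that in blast)
    show "continuous_on (ball x e \<times> cbox c d) (\<lambda>(x, t). fx x t)"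
      by (rule continuous_on_subset[OF contfx]) (use e in auto)
  qed (use e int in auto)
  then have D: "((\<lambda>x. integral (cbox c d) (\<lambda>t. f (t, x))) has_derivative integral (cbox c d) (fx x)) (at x)"
    using e by (simp add: at_within_open[of x "ball x e"])
  have "continuous_on (cbox c d) (\<lambda>t. (\<lambda>(x, t). fx x t) (x, t))"
    by (rule continuous_on_compose2[OF contfx])
      (use assms(3) in \<open>auto intro!: continuous_on_Pair continuous_on_const continuous_on_id\<close>)
  then have "continuous_on (cbox c d) (fx x)" by simp
  then have "fx x integrable_on cbox c d" by (rule integrable_continuous)
  from integral_linear[OF this, of "\<lambda>l. blinfun_apply l h" for h]
  have "integral (cbox c d) (fx x) h = integral (cbox c d) (\<lambda>t. fx x t h)" for h
    by (simp add: o_def blinfun.bounded_linear_left)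
  then have "blinfun_apply (integral (cbox c d) (fx x)) = (\<lambda>h. integral {c..d} (\<lambda>t. frechet_derivative f (at (t, x)) (0, h)))"
    by (simp add: fun_eq_iff fx_apply assms(3))
  with D show ?thesis by simp
qed

text \<open>Partial derivatives of a parameter integral are again parameter integrals, of the
  partial derivatives in the directions (0, i), so the induction generalises over f.\<close>

lemma Ck_on_param_integral:
  fixes f :: "real \<times> 'a::euclidean_space \<Rightarrow> real"
  assumes "open S" "Ck_on n (UNIV \<times> S) f"
  shows "Ck_on n S (\<lambda>x. integral {c..d} (\<lambda>t. f (t, x)))"
  using assms(2)
proof (induction n arbitrary: f)
  case 0
  have "continuous_on (S \<times> cbox c d) (\<lambda>(x, t). f (t, x))"
    unfolding case_prod_beta
  proof (rule continuous_on_compose2[of "UNIV \<times> S" f])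
    show "continuous_on (UNIV \<times> S) f" using 0 by simp
  qed (auto intro!: continuous_on_Pair continuous_on_fst continuous_on_snd continuous_on_id)
  from integral_continuous_on_param[OF this] show ?case by simp
next
  case (Suc n)
  have "Ck_on (Suc 0) (UNIV \<times> S) f"
    using Suc.prems by (induction n) (auto dest: Ck_on_SucD)
  show ?case
  proof (rule Ck_on_SucI[OF assms(1) has_derivative_param_integral[OF assms(1) \<open>Ck_on (Suc 0) (UNIV \<times> S) f\<close>]])
    fix i :: 'a assume "i \<in> Basis"
    then show "Ck_on n S (\<lambda>x. integral {c..d} (\<lambda>t. frechet_derivative f (at (t, x)) (0, i)))"
      using Suc.prems by (intro Suc.IH[of "\<lambda>z. frechet_derivative f (at z) (0, i)"] Ck_on_Suc_partial) (auto simp: Basis_prod_def)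
  qed
qed

section \<open>A smooth cutoff function on the line\<close>

text \<open>The powers of x in the denominator make the family closed under differentiation up to
  linear combinations, so smoothness of all members follows by one induction. The member m = 0 is
  the classical flat function.\<close>

definition flat_exp :: "nat \<Rightarrow> real \<Rightarrow> real" where
  "flat_exp m x = (if x > 0 then exp (- (1 / x)) / x ^ m else 0)"

lemma has_derivative_flat_exp:
  "(flat_exp m has_real_derivative flat_exp (m + 2) x - m * flat_exp (m + 1) x) (at x)"
proof (cases x "0::real" rule: linorder_cases)
  case less
  have "((\<lambda>x. 0) has_real_derivative 0) (at x)" by simp
  then have "(flat_exp m has_real_derivative 0) (at x)"
    by (rule DERIV_cong_ev[THEN iffD1, OF refl _ refl, rotated])
      (use eventually_at_left_real eventually_nhds_in_open[of "{..<0}" x] less in \<open>auto simp: flat_exp_def elim: eventually_mono\<close>)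
  then show ?thesis using less by (simp add: flat_exp_def)
next
  case greater
  have "((\<lambda>x. exp (- (1 / x)) / x ^ m) has_real_derivative
      exp (- (1 / x)) / x ^ (m + 2) - m * (exp (- (1 / x)) / x ^ (m + 1))) (at x)"
    using greater
    apply (auto intro!: derivative_eq_intros)
    apply (cases m; cases "m - 1"; simp add: field_simps power2_eq_square)
    done
  then have "(flat_exp m has_real_derivative
      exp (- (1 / x)) / x ^ (m + 2) - m * (exp (- (1 / x)) / x ^ (m + 1))) (at x)"
    by (rule DERIV_cong_ev[THEN iffD1, OF refl _ refl, rotated])
      (use eventually_nhds_in_open[of "{0<..}" x] greater in \<open>auto simp: flat_exp_def elim: eventually_mono\<close>)
  then show ?thesis using greater by (simp add: flat_exp_def)
next
  case equal
  \<comment> \<open>At 0 both one-sided difference quotients tend to 0; on the right exp (-1/h)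
    beats every power of h.\<close>
  have r: "((\<lambda>h::real. exp (- (1 / h)) / h ^ Suc m) \<longlongrightarrow> 0) (at_right 0)"
    by real_asymp
  have "((\<lambda>h. flat_exp m h / h) \<longlongrightarrow> 0) (at_right 0)"
    by (rule Lim_transform_eventually[OF r])
     (auto simp: flat_exp_def eventually_at_right_less field_simps intro!: eventually_at_rightI[of 0 1])
  moreover have "((\<lambda>h. flat_exp m h / h) \<longlongrightarrow> 0) (at_left 0)"
    by (rule Lim_transform_eventually[OF tendsto_const])
      (auto simp: flat_exp_def intro!: eventually_at_leftI[of "-1" 0])
  ultimately have "((\<lambda>h. flat_exp m h / h) \<longlongrightarrow> 0) (at 0)"
    by (simp add: filterlim_split_at_real)
  then show ?thesis using equal
    by (simp add: DERIV_def flat_exp_def)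
qed

lemma smooth_on_flat_exp: "smooth_on UNIV (flat_exp m)"
proof -
  have "Ck_on n UNIV (flat_exp m)" for n
  proof (induction n arbitrary: m)
    case 0
    then show ?case
      using has_derivative_flat_exp
      by (auto intro!: continuous_at_imp_continuous_on DERIV_isCont)
  next
    case (Suc n)
    have "Ck_on n UNIV (\<lambda>x. flat_exp (m + 2) x + (- real m) * flat_exp (m + 1) x)"
      by (intro Ck_on_add Ck_on_mult Ck_on_const Suc open_UNIV)
    then show ?case
      by (intro Ck_on_real_SucI[OF _ has_derivative_flat_exp]) auto
  qed
  then show ?thesis by (simp add: smooth_on_def)
qed

definition bump :: "real \<Rightarrow> real" where
  "bump x = flat_exp 0 (1 - x\<^sup>2)"

lemma smooth_on_bump: "smooth_on UNIV bump"
proof -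
  have "smooth_on UNIV (\<lambda>x::real. 1 + (- 1) * (x * x))"
    by (intro smooth_on_add smooth_on_mult smooth_on_const smooth_on_bounded_linear open_UNIV bounded_linear_ident)
  from smooth_on_compose_real[OF open_UNIV _ this smooth_on_flat_exp[of 0], OF subset_UNIV]
  show ?thesis by (simp add: bump_def[abs_def] power2_eq_square)
qed

lemma bump_pos: "\<bar>x\<bar> < 1 \<Longrightarrow> bump x > 0"
  by (simp add: bump_def flat_exp_def abs_square_less_1)

lemma bump_zero: "\<bar>x\<bar> \<ge> 1 \<Longrightarrow> bump x = 0"
  by (simp add: bump_def flat_exp_def) (metis abs_square_less_1 not_le)

section \<open>Integral inequalities\<close>

text \<open>Convexity of the p-th power, applied to (1 - l) * (x / (1 - l)) + l * (y / l). It takes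
  the place of Minkowski's inequality: the factor of x^p tends to 1 as l tends to 0, while that of
  y^p may blow up but multiplies a term that can be made small for fixed l.\<close>

lemma powr_add_le_weighted:
  fixes p l x y :: real
  assumes "p \<ge> 1" "0 < l" "l < 1" "x \<ge> 0" "y \<ge> 0"
  shows "(x + y) powr p \<le> (1 - l) powr (1 - p) * x powr p + l powr (1 - p) * y powr p"
proof -
  have scale: "c * (z / c) powr p = c powr (1 - p) * z powr p" if "c > 0" "z \<ge> 0" for c z :: real
    using that by (simp add: powr_divide powr_diff)
  have one: "c powr (1 - p) \<ge> 1" if "0 < c" "c < 1" for c :: real
    using powr_mono'[of "1 - p" 0 c] that assms(1) by simp
  consider "x = 0" | "y = 0" | "x > 0" "y > 0" using assms by linarith
  then show ?thesis
  proof cases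
    case 3
    have "((1 - l) * (x / (1 - l)) + l * (y / l)) powr p \<le>
        (1 - l) * (x / (1 - l)) powr p + l * (y / l) powr p"
      using convex_onD[OF powr_convex[OF assms(1)], of l "x / (1 - l)" "y / l"] 3 assms by auto
    then show ?thesis using assms 3 by (simp add: scale)
  next
    case 1
    then show ?thesis using one[of l] assms mult_right_mono[of 1 "l powr (1 - p)" "y powr p"] by simp
  next
    case 2
    then show ?thesis using one[of "1 - l"] assms mult_right_mono[of 1 "(1 - l) powr (1 - p)" "x powr p"] by simp
  qed
qed

lemma norm_add_powr_le_weighted:
  assumes "p \<ge> 1" "0 < l" "l < 1"
  shows "norm (x + y) powr p \<le> (1 - l) powr (1 - p) * norm x powr p + l powr (1 - p) * norm y powr p"
  using powr_add_le_weighted[OF assms, of "norm x" "norm y"] norm_triangle_ineq[of x y] assms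
    powr_mono2[of p "norm (x + y)" "norm x + norm y"] by simp

text \<open>Young's inequality for f / A and g / B, integrated and scaled back by C. The case A = 0
  or B = 0 is separate because of the division; there the product vanishes almost
  everywhere.\<close>

lemma nn_integral_Holder:
  fixes f g :: "'a \<Rightarrow> real"
  assumes [measurable]: "f \<in> borel_measurable M" "g \<in> borel_measurable M"
    and f: "\<And>x. f x \<ge> 0" and g: "\<And>x. g x \<ge> 0" and t: "0 < t" "t < 1"
    and A: "(\<integral>\<^sup>+x. f x \<partial>M) \<le> ennreal A" "A \<ge> 0" and B: "(\<integral>\<^sup>+x. g x \<partial>M) \<le> ennreal B" "B \<ge> 0"
  shows "(\<integral>\<^sup>+x. f x powr (1 - t) * g x powr t \<partial>M) \<le> ennreal (A powr (1 - t) * B powr t)"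
proof (cases "A = 0 \<or> B = 0")
  case True
  then have "AE x in M. f x = 0 \<or> g x = 0"
  proof
    assume "A = 0"
    then have "AE x in M. ennreal (f x) = 0" using A by (subst nn_integral_0_iff_AE[symmetric]) auto
    then show ?thesis by eventually_elim (use f in \<open>simp add: ennreal_eq_0_iff antisym\<close>)
  next
    assume "B = 0"
    then have "AE x in M. ennreal (g x) = 0" using B by (subst nn_integral_0_iff_AE[symmetric]) auto
    then show ?thesis by eventually_elim (use g in \<open>simp add: ennreal_eq_0_iff antisym\<close>)
  qed
  then have "(\<integral>\<^sup>+x. f x powr (1 - t) * g x powr t \<partial>M) = (\<integral>\<^sup>+x. 0 \<partial>M)"
    by (intro nn_integral_cong_AE) auto
  then show ?thesis by simp
next
  case False
  then have pos: "A > 0" "B > 0" using A B by auto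
  define C where "C = A powr (1 - t) * B powr t"
  have C: "C > 0" using pos by (simp add: C_def)
  have Young: "f x powr (1 - t) * g x powr t \<le> C * (1 - t) / A * f x + C * t / B * g x" for x
  proof (cases "f x = 0 \<or> g x = 0")
    case True
    then show ?thesis using f[of x] g[of x] pos C t by auto
  next
    case False
    then have "(f x / A) powr (1 - t) * (g x / B) powr t \<le> (1 - t) * (f x / A) + t * (g x / B)"
      using f[of x] g[of x] pos t by (intro Youngs_inequality_0) auto
    then have "C * ((f x / A) powr (1 - t) * (g x / B) powr t) \<le> C * ((1 - t) * (f x / A) + t * (g x / B))"
      using C by simp
    moreover have "C * ((f x / A) powr (1 - t) * (g x / B) powr t) = f x powr (1 - t) * g x powr t"
      using f[of x] g[of x] pos by (simp add: C_def powr_divide)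
    ultimately show ?thesis by (simp add: algebra_simps)
  qed
  have "(\<integral>\<^sup>+x. f x powr (1 - t) * g x powr t \<partial>M) \<le>
      (\<integral>\<^sup>+x. ennreal (C * (1 - t) / A) * f x + ennreal (C * t / B) * g x \<partial>M)"
    using Young C f g t pos
    by (intro nn_integral_mono) (simp add: ennreal_mult'[symmetric] ennreal_plus[symmetric] del: ennreal_plus)
  also have "\<dots> = ennreal (C * (1 - t) / A) * (\<integral>\<^sup>+x. f x \<partial>M) + ennreal (C * t / B) * (\<integral>\<^sup>+x. g x \<partial>M)"
    by (simp add: nn_integral_add nn_integral_cmult)
  also have "\<dots> \<le> ennreal (C * (1 - t) / A) * ennreal A + ennreal (C * t / B) * ennreal B"
    using A B by (intro add_mono mult_left_mono) auto
  also have "\<dots> = ennreal C"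
    using C t pos by (simp add: ennreal_mult'[symmetric] ennreal_plus[symmetric] field_simps del: ennreal_plus)
  finally show ?thesis by (simp add: C_def)
qed

section \<open>Logarithmic polar coordinates\<close>

lemma lborel_dilation:
  fixes c c' :: real
  assumes "c > 0" "c' > 0"
  shows "(lborel :: ('a::euclidean_space \<times> 'b::euclidean_space) measure) =
    density (distr lborel borel (\<lambda>z. (c *\<^sub>R fst z, c' *\<^sub>R snd z))) (\<lambda>_. ennreal (c ^ DIM('a) * c' ^ DIM('b)))"
proof -
  \<comment> \<open>A basis vector of the product is (u, 0) or (0, u); \<open>snd j = 0\<close>
    tells the two kinds apart.\<close>
  define k where "k j = (if snd j = 0 then c else c')" for j :: "'a \<times> 'b"
  have T: "(\<Sum>j\<in>Basis. (k j * (x \<bullet> j)) *\<^sub>R j) = (c *\<^sub>R fst x, c' *\<^sub>R snd x)" for x :: "'a \<times> 'b"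
  proof (rule euclidean_eqI)
    fix i :: "'a \<times> 'b" assume i: "i \<in> Basis"
    have "(\<Sum>j\<in>Basis. (k j * (x \<bullet> j)) *\<^sub>R j) \<bullet> i = k i * (x \<bullet> i)"
      using i by (simp add: inner_sum_left inner_Basis if_distrib cong: if_cong)
    also have "\<dots> = (c *\<^sub>R fst x, c' *\<^sub>R snd x) \<bullet> i"
      using i by (auto simp: Basis_prod_def k_def inner_prod_def nonzero_Basis)
    finally show "(\<Sum>j\<in>Basis. (k j * (x \<bullet> j)) *\<^sub>R j) \<bullet> i = (c *\<^sub>R fst x, c' *\<^sub>R snd x) \<bullet> i" .
  qed
  have "(\<Prod>j\<in>Basis. \<bar>k j\<bar>) = c ^ DIM('a) * c' ^ DIM('b)"
  proof -
    have "(\<Prod>j\<in>Basis. \<bar>k j\<bar>) = (\<Prod>j\<in>(\<lambda>u. (u::'a, 0::'b)) ` Basis. \<bar>k j\<bar>) * (\<Prod>j\<in>(\<lambda>u. (0::'a, u::'b)) ` Basis. \<bar>k j\<bar>)"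
      unfolding Basis_prod_def by (rule prod.union_disjoint) auto
    also have "\<dots> = c ^ DIM('a) * c' ^ DIM('b)"
      using assms by (simp add: prod.reindex inj_on_def k_def nonzero_Basis)
    finally show ?thesis .
  qed
  moreover have "k j \<noteq> 0" for j using assms by (simp add: k_def)
  ultimately show ?thesis
    using lborel_affine_euclidean[of k 0] by (simp add: T)
qed

lemma nn_integral_lborel_scale:
  fixes f :: "'a::euclidean_space \<Rightarrow> ennreal"
  assumes [measurable]: "f \<in> borel_measurable borel" and c: "c > 0"
  shows "(\<integral>\<^sup>+z. f z \<partial>lborel) = ennreal (c ^ DIM('a)) * (\<integral>\<^sup>+z. f (c *\<^sub>R z) \<partial>lborel)"
  using c by (subst lborel_affine[of c 0])
    (simp_all add: nn_integral_density nn_integral_distr nn_integral_cmult)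

lemma sgn_measurable_sphere [measurable]:
  "sgn \<in> measurable (restrict_space lborel (ball 0 1 - {0})) (restrict_space borel (sphere 0 (1::real) :: 'a::euclidean_space set))"
proof (rule measurable_restrict_space2)
  show "sgn \<in> space (restrict_space lborel (ball 0 1 - {0})) \<rightarrow> sphere 0 (1::real)"
    by (auto simp: space_restrict_space norm_sgn)
  show "(sgn :: 'a \<Rightarrow> 'a) \<in> borel_measurable (restrict_space lborel (ball 0 1 - {0}))"
    by (intro measurable_restrict_space1) (simp add: sgn_div_norm)
qed

lemma space_sphere_measure [simp]: "space sphere_measure = (sphere 0 1 :: 'a::euclidean_space set)"
  by (simp add: sphere_measure_def space_scale_measure space_restrict_space)

lemma sets_sphere_measure [measurable_cong]:
  "sets sphere_measure = sets (restrict_space borel (sphere 0 1 :: 'a::euclidean_space set))"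
  by (simp add: sphere_measure_def)

lemma borel_measurable_sphere: "f \<in> measurable borel N \<Longrightarrow> f \<in> measurable sphere_measure N"
  by (simp add: measurable_cong_sets[OF sets_sphere_measure refl] measurable_restrict_space1)

lemma nn_integral_sphere_measure:
  fixes f :: "'a::euclidean_space \<Rightarrow> ennreal"
  assumes "f \<in> borel_measurable sphere_measure"
  shows "(\<integral>\<^sup>+\<sigma>. f \<sigma> \<partial>sphere_measure) =
    ennreal DIM('a) * (\<integral>\<^sup>+z. f (sgn z) * indicator (ball 0 1 - {0}) z \<partial>lborel)"
proof -
  have f: "f \<in> borel_measurable (restrict_space borel (sphere 0 1))"
    using assms by (simp add: measurable_cong_sets[OF sets_sphere_measure refl])
  then show ?thesis
    unfolding sphere_measure_def
    by (simp add: nn_integral_scale_measure nn_integral_distr nn_integral_restrict_space)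
qed

lemma nn_integral_exp_tail:
  fixes c L :: real
  assumes "c > 0"
  shows "(\<integral>\<^sup>+t. ennreal (exp (- c * t)) * indicator {L..} t \<partial>lborel) = ennreal (exp (- c * L) / c)"
proof -
  have "((\<lambda>t. - exp (- c * t) / c) \<longlongrightarrow> 0) at_top"
    using assms by real_asymp
  moreover have "((\<lambda>t. - exp (- c * t) / c) has_real_derivative exp (- c * t)) (at t)" for t
    using assms by (auto intro!: derivative_eq_intros)
  ultimately show ?thesis
    by (subst nn_integral_FTC_atLeast[where F = "\<lambda>t. - exp (- c * t) / c" and T = 0]) auto
qed

text \<open>After \<open>\<sigma>\<close> is replaced by \<open>sgn z\<close>, the \<open>t\<close>-integral only depends on the ray through \<open>z\<close>, so that it
  may be shifted by \<open>ln \<bar>z\<bar>\<close>; interchanging the integrals and rescaling \<open>z\<close> gives the claim.\<close>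

lemma nn_integral_log_polar:
  fixes f :: "'a::euclidean_space \<Rightarrow> ennreal"
  assumes [measurable]: "f \<in> borel_measurable borel"
  shows "(\<integral>\<^sup>+z. f z \<partial>lborel) =
    (\<integral>\<^sup>+\<sigma>. (\<integral>\<^sup>+t. f (exp t *\<^sub>R \<sigma>) * ennreal (exp (DIM('a) * t)) \<partial>lborel) \<partial>sphere_measure)"
proof -
  define d where "d = DIM('a)"
  have d: "d > 0" by (simp add: d_def)
  let ?B = "{z :: 'a. 0 < norm z \<and> norm z < 1}"
  let ?v = "\<lambda>(t::real) z. f (exp t *\<^sub>R z) * ennreal (norm z ^ d * exp (d * t))"
  let ?w = "\<lambda>(t::real) z. f z * ennreal (norm z ^ d * exp (- real d * t)) * indicator {z. 0 < norm z \<and> norm z < exp t} z"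
  have B: "ball 0 1 - {0} = ?B" by auto
  define H where "H z = (\<integral>\<^sup>+t. f (exp t *\<^sub>R z) * ennreal (exp (d * t)) \<partial>lborel)" for z
  have [measurable]: "H \<in> borel_measurable borel" unfolding H_def by measurable
  have shift: "H (sgn z) = (\<integral>\<^sup>+t. ?v t z \<partial>lborel)" if "z \<noteq> 0" for z
  proof -
    have e: "exp (ln (norm z) + t) *\<^sub>R sgn z = exp t *\<^sub>R z" for t
      using that by (simp add: sgn_div_norm exp_add)
    have "exp (d * (ln (norm z) + t)) = norm z ^ d * exp (d * t)" for t :: real
      using that by (simp add: distrib_left exp_add exp_of_nat_mult)
    with e show ?thesis
      unfolding H_def by (subst nn_integral_real_affine[where c = 1 and t = "ln (norm z)"]) auto
  qed
  have scale: "(\<integral>\<^sup>+z. ?v t z * indicator ?B z \<partial>lborel) =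
      (\<integral>\<^sup>+z. ?w t z \<partial>lborel)"
    (is "?l = ?r") for t :: real
  proof -
    have eq: "exp (- real d * t) * exp t ^ d = 1"
      by (simp add: exp_of_nat_mult[symmetric] exp_add[symmetric])
    have "?r = ennreal (exp t ^ d) * (\<integral>\<^sup>+z. f (exp t *\<^sub>R z) * ennreal (norm (exp t *\<^sub>R z) ^ d * exp (- real d * t)) *
       indicator {z. 0 < norm z \<and> norm z < exp t} (exp t *\<^sub>R z) \<partial>lborel)"
      unfolding d_def by (rule nn_integral_lborel_scale) auto
    also have "\<dots> = (\<integral>\<^sup>+z. ennreal (exp t ^ d) * (f (exp t *\<^sub>R z) * ennreal (norm (exp t *\<^sub>R z) ^ d * exp (- real d * t)) *
       indicator {z. 0 < norm z \<and> norm z < exp t} (exp t *\<^sub>R z)) \<partial>lborel)"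
      by (rule nn_integral_cmult[symmetric]) measurable
    also have "\<dots> = ?l"
    proof (rule nn_integral_cong)
      fix z :: 'a
      have i: "indicator {z. 0 < norm z \<and> norm z < exp t} (exp t *\<^sub>R z) = (indicator ?B z :: ennreal)"
        by (auto simp: indicator_def)
      have "exp t ^ d * (norm (exp t *\<^sub>R z) ^ d * exp (- real d * t)) = (exp (- real d * t) * exp t ^ d) * (norm z ^ d * exp t ^ d)"
        by (simp add: power_mult_distrib)
      also have "\<dots> = norm z ^ d * exp (d * t)"
        unfolding eq by (simp add: exp_of_nat_mult)
      finally have h: "ennreal (exp t ^ d) * ennreal (norm (exp t *\<^sub>R z) ^ d * exp (- real d * t)) = ennreal (norm z ^ d * exp (d * t))"
        by (simp add: ennreal_mult'[symmetric])
      show "ennreal (exp t ^ d) * (f (exp t *\<^sub>R z) * ennreal (norm (exp t *\<^sub>R z) ^ d * exp (- real d * t)) *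
       indicator {z. 0 < norm z \<and> norm z < exp t} (exp t *\<^sub>R z)) =
       ?v t z * indicator ?B z"
        unfolding i h[symmetric] by (simp only: ac_simps)
    qed
    finally show ?thesis by simp
  qed
  \<comment> \<open>Integrating e^(-d t) over t > ln |z| gives |z|^(-d) / d, which cancels |z|^d and
    the normalising factor d of \<open>sphere_measure\<close>.\<close>
  have inner: "ennreal d * (\<integral>\<^sup>+t. ?w t z \<partial>lborel) = f z"
    if "z \<noteq> 0" for z
  proof -
    have "(\<integral>\<^sup>+t. ?w t z \<partial>lborel)
      = (\<integral>\<^sup>+t. (f z * ennreal (norm z ^ d)) * (ennreal (exp (- real d * t)) * indicator {ln (norm z)..} t) \<partial>lborel)"
    proof (rule nn_integral_cong_AE)
      have "AE t in lborel. t \<noteq> ln (norm z)" by (rule AE_lborel_singleton)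
      then show "AE t in lborel. ?w t z
         = (f z * ennreal (norm z ^ d)) * (ennreal (exp (- real d * t)) * indicator {ln (norm z)..} t)"
      proof eventually_elim
        case (elim t)
        have "norm z < exp t \<longleftrightarrow> ln (norm z) \<le> t"
          using elim that ln_less_cancel_iff[of "norm z" "exp t"] by auto
        then show ?case using that by (simp add: indicator_def ennreal_mult' mult.assoc)
      qed
    qed
    also have "\<dots> = (f z * ennreal (norm z ^ d)) * ennreal (exp (- real d * ln (norm z)) / d)"
      using nn_integral_exp_tail[of "real d" "ln (norm z)"] d by (simp add: nn_integral_cmult)
    finally have "ennreal d * (\<integral>\<^sup>+t. ?w t z \<partial>lborel)
      = f z * (ennreal d * ennreal (norm z ^ d) * ennreal (exp (- real d * ln (norm z)) / d))"
      by (simp add: mult.assoc mult.left_commute)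
    also have "ennreal d * ennreal (norm z ^ d) * ennreal (exp (- real d * ln (norm z)) / d) = 1"
    proof -
      have "exp (real d * ln (norm z)) = norm z ^ d" using that by (simp add: exp_of_nat_mult)
      then have "real d * norm z ^ d * (exp (- real d * ln (norm z)) / d) = 1"
        using d that by (simp add: exp_minus field_simps)
      then show ?thesis by (simp add: ennreal_mult'[symmetric])
    qed
    finally show ?thesis by simp
  qed
  have "(\<integral>\<^sup>+\<sigma>. H \<sigma> \<partial>sphere_measure) = ennreal d * (\<integral>\<^sup>+z. H (sgn z) * indicator ?B z \<partial>lborel)"
    unfolding d_def B[symmetric] by (rule nn_integral_sphere_measure) (rule borel_measurable_sphere, measurable)
  also have "(\<integral>\<^sup>+z. H (sgn z) * indicator ?B z \<partial>lborel) =
      (\<integral>\<^sup>+z. (\<integral>\<^sup>+t. ?v t z * indicator ?B z \<partial>lborel) \<partial>lborel)"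
    by (intro nn_integral_cong) (auto simp: shift indicator_def)
  also have "\<dots> = (\<integral>\<^sup>+t. (\<integral>\<^sup>+z. ?v t z * indicator ?B z \<partial>lborel) \<partial>lborel)"
    by (rule lborel_pair.Fubini'[symmetric]) measurable
  also have "\<dots> = (\<integral>\<^sup>+t. (\<integral>\<^sup>+z. ?w t z \<partial>lborel) \<partial>lborel)"
    by (simp only: scale)
  also have "\<dots> = (\<integral>\<^sup>+z. (\<integral>\<^sup>+t. ?w t z \<partial>lborel) \<partial>lborel)"
    by (rule lborel_pair.Fubini') measurable
  also have "ennreal d * \<dots> =
     (\<integral>\<^sup>+z. ennreal d * (\<integral>\<^sup>+t. ?w t z \<partial>lborel) \<partial>lborel)"
    by (rule nn_integral_cmult[symmetric]) measurable
  also have "\<dots> = (\<integral>\<^sup>+z. f z \<partial>lborel)"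
  proof (rule nn_integral_cong_AE)
    have "AE z in lborel. z \<noteq> (0::'a)" by (rule AE_lborel_singleton)
    then show "AE z in lborel. ennreal d * (\<integral>\<^sup>+t. ?w t z \<partial>lborel) = f z"
      by eventually_elim (rule inner)
  qed
  finally show ?thesis by (simp add: H_def d_def)
qed

section \<open>Integrability of the weights\<close>

lemma nn_integral_exp_head:
  fixes c L :: real
  assumes "c > 0"
  shows "(\<integral>\<^sup>+t. ennreal (exp (c * t)) * indicator {..L} t \<partial>lborel) = ennreal (exp (c * L) / c)"
proof -
  have "(\<integral>\<^sup>+t. ennreal (exp (c * t)) * indicator {..L} t \<partial>lborel) =
      (\<integral>\<^sup>+t. ennreal (exp (- c * t)) * indicator {- L..} t \<partial>lborel)"
    by (subst nn_integral_real_affine[where c = "-1" and t = 0])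
      (auto simp: indicator_def intro!: nn_integral_cong)
  then show ?thesis using nn_integral_exp_tail[OF assms, of "- L"] by simp
qed

lemma emeasure_sphere_measure_finite:
  "emeasure sphere_measure (space sphere_measure :: 'a::euclidean_space set) < \<infinity>"
proof -
  have "emeasure sphere_measure (space sphere_measure :: 'a set) = (\<integral>\<^sup>+(\<sigma>::'a). 1 \<partial>sphere_measure)"
    by simp
  also have "\<dots> = ennreal DIM('a) * emeasure lborel (ball 0 1 - {0::'a})"
    by (subst nn_integral_sphere_measure) simp_all
  also have "\<dots> < \<infinity>"
    using le_less_trans[OF emeasure_mono emeasure_lborel_ball_finite, of "ball 0 1 - {0::'a}" 0 1]
    by (simp add: ennreal_mult_less_top)
  finally show ?thesis .
qed

text \<open>In polar coordinates this is the integral of e^((n + s) t) over t \<le> 0, with n the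
  dimension, times the finite area of the sphere.\<close>

lemma nn_integral_norm_powr_ball_finite:
  assumes "real DIM('a::euclidean_space) + s > 0"
  shows "(\<integral>\<^sup>+(y::'a). ennreal (norm y powr s) * indicator {y. norm y \<le> 1} y \<partial>lborel) < \<infinity>"
proof -
  have "(\<integral>\<^sup>+(y::'a). ennreal (norm y powr s) * indicator {y. norm y \<le> 1} y \<partial>lborel) =
     (\<integral>\<^sup>+\<sigma>. (\<integral>\<^sup>+t. ennreal (norm (exp t *\<^sub>R \<sigma>) powr s) * indicator {y. norm y \<le> 1} (exp t *\<^sub>R \<sigma>) *
        ennreal (exp (DIM('a) * t)) \<partial>lborel) \<partial>(sphere_measure :: 'a measure))"
    by (rule nn_integral_log_polar) measurable
  also have "\<dots> = (\<integral>\<^sup>+\<sigma>. ennreal (1 / (DIM('a) + s)) \<partial>(sphere_measure :: 'a measure))"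
  proof (rule nn_integral_cong)
    fix \<sigma> :: 'a assume "\<sigma> \<in> space sphere_measure"
    then have n: "norm \<sigma> = 1" by simp
    have "(\<integral>\<^sup>+t. ennreal (norm (exp t *\<^sub>R \<sigma>) powr s) * indicator {y. norm y \<le> 1} (exp t *\<^sub>R \<sigma>) *
        ennreal (exp (DIM('a) * t)) \<partial>lborel) =
      (\<integral>\<^sup>+t. ennreal (exp ((DIM('a) + s) * t)) * indicator {..0} t \<partial>lborel)"
      by (intro nn_integral_cong)
        (auto simp: n indicator_def powr_def ennreal_mult'[symmetric] exp_add[symmetric] algebra_simps)
    then show "(\<integral>\<^sup>+t. ennreal (norm (exp t *\<^sub>R \<sigma>) powr s) * indicator {y. norm y \<le> 1} (exp t *\<^sub>R \<sigma>) *
        ennreal (exp (DIM('a) * t)) \<partial>lborel) = ennreal (1 / (DIM('a) + s))"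
      using nn_integral_exp_head[OF assms, of 0] by simp
  qed
  also have "\<dots> < \<infinity>"
    using emeasure_sphere_measure_finite[where 'a = 'a] by (simp add: ennreal_mult_less_top)
  finally show ?thesis .
qed

text \<open>Both weights have this form: \<open>weight (a - p - b + \<gamma>) (- \<gamma>)\<close>
  for the mass and \<open>weight a (- b)\<close> for the energy. The degree of homogeneity s + t of
  the mass weight does not depend on \<gamma>.\<close>

definition weight :: "real \<Rightarrow> real \<Rightarrow> (real^'k) \<times> (real^'m) \<Rightarrow> real" where
  "weight s t z = norm (fst z) powr s * norm z powr t"

lemma weight_nonneg [simp]: "weight s t z \<ge> 0"
  by (simp add: weight_def)

lemma borel_measurable_fst_comp [measurable (raw)]:
  fixes f :: "'c \<Rightarrow> 'a::euclidean_space \<times> 'b::euclidean_space"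
  shows "f \<in> borel_measurable M \<Longrightarrow> (\<lambda>x. fst (f x)) \<in> borel_measurable M"
  by (rule measurable_compose[OF _ borel_measurable_continuous_onI]) (auto intro: continuous_intros)

lemma borel_measurable_snd_comp [measurable (raw)]:
  fixes f :: "'c \<Rightarrow> 'a::euclidean_space \<times> 'b::euclidean_space"
  shows "f \<in> borel_measurable M \<Longrightarrow> (\<lambda>x. snd (f x)) \<in> borel_measurable M"
  by (rule measurable_compose[OF _ borel_measurable_continuous_onI]) (auto intro: continuous_intros)

lemma weight_measurable [measurable]: "weight s t \<in> borel_measurable borel"
  unfolding weight_def by measurable

lemma weight_exp_scale:
  "weight s t (exp \<tau> *\<^sub>R z) = exp ((s + t) * \<tau>) * weight s t z"
  by (simp add: weight_def powr_mult exp_powr_real distrib_left distrib_right exp_add mult_ac)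

text \<open>Homogeneity turns the weight on a ray into an exponential of rate s + t, to which the
  volume element adds d; on the sphere only the power s of |y| survives.\<close>

lemma nn_integral_weight_polar:
  fixes g :: "(real^'k::finite) \<times> (real^'m::finite) \<Rightarrow> ennreal"
  assumes [measurable]: "g \<in> borel_measurable borel"
  defines "d \<equiv> real (CARD('k) + CARD('m))"
  shows "(\<integral>\<^sup>+z. ennreal (weight s t z) * g z \<partial>lborel) =
    (\<integral>\<^sup>+\<sigma>. ennreal (norm (fst \<sigma>) powr s) *
      (\<integral>\<^sup>+\<tau>. ennreal (exp ((d + s + t) * \<tau>)) * g (exp \<tau> *\<^sub>R \<sigma>) \<partial>lborel) \<partial>sphere_measure)"
proof -
  have "(\<integral>\<^sup>+z. ennreal (weight s t z) * g z \<partial>lborel) =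
    (\<integral>\<^sup>+\<sigma>. (\<integral>\<^sup>+\<tau>. ennreal (weight s t (exp \<tau> *\<^sub>R \<sigma>)) * g (exp \<tau> *\<^sub>R \<sigma>) *
        ennreal (exp (real DIM((real^'k) \<times> (real^'m)) * \<tau>)) \<partial>lborel) \<partial>sphere_measure)"
    by (rule nn_integral_log_polar) measurable
  also have "\<dots> = (\<integral>\<^sup>+\<sigma>. ennreal (norm (fst \<sigma>) powr s) *
      (\<integral>\<^sup>+\<tau>. ennreal (exp ((d + s + t) * \<tau>)) * g (exp \<tau> *\<^sub>R \<sigma>) \<partial>lborel) \<partial>sphere_measure)"
  proof (rule nn_integral_cong)
    fix \<sigma> :: "(real^'k) \<times> (real^'m)" assume "\<sigma> \<in> space sphere_measure"
    then have n: "norm \<sigma> = 1" by simp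
    have "ennreal (weight s t (exp \<tau> *\<^sub>R \<sigma>)) * g (exp \<tau> *\<^sub>R \<sigma>) * ennreal (exp (real DIM((real^'k) \<times> (real^'m)) * \<tau>)) =
      ennreal (norm (fst \<sigma>) powr s) * (ennreal (exp ((d + s + t) * \<tau>)) * g (exp \<tau> *\<^sub>R \<sigma>))" for \<tau>
    proof -
      have "weight s t (exp \<tau> *\<^sub>R \<sigma>) * exp (real DIM((real^'k) \<times> (real^'m)) * \<tau>) =
          norm (fst \<sigma>) powr s * exp ((d + s + t) * \<tau>)"
        unfolding weight_exp_scale by (simp add: weight_def n d_def exp_add[symmetric] distrib_right)
      then have "ennreal (weight s t (exp \<tau> *\<^sub>R \<sigma>)) * ennreal (exp (real DIM((real^'k) \<times> (real^'m)) * \<tau>)) =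
          ennreal (norm (fst \<sigma>) powr s) * ennreal (exp ((d + s + t) * \<tau>))"
        by (simp only: ennreal_mult'[symmetric] weight_nonneg exp_ge_zero powr_ge_zero)
      then show ?thesis by (simp only: mult.assoc[symmetric] mult.commute[of _ "g _"]) (simp only: mult.assoc)
    qed
    then show "(\<integral>\<^sup>+\<tau>. ennreal (weight s t (exp \<tau> *\<^sub>R \<sigma>)) * g (exp \<tau> *\<^sub>R \<sigma>) *
        ennreal (exp (real DIM((real^'k) \<times> (real^'m)) * \<tau>)) \<partial>lborel) = ennreal (norm (fst \<sigma>) powr s) *
      (\<integral>\<^sup>+\<tau>. ennreal (exp ((d + s + t) * \<tau>)) * g (exp \<tau> *\<^sub>R \<sigma>) \<partial>lborel)"
      by (simp add: nn_integral_cmult)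
  qed
  finally show ?thesis .
qed

lemma nn_integral_weight_ball:
  assumes "real (CARD('k) + CARD('m)) + s + t > 0" "R > 0"
  shows "(\<integral>\<^sup>+(z::(real^'k::finite) \<times> (real^'m::finite)). ennreal (weight s t z) * indicator (cball 0 R) z \<partial>lborel) =
    (\<integral>\<^sup>+(\<sigma>::(real^'k) \<times> (real^'m)). ennreal (norm (fst \<sigma>) powr s) \<partial>sphere_measure) *
      ennreal (R powr (real (CARD('k) + CARD('m)) + s + t) / (real (CARD('k) + CARD('m)) + s + t))"
proof -
  define c where "c = real (CARD('k) + CARD('m)) + s + t"
  have "(\<integral>\<^sup>+\<tau>. ennreal (exp (c * \<tau>)) * indicator (cball 0 R) (exp \<tau> *\<^sub>R \<sigma>) \<partial>lborel) = ennreal (R powr c / c)"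
    if "norm \<sigma> = 1" for \<sigma> :: "(real^'k) \<times> (real^'m)"
  proof -
    have "exp \<tau> \<le> R \<longleftrightarrow> \<tau> \<le> ln R" for \<tau> using assms(2) by (simp add: ln_ge_iff)
    then have "indicator (cball 0 R) (exp \<tau> *\<^sub>R \<sigma>) = (indicator {..ln R} \<tau> :: ennreal)" for \<tau>
      by (simp add: indicator_def that)
    then show ?thesis
      using nn_integral_exp_head[of c "ln R"] assms by (simp add: powr_def c_def)
  qed
  then have "(\<integral>\<^sup>+(z::(real^'k) \<times> (real^'m)). ennreal (weight s t z) * indicator (cball 0 R) z \<partial>lborel) =
      (\<integral>\<^sup>+(\<sigma>::(real^'k) \<times> (real^'m)). ennreal (norm (fst \<sigma>) powr s) * ennreal (R powr c / c) \<partial>sphere_measure)"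
    by (subst nn_integral_weight_polar)
      (auto simp: c_def intro!: nn_integral_cong borel_measurable_indicator)
  also have "\<dots> = (\<integral>\<^sup>+(\<sigma>::(real^'k) \<times> (real^'m)). ennreal (norm (fst \<sigma>) powr s) \<partial>sphere_measure) * ennreal (R powr c / c)"
    by (rule nn_integral_multc, rule borel_measurable_sphere) measurable
  finally show ?thesis by (simp add: c_def)
qed

text \<open>The spherical integral is read off from a ball integral with t = 0, where it is a
  factor. The ball lies in the product of the unit balls of the two factors, and there the integral
  splits into one over y, finite because k + s > 0, and the volume of the ball in x.\<close>

lemma nn_integral_sphere_weight_finite:
  assumes "real CARD('k) + s > 0"
  shows "(\<integral>\<^sup>+(\<sigma>::(real^'k::finite) \<times> (real^'m::finite)). ennreal (norm (fst \<sigma>) powr s) \<partial>sphere_measure) < \<infinity>"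
    (is "?I < _")
proof -
  let ?d = "real (CARD('k) + CARD('m)) + s + 0"
  have d: "?d > 0" using assms by simp
  have "?I * ennreal (1 powr ?d / ?d) =
     (\<integral>\<^sup>+(z::(real^'k) \<times> (real^'m)). ennreal (weight s 0 z) * indicator (cball 0 1) z \<partial>lborel)"
    using nn_integral_weight_ball[where 'k = 'k and 'm = 'm, OF d, of 1] by simp
  also have "\<dots> \<le> (\<integral>\<^sup>+(z::(real^'k) \<times> (real^'m)). (ennreal (norm (fst z) powr s) * indicator {y. norm y \<le> 1} (fst z))
       * indicator {x. norm x \<le> 1} (snd z) \<partial>(lborel \<Otimes>\<^sub>M lborel))"
    unfolding lborel_prod
  proof (rule nn_integral_mono)
    fix z :: "(real^'k) \<times> (real^'m)"
    have "norm (fst z) \<le> norm z" "norm (snd z) \<le> norm z" 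
      using norm_fst_le[of "fst z" "snd z"] norm_snd_le[of "snd z" "fst z"] by simp_all
    then show "ennreal (weight s 0 z) * indicator (cball 0 1) z \<le>
      ennreal (norm (fst z) powr s) * indicator {y. norm y \<le> 1} (fst z) * indicator {x. norm x \<le> 1} (snd z)"
      by (cases "z = 0") (auto simp: indicator_def weight_def)
  qed
  also have "\<dots> = (\<integral>\<^sup>+(y::real^'k). (\<integral>\<^sup>+(x::real^'m). (ennreal (norm y powr s) * indicator {y. norm y \<le> 1} y) * indicator {x. norm x \<le> 1} x \<partial>lborel) \<partial>lborel)"
    by (subst lborel.nn_integral_fst[symmetric]) simp_all
  also have "\<dots> = (\<integral>\<^sup>+(y::real^'k). ennreal (norm y powr s) * indicator {y. norm y \<le> 1} y \<partial>lborel) *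
      (\<integral>\<^sup>+(x::real^'m). ennreal (norm x powr 0) * indicator {x. norm x \<le> 1} x \<partial>lborel)"
  \<comment> \<open>Since \<open>0 powr 0 = 0\<close>, the function \<open>norm x powr 0\<close>
    differs from 1 at the origin, and the integrands agree only almost everywhere.\<close>
  proof -
    have "(\<integral>\<^sup>+(x::real^'m). indicator {x. norm x \<le> 1} x \<partial>lborel) = (\<integral>\<^sup>+(x::real^'m). ennreal (norm x powr 0) * indicator {x. norm x \<le> 1} x \<partial>lborel)"
      using AE_lborel_singleton[of 0] by (intro nn_integral_cong_AE) (auto elim: eventually_mono)
    then show ?thesis by (simp add: nn_integral_cmult nn_integral_multc)
  qed
  also have "\<dots> < \<infinity>"
    using nn_integral_norm_powr_ball_finite[where 'a = "real^'k", of s]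
      nn_integral_norm_powr_ball_finite[where 'a = "real^'m", of 0] assms
    by (auto simp: ennreal_mult_less_top)
  finally show ?thesis using d by (auto simp: ennreal_mult_less_top)
qed

lemma AE_fst_nonzero: "AE z in lborel. fst (z :: (real^'k::finite) \<times> (real^'m::finite)) \<noteq> 0"
proof (rule AE_I)
  have "emeasure lborel {z :: (real^'k) \<times> (real^'m). fst z = 0} =
      emeasure (lborel \<Otimes>\<^sub>M lborel) ({0::real^'k} \<times> (UNIV :: (real^'m) set))"
    unfolding lborel_prod by (rule arg_cong2[where f = emeasure]) auto
  also have "\<dots> = 0" by (simp add: lborel.emeasure_pair_measure_Times)
  finally show "emeasure lborel {z :: (real^'k) \<times> (real^'m). fst z = 0} = 0" .
  show "{z :: (real^'k) \<times> (real^'m). fst z = 0} \<in> sets lborel"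
    unfolding sets_lborel by (intro borel_closed closed_Collect_eq continuous_intros)
qed auto

text \<open>The two positivity conditions express integrability of the weight across y = 0 and at
  the origin; f is dominated by a multiple of the indicator of a ball.\<close>

lemma integrable_weight_bounded:
  fixes f :: "(real^'k::finite) \<times> (real^'m::finite) \<Rightarrow> real"
  assumes "real CARD('k) + s > 0" "real (CARD('k) + CARD('m)) + s + t > 0"
    and [measurable]: "f \<in> borel_measurable borel"
    and bd: "\<And>z. \<bar>f z\<bar> \<le> C" and supp: "\<And>z. norm z > R \<Longrightarrow> f z = 0"
  shows "integrable lborel (\<lambda>z. weight s t z * f z)"
proof -
  define R' where "R' = max R 1"
  have int: "integrable lborel (\<lambda>z::(real^'k) \<times> (real^'m). weight s t z * indicator (cball 0 R') z)"
  proof (rule integrableI_bounded)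
    have "(\<integral>\<^sup>+(z::(real^'k) \<times> (real^'m)). ennreal (norm (weight s t z * indicator (cball 0 R') z)) \<partial>lborel) =
      (\<integral>\<^sup>+(z::(real^'k) \<times> (real^'m)). ennreal (weight s t z) * indicator (cball 0 R') z \<partial>lborel)"
      by (intro nn_integral_cong) (auto simp: indicator_def)
    also have "\<dots> < \<infinity>"
      using nn_integral_weight_ball[where 'k = 'k and 'm = 'm, OF assms(2), of R']
        nn_integral_sphere_weight_finite[where 'k = 'k and 'm = 'm, OF assms(1)]
      by (simp add: R'_def ennreal_mult_less_top)
    finally show "(\<integral>\<^sup>+(z::(real^'k) \<times> (real^'m)). ennreal (norm (weight s t z * indicator (cball 0 R') z)) \<partial>lborel) < \<infinity>" .
    show "(\<lambda>z::(real^'k) \<times> (real^'m). weight s t z * indicator (cball 0 R') z) \<in> borel_measurable lborel"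
      by (simp, intro borel_measurable_times weight_measurable borel_measurable_indicator) auto
  qed
  have "integrable lborel (\<lambda>z::(real^'k) \<times> (real^'m). C * (weight s t z * indicator (cball 0 R') z))"
    using int by simp
  then show ?thesis
  proof (rule Bochner_Integration.integrable_bound)
    show "AE z in lborel. norm (weight s t z * f z) \<le> norm (C * (weight s t z * indicator (cball 0 R') z))"
    proof (rule AE_I2)
      fix z :: "(real^'k) \<times> (real^'m)"
      have "C \<ge> 0" using bd[of z] by linarith
      then show "norm (weight s t z * f z) \<le> norm (C * (weight s t z * indicator (cball 0 R') z))"
        using bd[of z] supp[of z] mult_left_mono[OF bd[of z], of "weight s t z"]
        by (auto simp: indicator_def R'_def abs_mult mult.commute)
    qed
  qed simp
qed

section \<open>Integrating along anisotropic dilations\<close>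

text \<open>The flow of the linear vector field (A y, B x).\<close>

definition dil :: "real \<Rightarrow> real \<Rightarrow> real \<Rightarrow> 'a::real_vector \<times> 'b::real_vector \<Rightarrow> 'a \<times> 'b" where
  "dil A B t z = (exp (A * t) *\<^sub>R fst z, exp (B * t) *\<^sub>R snd z)"

text \<open>The divergence theorem for the linear field generating \<open>dil\<close>, which needs no boundary terms:
  the integral of \<open>\<kappa> \<Psi> + D\<close> is invariant under the dilations, and averaging it over \<open>0 \<le> t \<le> 1\<close> leaves
  the difference of two equal integrals of \<open>\<Psi>\<close>.\<close>

lemma integral_dilation_derivative:
  fixes \<Psi> D :: "'a::euclidean_space \<times> 'b::euclidean_space \<Rightarrow> real"
  assumes \<Psi>: "integrable lborel \<Psi>" and D: "integrable lborel D"
    and good: "AE z in lborel. good z"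
    and deriv: "\<And>z t. good z \<Longrightarrow> ((\<lambda>t. \<Psi> (dil A B t z)) has_real_derivative D (dil A B t z)) (at t)"
  shows "(\<integral>z. (A * DIM('a) + B * DIM('b)) * \<Psi> z + D z \<partial>lborel) = 0"
proof -
  define \<kappa> where "\<kappa> = A * DIM('a) + B * DIM('b)"
  define f where "f z = \<kappa> * \<Psi> z + D z" for z
  have [measurable]: "\<Psi> \<in> borel_measurable borel" "D \<in> borel_measurable borel"
    using \<Psi> D by (auto dest: borel_measurable_integrable)
  have f: "integrable lborel f" unfolding f_def using \<Psi> D by simp
  have [measurable]: "f \<in> borel_measurable borel" unfolding f_def by measurable
  have dil_m [measurable]: "(\<lambda>x. dil A B (fst x) (snd x)) \<in> borel \<Otimes>\<^sub>M borel \<rightarrow>\<^sub>M (borel :: ('a \<times> 'b) measure)"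
    unfolding dil_def borel_prod[symmetric] by measurable
  have dil_m1 [measurable]: "dil A B t \<in> borel \<rightarrow>\<^sub>M (borel :: ('a \<times> 'b) measure)" for t
    unfolding dil_def borel_prod[symmetric] by measurable
  \<comment> \<open>The Jacobian of the flow at time t is e^(\<kappa> t), where \<kappa> is the
    divergence of the field.\<close>
  have dens: "(lborel :: ('a \<times> 'b) measure) = density (distr lborel borel (dil A B t)) (\<lambda>_. ennreal (exp (\<kappa> * t)))" for t
  proof -
    have "exp (A * t) ^ DIM('a) * exp (B * t) ^ DIM('b) = exp (\<kappa> * t)"
      by (simp add: \<kappa>_def exp_of_nat_mult[symmetric] exp_add[symmetric] algebra_simps)
    then show ?thesis
      using lborel_dilation[of "exp (A * t)" "exp (B * t)", where 'a = 'a and 'b = 'b] by (simp add: dil_def[abs_def])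
  qed
  have inv_integrable: "integrable lborel (\<lambda>z. exp (\<kappa> * t) * h (dil A B t z))"
    and inv: "(\<integral>z. exp (\<kappa> * t) * h (dil A B t z) \<partial>lborel) = (\<integral>z. h z \<partial>lborel)"
    if h: "integrable lborel h" for h :: "'a \<times> 'b \<Rightarrow> real" and t
  proof -
    have [measurable]: "h \<in> borel_measurable borel" using h by (auto dest: borel_measurable_integrable)
    have "integrable (density (distr lborel borel (dil A B t)) (\<lambda>_. ennreal (exp (\<kappa> * t)))) h"
      using h dens by metis
    then show "integrable lborel (\<lambda>z. exp (\<kappa> * t) * h (dil A B t z))"
      by (simp add: integrable_density integrable_distr_eq)
    have "(\<integral>z. h z \<partial>lborel) = (\<integral>z. h z \<partial>(density (distr lborel borel (dil A B t)) (\<lambda>_. ennreal (exp (\<kappa> * t)))))"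
      using dens by metis
    then show "(\<integral>z. exp (\<kappa> * t) * h (dil A B t z) \<partial>lborel) = (\<integral>z. h z \<partial>lborel)"
      by (simp add: integral_density integral_distr)
  qed
  \<comment> \<open>The average over t, written on the product space so that Fubini's theorem
    applies.\<close>
  define F where "F t z = indicator {0..1} t * (exp (\<kappa> * t) * f (dil A B t z))" for t z
  have F_m: "case_prod F \<in> borel_measurable (lborel \<Otimes>\<^sub>M lborel)"
    unfolding F_def case_prod_beta by measurable
  have F_int: "integrable (lborel \<Otimes>\<^sub>M lborel) (case_prod F)"
  proof (rule lborel_pair.Fubini_integrable[OF F_m])
    have "(\<integral>z. norm (F t z) \<partial>lborel) = indicator {0..1} t * (\<integral>z. \<bar>f z\<bar> \<partial>lborel)" for t
    proof -
      have "(\<integral>z. norm (F t z) \<partial>lborel) = (\<integral>z. indicator {0..1} t * (exp (\<kappa> * t) * \<bar>f (dil A B t z)\<bar>) \<partial>lborel)"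
        by (intro Bochner_Integration.integral_cong) (auto simp: F_def abs_mult indicator_def)
      then show ?thesis using inv[of "\<lambda>z. \<bar>f z\<bar>" t] f by simp
    qed
    then show "integrable lborel (\<lambda>t. \<integral>z. norm (case_prod F (t, z)) \<partial>lborel)"
      by (simp add: integrable_real_indicator)
    show "AE t in lborel. integrable lborel (\<lambda>z. case_prod F (t, z))"
      using inv_integrable[OF f] by (simp add: F_def)
  qed
  \<comment> \<open>Along the orbit of z the integrand is the t-derivative of e^(\<kappa> t) times
    \<Psi>.\<close>
  have FTC: "(\<integral>t. F t z \<partial>lborel) = exp \<kappa> * \<Psi> (dil A B 1 z) - \<Psi> z"
    if z: "good z" and int: "integrable lborel (\<lambda>t. F t z)" for z
  proof -
    have "((\<lambda>t. exp (\<kappa> * t) * \<Psi> (dil A B t z)) has_real_derivative exp (\<kappa> * t) * f (dil A B t z)) (at t)" for t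
      by (auto intro!: derivative_eq_intros deriv[OF z] simp: f_def algebra_simps)
    then have "((\<lambda>t. exp (\<kappa> * t) * f (dil A B t z)) has_integral
       exp (\<kappa> * 1) * \<Psi> (dil A B 1 z) - exp (\<kappa> * 0) * \<Psi> (dil A B 0 z)) {0..1}"
      by (intro fundamental_theorem_of_calculus)
        (auto simp: has_real_derivative_iff_has_vector_derivative[symmetric] intro: has_field_derivative_at_within)
    moreover have "set_integrable lborel {0..1} (\<lambda>t. exp (\<kappa> * t) * f (dil A B t z))"
      using int by (simp add: set_integrable_def F_def)
    then have "(\<integral>t. F t z \<partial>lborel) = integral {0..1} (\<lambda>t. exp (\<kappa> * t) * f (dil A B t z))"
      by (subst set_borel_integral_eq_integral(2)[symmetric]) (auto simp: set_lebesgue_integral_def F_def)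
    ultimately show ?thesis by (simp add: dil_def integral_unique)
  qed
  have "(\<integral>z. f z \<partial>lborel) = (\<integral>(t::real). indicator {0..1} t * (\<integral>z. f z \<partial>lborel) \<partial>lborel)"
    by simp
  also have "\<dots> = (\<integral>t. (\<integral>z. F t z \<partial>lborel) \<partial>lborel)"
    using inv[OF f] by (simp add: F_def)
  also have "\<dots> = (\<integral>z. (\<integral>t. F t z \<partial>lborel) \<partial>lborel)"
    using lborel_pair.Fubini_integral[OF F_int] by simp
  also have "\<dots> = (\<integral>z. exp (\<kappa> * 1) * \<Psi> (dil A B 1 z) - \<Psi> z \<partial>lborel)"
  proof (rule integral_cong_AE)
    show "AE z in lborel. (\<integral>t. F t z \<partial>lborel) = exp (\<kappa> * 1) * \<Psi> (dil A B 1 z) - \<Psi> z"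
      using good lborel_pair.AE_integrable_snd[OF F_int] by eventually_elim (simp add: FTC)
    show "(\<lambda>z. \<integral>t. F t z \<partial>lborel) \<in> borel_measurable lborel"
      using lborel_pair.integrable_snd[OF F_int] by (rule borel_measurable_integrable)
  qed measurable
  also have "\<dots> = 0"
    using inv_integrable[OF \<Psi>, of 1] inv[OF \<Psi>, of 1] \<Psi> by (subst Bochner_Integration.integral_diff) auto
  finally show ?thesis by (simp add: f_def \<kappa>_def)
qed

section \<open>Test functions\<close>

lemma test_functions_smooth: "u \<in> test_functions \<Longrightarrow> smooth_on UNIV u"
  by (simp add: test_functions_def)

lemma test_functions_differentiable: "u \<in> test_functions \<Longrightarrow> u differentiable at x"
  using smooth_on_differentiable test_functions_smooth by blast

lemma test_functions_continuous: "u \<in> test_functions \<Longrightarrow> continuous_on UNIV u"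
  using smooth_on_continuous test_functions_smooth by blast

lemma continuous_on_gradient:
  assumes "smooth_on S u"
  shows "continuous_on S (gradient u)"
  unfolding gradient_def
  by (intro continuous_on_sum continuous_on_scaleR continuous_on_const
      smooth_on_continuous smooth_on_partial[OF assms])

lemma gradient_measurable: "u \<in> test_functions \<Longrightarrow> gradient u \<in> borel_measurable borel"
  using continuous_on_gradient test_functions_smooth borel_measurable_continuous_onI by blast

lemma test_functions_measurable: "u \<in> test_functions \<Longrightarrow> u \<in> borel_measurable borel"
  using test_functions_continuous borel_measurable_continuous_onI by blast

lemma test_functions_bounds:
  assumes "u \<in> test_functions"
  obtains R K where "R > 0" "K > 0" "\<And>z. \<bar>u z\<bar> \<le> K" "\<And>z. norm (gradient u z) \<le> K"
    "\<And>z. norm z > R \<Longrightarrow> u z = 0" "\<And>z. norm z > R \<Longrightarrow> gradient u z = 0"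
proof -
  have "bounded {z. u z \<noteq> 0}"
    using assms bounded_subset[OF compact_imp_bounded closure_subset] by (simp add: test_functions_def)
  then obtain R where R: "R > 0" "\<And>z. u z \<noteq> 0 \<Longrightarrow> norm z \<le> R"
    unfolding bounded_pos by auto
  have u0: "u z = 0" if "norm z > R" for z using R that by force
  have g0: "gradient u z = 0" if "norm z > R" for z
  proof -
    have "open (- cball 0 R :: 'a set)" by (simp add: open_Compl)
    moreover have "z \<in> - cball 0 R" using that by simp
    ultimately have "(u has_derivative (\<lambda>h. 0)) (at z)"
      by (rule has_derivative_transform_within_open[OF has_derivative_const[of 0]])
        (use u0 in \<open>auto simp: not_le\<close>)
    from has_derivative_frechetI[OF this] show ?thesis by (simp add: gradient_def)
  qed
  have "bounded (u ` cball 0 R)" "bounded (gradient u ` cball 0 R)"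
    using test_functions_continuous[OF assms] continuous_on_gradient[OF test_functions_smooth[OF assms]]
    by (auto intro!: compact_imp_bounded compact_continuous_image intro: continuous_on_subset)
  then obtain K1 K2 where "\<forall>z\<in>cball 0 R. \<bar>u z\<bar> \<le> K1" "\<forall>z\<in>cball 0 R. norm (gradient u z) \<le> K2"
    unfolding bounded_iff by auto
  then have K: "\<And>z. norm z \<le> R \<Longrightarrow> \<bar>u z\<bar> \<le> K1" "\<And>z. norm z \<le> R \<Longrightarrow> norm (gradient u z) \<le> K2"
    by auto
  have "\<bar>u z\<bar> \<le> max 1 (max K1 K2)" "norm (gradient u z) \<le> max 1 (max K1 K2)" for z
    using K[of z] u0[of z] g0[of z] by (cases "norm z \<le> R"; simp add: le_max_iff_disj)+
  then show ?thesis using that[of R "max 1 (max K1 K2)"] R(1) u0 g0 by simp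
qed

text \<open>The infimum defining \<open>S_const\<close> thus runs over a nonempty set, from which
  its finiteness is derived.\<close>

lemma test_functions_nontrivial: "\<exists>u::'a::euclidean_space \<Rightarrow> real. u \<in> test_functions \<and> u \<noteq> (\<lambda>_. 0)"
proof -
  define u where "u z = bump (z \<bullet> z)" for z :: 'a
  have "Ck_on n UNIV (\<lambda>x::'a. \<Sum>b\<in>Basis. (x \<bullet> b) * (x \<bullet> b))" for n
    by (intro Ck_on_sum Ck_on_mult) (auto intro: Ck_on_bounded_linear bounded_linear_inner_left)
  then have "smooth_on UNIV (\<lambda>x::'a. x \<bullet> x)"
    unfolding smooth_on_def by (subst euclidean_inner) blast
  then have "smooth_on UNIV u"
    unfolding u_def by (intro smooth_on_compose_real[OF _ _ _ smooth_on_bump]) auto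
  moreover have "{z. u z \<noteq> 0} \<subseteq> cball 0 1"
    using bump_zero by (force simp: u_def norm_eq_sqrt_inner)
  then have "bounded {z. u z \<noteq> 0}" using bounded_subset bounded_cball by blast
  then have "compact (closure {z. u z \<noteq> 0})" by (simp add: compact_closure)
  moreover have "u 0 \<noteq> 0" using bump_pos[of 0] by (simp add: u_def)
  ultimately show ?thesis unfolding test_functions_def by (intro exI[of _ u]) auto
qed

text \<open>As p > 1, the derivative exists at 0 as well and is 0 there, so |u|^p can be
  differentiated along the flow without regularisation.\<close>

lemma DERIV_abs_powr:
  fixes p x :: real
  assumes "p > 1"
  shows "((\<lambda>x. \<bar>x\<bar> powr p) has_real_derivative p * \<bar>x\<bar> powr (p - 1) * sgn x) (at x)"
proof (cases x "0::real" rule: linorder_cases)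
  case less
  have "((\<lambda>x. (- x) powr p) has_real_derivative p * (- x) powr (p - 1) * (- 1)) (at x)"
    using less by (auto intro!: derivative_eq_intros)
  then have "((\<lambda>x. \<bar>x\<bar> powr p) has_real_derivative p * (- x) powr (p - 1) * (- 1)) (at x)"
    by (rule has_field_derivative_transform_within_open[where S = "{..<0}"]) (use less in auto)
  then show ?thesis using less by simp
next
  case greater
  have "((\<lambda>x. x powr p) has_real_derivative p * x powr (p - 1)) (at x)"
    using greater by (auto intro!: derivative_eq_intros)
  then have "((\<lambda>x. \<bar>x\<bar> powr p) has_real_derivative p * x powr (p - 1)) (at x)"
    by (rule has_field_derivative_transform_within_open[where S = "{0<..}"]) (use greater in auto)
  then show ?thesis using greater by simp
next
  case equal
  have "((\<lambda>h. \<bar>h\<bar> powr p / h) \<longlongrightarrow> 0) (at (0::real))"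
  proof (rule Lim_null_comparison)
    have "\<forall>\<^sub>F h in at (0::real). h \<noteq> 0" by (simp add: eventually_at_filter)
    then show "\<forall>\<^sub>F h in at 0. norm (\<bar>h\<bar> powr p / h) \<le> \<bar>h\<bar> powr (p - 1)"
      by eventually_elim (simp add: powr_diff abs_divide)
    have "((\<lambda>h::real. \<bar>h\<bar> powr (p - 1)) \<longlongrightarrow> 0 powr (p - 1)) (at 0)"
      using assms tendsto_rabs_zero[OF tendsto_ident_at[of "0::real" UNIV]]
      by (intro tendsto_powr') auto
    then show "((\<lambda>h. \<bar>h\<bar> powr (p - 1)) \<longlongrightarrow> 0) (at (0::real))" by simp
  qed
  then show ?thesis using equal by (simp add: DERIV_def)
qed

lemma DERIV_norm_vector:
  fixes g :: "real \<Rightarrow> 'a::real_inner"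
  assumes "(g has_vector_derivative v) (at t)" "g t \<noteq> 0"
  shows "((\<lambda>t. norm (g t)) has_real_derivative v \<bullet> sgn (g t)) (at t)"
  using has_derivative_compose[OF assms(1)[unfolded has_vector_derivative_def] has_derivative_norm[OF assms(2)]]
  unfolding has_field_derivative_def by (simp add: mult_commute_abs)

lemma DERIV_gradient_compose:
  fixes g :: "real \<Rightarrow> 'a::euclidean_space"
  assumes "(g has_vector_derivative v) (at t)" "u differentiable at (g t)"
  shows "((\<lambda>t. u (g t)) has_real_derivative gradient u (g t) \<bullet> v) (at t)"
  using has_derivative_compose[OF assms(1)[unfolded has_vector_derivative_def] frechet_has_derivative[OF assms(2)]]
  unfolding has_field_derivative_def frechet_derivative_eq_gradient[OF assms(2)] by (simp add: mult_commute_abs)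

section \<open>The fundamental integral inequality\<close>

text \<open>Only the hypotheses free of \<gamma> are fixed, because the arguments compare different
  values of \<gamma>. The parameters \<open>tk\<close> and \<open>tm\<close> carry the dimensions k
  and d - k as types, as in \<open>S_const\<close>.\<close>

locale hardy_weights =
  fixes p a b :: real and tk :: "'k::finite itself" and tm :: "'m::finite itself"
  assumes p: "p > 1"
    and ka: "real CARD('k) + a > 0"
    and dab: "real CARD('k) + real CARD('m) + a - p > b"
begin

abbreviation tests :: "((real^'k) \<times> (real^'m) \<Rightarrow> real) set" where
  "tests \<equiv> test_functions"

abbreviation \<Omega> :: "((real^'k) \<times> (real^'m)) measure" where
  "\<Omega> \<equiv> sphere_measure"

abbreviation \<omega> :: "real \<Rightarrow> (real^'k) \<times> (real^'m) \<Rightarrow> ennreal" where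
  "\<omega> s \<sigma> \<equiv> ennreal (norm (fst \<sigma>) powr s)"

definition M :: "real \<Rightarrow> ((real^'k) \<times> (real^'m) \<Rightarrow> real) \<Rightarrow> real" where
  "M \<gamma> u = (\<integral>z. weight (a - p - b + \<gamma>) (- \<gamma>) z * \<bar>u z\<bar> powr p \<partial>lborel)"

definition E :: "((real^'k) \<times> (real^'m) \<Rightarrow> real) \<Rightarrow> real" where
  "E u = (\<integral>z. weight a (- b) z * norm (gradient u z) powr p \<partial>lborel)"

text \<open>Local integrability of the mass weight across y = 0: its exponent of |y| exceeds
  -k.\<close>

definition adm :: "real \<Rightarrow> bool" where
  "adm \<gamma> \<longleftrightarrow> real CARD('k) + a - p > b - \<gamma>"

lemma mass_integrable:
  assumes u: "u \<in> tests" and \<gamma>: "adm \<gamma>"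
  shows "integrable lborel (\<lambda>z. weight (a - p - b + \<gamma>) (- \<gamma>) z * \<bar>u z\<bar> powr p)"
proof -
  obtain R K where RK: "R > 0" "K > 0" "\<And>z. \<bar>u z\<bar> \<le> K" "\<And>z. norm (gradient u z) \<le> K"
    "\<And>z. norm z > R \<Longrightarrow> u z = 0" "\<And>z. norm z > R \<Longrightarrow> gradient u z = 0"
    by (rule test_functions_bounds[OF u]) (rule that; assumption)
  note [measurable] = test_functions_measurable[OF u]
  show ?thesis
  proof (rule integrable_weight_bounded)
    show "\<bar>\<bar>u z\<bar> powr p\<bar> \<le> K powr p" for z using RK(3)[of z] p by (simp add: powr_mono2)
    show "\<bar>u z\<bar> powr p = 0" if "norm z > R" for z using RK(5)[OF that] p by simp
  qed (use \<gamma> dab in \<open>auto simp: adm_def\<close>)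
qed

lemma energy_integrable:
  assumes u: "u \<in> tests"
  shows "integrable lborel (\<lambda>z. weight a (- b) z * norm (gradient u z) powr p)"
proof -
  obtain R K where RK: "R > 0" "K > 0" "\<And>z. \<bar>u z\<bar> \<le> K" "\<And>z. norm (gradient u z) \<le> K"
    "\<And>z. norm z > R \<Longrightarrow> u z = 0" "\<And>z. norm z > R \<Longrightarrow> gradient u z = 0"
    by (rule test_functions_bounds[OF u]) (rule that; assumption)
  note [measurable] = gradient_measurable[OF u]
  show ?thesis
  proof (rule integrable_weight_bounded)
    show "\<bar>norm (gradient u z) powr p\<bar> \<le> K powr p" for z using RK(4)[of z] p by (simp add: powr_mono2)
    show "norm (gradient u z) powr p = 0" if "norm z > R" for z using RK(6)[OF that] p by simp
  qed (use ka dab p in \<open>auto simp: adm_def\<close>)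
qed

lemma weighted_mass_eq: "u \<in> tests \<Longrightarrow> adm \<gamma> \<Longrightarrow> weighted_mass p a b \<gamma> u = ennreal (M \<gamma> u)"
  using nn_integral_eq_integral[OF mass_integrable] unfolding weighted_mass_def M_def
  by (simp add: weight_def)

lemma weighted_energy_eq: "u \<in> tests \<Longrightarrow> weighted_energy p a b u = ennreal (E u)"
  using nn_integral_eq_integral[OF energy_integrable] unfolding weighted_energy_def E_def
  by (simp add: weight_def)

lemma M_nonneg: "M \<gamma> u \<ge> 0" unfolding M_def by simp

lemma E_nonneg: "E u \<ge> 0" unfolding E_def by simp

text \<open>The weight is positive off the null set y = 0, so a vanishing mass would make the open
  set where u is nonzero negligible, hence empty.\<close>

lemma M_pos:
  assumes u: "u \<in> tests" "u \<noteq> (\<lambda>_. 0)" and \<gamma>: "adm \<gamma>"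
  shows "M \<gamma> u > 0"
proof (rule ccontr)
  assume "\<not> M \<gamma> u > 0"
  then have "M \<gamma> u = 0" using M_nonneg[of \<gamma> u] by simp
  then have "AE z in lborel. weight (a - p - b + \<gamma>) (- \<gamma>) z * \<bar>u z\<bar> powr p = 0"
    unfolding M_def by (subst (asm) integral_nonneg_eq_0_iff_AE[OF mass_integrable[OF u(1) \<gamma>]]) auto
  with AE_fst_nonzero have "AE z in lborel. u z = 0"
    by eventually_elim (auto simp: weight_def zero_prod_def prod_eq_iff)
  then have "{z. u z \<noteq> 0} \<in> null_sets lborel"
    using test_functions_measurable[OF u(1)] by (subst AE_iff_null_sets) auto
  then have "negligible {z. u z \<noteq> 0}"
    by (simp add: negligible_iff_null_sets null_sets_completionI)
  moreover have "open {z. u z \<noteq> 0}"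
    using test_functions_continuous[OF u(1)] by (intro open_Collect_neq) auto
  ultimately have "{z. u z \<noteq> 0} = {}" using open_not_negligible by blast
  then show False using u(2) by auto
qed

text \<open>The divergence identity for the field \<open>weight * (A y, B x)\<close> tested with \<open>\<bar>u\<bar>\<^sup>p\<close>.\<close>

lemma dilation_identity:
  fixes A B :: real
  assumes u: "u \<in> tests" and \<gamma>: "adm \<gamma>"
  defines "s \<equiv> a - p - b + \<gamma>"
  shows "integrable lborel (\<lambda>z. weight s (- \<gamma>) z * (\<bar>u z\<bar> powr (p - 1) * sgn (u z) * (gradient u z \<bullet> (A *\<^sub>R fst z, B *\<^sub>R snd z))))"
    and "(A * CARD('k) + B * CARD('m) + s * A - \<gamma> * B) * M \<gamma> u - \<gamma> * (A - B) * M (\<gamma> + 2) u =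
      - p * (\<integral>z. weight s (- \<gamma>) z * (\<bar>u z\<bar> powr (p - 1) * sgn (u z) * (gradient u z \<bullet> (A *\<^sub>R fst z, B *\<^sub>R snd z))) \<partial>lborel)"
proof -
  obtain R K where RK: "R > 0" "K > 0" "\<And>z. \<bar>u z\<bar> \<le> K" "\<And>z. norm (gradient u z) \<le> K"
    "\<And>z. norm z > R \<Longrightarrow> u z = 0" "\<And>z. norm z > R \<Longrightarrow> gradient u z = 0"
    by (rule test_functions_bounds[OF u]) (rule that; assumption)
  note [measurable] = test_functions_measurable[OF u] gradient_measurable[OF u]
  define G where "G z = \<bar>u z\<bar> powr (p - 1) * sgn (u z) * (gradient u z \<bullet> (A *\<^sub>R fst z, B *\<^sub>R snd z))" for z
  have [measurable]: "(\<lambda>z. (A *\<^sub>R fst z, B *\<^sub>R snd z)) \<in> borel \<rightarrow>\<^sub>M (borel :: ((real^'k) \<times> (real^'m)) measure)"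
    by (intro borel_measurable_continuous_onI continuous_intros)
  have [measurable]: "G \<in> borel_measurable borel" unfolding G_def by measurable
  have Vn: "norm (A *\<^sub>R y, B *\<^sub>R x) \<le> (\<bar>A\<bar> + \<bar>B\<bar>) * norm (y, x)" for y :: "real^'k" and x :: "real^'m"
  proof -
    have "norm (A *\<^sub>R y, B *\<^sub>R x) \<le> norm (A *\<^sub>R y) + norm (B *\<^sub>R x)" by (rule norm_Pair_le)
    also have "\<dots> \<le> \<bar>A\<bar> * norm (y, x) + \<bar>B\<bar> * norm (y, x)"
      using norm_fst_le[of y x] norm_snd_le[of x y] by (auto intro!: add_mono mult_left_mono)
    finally show ?thesis by (simp add: distrib_right)
  qed
  have Gb: "\<bar>G z\<bar> \<le> K powr (p - 1) * (K * ((\<bar>A\<bar> + \<bar>B\<bar>) * R))" for z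
  proof (cases "norm z > R")
    case True
    then show ?thesis using RK by (simp add: G_def)
  next
    case False
    have "\<bar>gradient u z \<bullet> (A *\<^sub>R fst z, B *\<^sub>R snd z)\<bar> \<le> norm (gradient u z) * norm (A *\<^sub>R fst z, B *\<^sub>R snd z)"
      by (rule Cauchy_Schwarz_ineq2)
    also have "\<dots> \<le> K * ((\<bar>A\<bar> + \<bar>B\<bar>) * R)"

    proof (rule mult_mono[OF RK(4)])
      have "(\<bar>A\<bar> + \<bar>B\<bar>) * norm z \<le> (\<bar>A\<bar> + \<bar>B\<bar>) * R"
        using False by (intro mult_left_mono) auto
      then show "norm (A *\<^sub>R fst z, B *\<^sub>R snd z) \<le> (\<bar>A\<bar> + \<bar>B\<bar>) * R"
        using Vn[of "fst z" "snd z"] by simp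
    qed (use RK(2) in auto)
    finally have "\<bar>u z\<bar> powr (p - 1) * \<bar>gradient u z \<bullet> (A *\<^sub>R fst z, B *\<^sub>R snd z)\<bar> \<le> K powr (p - 1) * (K * ((\<bar>A\<bar> + \<bar>B\<bar>) * R))"
      using RK(3)[of z] p by (intro mult_mono powr_mono2) auto
    moreover have "\<bar>G z\<bar> \<le> \<bar>u z\<bar> powr (p - 1) * \<bar>gradient u z \<bullet> (A *\<^sub>R fst z, B *\<^sub>R snd z)\<bar>"
      by (simp add: G_def abs_mult abs_sgn_eq)
    ultimately show ?thesis by linarith
  qed
  have s: "real CARD('k) + s > 0" "real (CARD('k) + CARD('m)) + s + - \<gamma> > 0"
    using \<gamma> dab by (auto simp: adm_def s_def)
  have intG: "integrable lborel (\<lambda>z. weight s (- \<gamma>) z * G z)"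
    by (rule integrable_weight_bounded[OF s _ Gb, where R = R]) (use RK in \<open>auto simp: G_def\<close>)
  then show "integrable lborel (\<lambda>z. weight s (- \<gamma>) z * (\<bar>u z\<bar> powr (p - 1) * sgn (u z) * (gradient u z \<bullet> (A *\<^sub>R fst z, B *\<^sub>R snd z))))"
    by (simp add: G_def)
  define \<Psi> where "\<Psi> z = weight s (- \<gamma>) z * \<bar>u z\<bar> powr p" for z
  \<comment> \<open>Differentiating |z|^(-\<gamma>) along the field gives the factor |y|^2 / |z|^2,
    and the weight times this factor is the mass weight for \<gamma> + 2.\<close>
  define \<Psi>2 where "\<Psi>2 z = weight (s + 2) (- \<gamma> - 2) z * \<bar>u z\<bar> powr p" for z
  define D where "D z = (s * A - \<gamma> * B) * \<Psi> z - \<gamma> * (A - B) * \<Psi>2 z + p * (weight s (- \<gamma>) z * G z)" for z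
  have int\<Psi>: "integrable lborel \<Psi>" using mass_integrable[OF u \<gamma>] by (simp add: \<Psi>_def[abs_def] s_def)
  have \<gamma>2: "adm (\<gamma> + 2)" using \<gamma> by (simp add: adm_def)
  have e2: "a - p - b + (\<gamma> + 2) = s + 2" "- (\<gamma> + 2) = - \<gamma> - 2" by (simp_all add: s_def)
  have int\<Psi>2: "integrable lborel \<Psi>2" using mass_integrable[OF u \<gamma>2] unfolding e2 by (simp add: \<Psi>2_def[abs_def])
  have intD: "integrable lborel D" unfolding D_def using intG int\<Psi> int\<Psi>2 by simp
  have deriv: "((\<lambda>t. \<Psi> (dil A B t z)) has_real_derivative D (dil A B t z)) (at t)" if z: "fst z \<noteq> 0" for z t
  proof -
    let ?Z = "dil A B t z"
    let ?V = "(A *\<^sub>R fst ?Z, B *\<^sub>R snd ?Z)"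
    have Z: "fst ?Z \<noteq> 0" "?Z \<noteq> 0" using z by (auto simp: dil_def zero_prod_def)
    have vd1: "((\<lambda>t. fst (dil A B t z)) has_vector_derivative A *\<^sub>R fst ?Z) (at t)"
      unfolding dil_def by (auto intro!: derivative_eq_intros simp: mult.commute)
    have vd2: "((\<lambda>t. snd (dil A B t z)) has_vector_derivative B *\<^sub>R snd ?Z) (at t)"
      unfolding dil_def by (auto intro!: derivative_eq_intros simp: mult.commute)
    have vd: "((\<lambda>t. dil A B t z) has_vector_derivative ?V) (at t)"
      using has_vector_derivative_Pair[OF vd1 vd2] by simp
    have n1: "((\<lambda>t. norm (fst (dil A B t z)) powr s) has_real_derivative
        s * A * norm (fst ?Z) powr s) (at t)"
    proof -
      have h1: "((\<lambda>t. norm (fst (dil A B t z)) powr s) has_real_derivative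
        s * norm (fst ?Z) powr (s - of_nat 1) * (A *\<^sub>R fst ?Z \<bullet> sgn (fst ?Z))) (at t)"
        by (rule DERIV_fun_powr[OF DERIV_norm_vector[OF vd1 Z(1)]]) (use Z in simp)
      have h2: "s * norm (fst ?Z) powr (s - of_nat 1) * (A *\<^sub>R fst ?Z \<bullet> sgn (fst ?Z)) = s * A * norm (fst ?Z) powr s"
        using Z by (simp add: sgn_div_norm powr_diff dot_square_norm power2_eq_square)
      show ?thesis by (rule DERIV_cong[OF h1 h2])
    qed
    have n2: "((\<lambda>t. norm (dil A B t z) powr (- \<gamma>)) has_real_derivative
        - \<gamma> * norm ?Z powr (- \<gamma>) * ((A * (norm (fst ?Z))\<^sup>2 + B * (norm (snd ?Z))\<^sup>2) / (norm ?Z)\<^sup>2)) (at t)"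
    proof -
      have h1: "((\<lambda>t. norm (dil A B t z) powr (- \<gamma>)) has_real_derivative
        - \<gamma> * norm ?Z powr (- \<gamma> - of_nat 1) * (?V \<bullet> sgn ?Z)) (at t)"
        by (rule DERIV_fun_powr[OF DERIV_norm_vector[OF vd Z(2)]]) (use Z in simp)
      have "?V \<bullet> sgn ?Z = (A * (norm (fst ?Z))\<^sup>2 + B * (norm (snd ?Z))\<^sup>2) / norm ?Z"
        by (simp add: sgn_div_norm inner_prod_def dot_square_norm divide_inverse algebra_simps)
      moreover have "norm ?Z powr (- \<gamma> - of_nat 1) = norm ?Z powr (- \<gamma>) / norm ?Z"
        using Z by (simp add: powr_diff)
      ultimately show ?thesis by (intro DERIV_cong[OF h1]) (simp add: power2_eq_square)
    qed
    have n3: "((\<lambda>t. \<bar>u (dil A B t z)\<bar> powr p) has_real_derivative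
        p * \<bar>u ?Z\<bar> powr (p - 1) * sgn (u ?Z) * (gradient u ?Z \<bullet> ?V)) (at t)"
      using DERIV_chain2[OF DERIV_abs_powr[OF p] DERIV_gradient_compose[OF vd test_functions_differentiable[OF u]]] .
    have sq: "(norm ?Z)\<^sup>2 = (norm (fst ?Z))\<^sup>2 + (norm (snd ?Z))\<^sup>2"
      by (metis norm_Pair prod.collapse real_sqrt_pow2 sum_power2_ge_zero)
    have w2: "weight (s + 2) (- \<gamma> - 2) ?Z = weight s (- \<gamma>) ?Z * ((norm (fst ?Z))\<^sup>2 / (norm ?Z)\<^sup>2)"
      using Z by (simp add: weight_def powr_add powr_diff powr_numeral)
    \<comment> \<open>This splits (A y, B x) into B z and (A - B) (y, 0); for A = B the contribution
      of \<open>\<Psi>2\<close> disappears.\<close>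
    have frac: "(A * (norm (fst ?Z))\<^sup>2 + B * (norm (snd ?Z))\<^sup>2) / (norm ?Z)\<^sup>2 =
       B + (A - B) * ((norm (fst ?Z))\<^sup>2 / (norm ?Z)\<^sup>2)"
      using Z sq by (simp add: field_simps)
    show ?thesis
      unfolding \<Psi>_def weight_def
      by (rule DERIV_cong[OF DERIV_mult[OF DERIV_mult[OF n1 n2] n3]])
        (simp add: D_def \<Psi>_def \<Psi>2_def w2 frac G_def weight_def[of s "- \<gamma>"] algebra_simps
          diff_divide_distrib)
  qed
  have "(\<integral>z. (A * DIM(real^'k) + B * DIM(real^'m)) * \<Psi> z + D z \<partial>lborel) = 0"
    by (rule integral_dilation_derivative[OF int\<Psi> intD AE_fst_nonzero deriv])
  then have "(A * CARD('k) + B * CARD('m)) * (\<integral>z. \<Psi> z \<partial>lborel) +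
     ((s * A - \<gamma> * B) * (\<integral>z. \<Psi> z \<partial>lborel) - \<gamma> * (A - B) * (\<integral>z. \<Psi>2 z \<partial>lborel) + p * (\<integral>z. weight s (- \<gamma>) z * G z \<partial>lborel)) = 0"
    using int\<Psi> int\<Psi>2 intG by (simp add: D_def)
  moreover have "(\<integral>z. \<Psi> z \<partial>lborel) = M \<gamma> u" by (simp add: \<Psi>_def M_def s_def)
  moreover have "(\<integral>z. \<Psi>2 z \<partial>lborel) = M (\<gamma> + 2) u" unfolding M_def e2 by (simp add: \<Psi>2_def)
  ultimately show "(A * CARD('k) + B * CARD('m) + s * A - \<gamma> * B) * M \<gamma> u - \<gamma> * (A - B) * M (\<gamma> + 2) u =
      - p * (\<integral>z. weight s (- \<gamma>) z * (\<bar>u z\<bar> powr (p - 1) * sgn (u z) * (gradient u z \<bullet> (A *\<^sub>R fst z, B *\<^sub>R snd z))) \<partial>lborel)"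
    unfolding G_def by (simp add: algebra_simps)
qed

text \<open>Hoelder's inequality with exponents 1 - 1/p and 1/p on the right-hand side of
  \<open>dilation_identity\<close>. The corresponding powers of the mass and energy weights multiply
  to the mass weight times |y|^(1 - \<theta>) |z|^\<theta>, and this is the function against which
  the field has to be bounded.\<close>

lemma fundamental_inequality:
  fixes A B c :: real
  assumes u: "u \<in> tests" and \<gamma>: "adm \<gamma>" and c: "c \<ge> 0"
  defines "\<theta> \<equiv> (\<gamma> - b) / p"
  assumes field: "\<And>(y::real^'k) (x::real^'m). y \<noteq> 0 \<Longrightarrow>
      norm (A *\<^sub>R y, B *\<^sub>R x) \<le> c * (norm y powr (1 - \<theta>) * norm (y, x) powr \<theta>)"
  shows "(A * CARD('k) + B * CARD('m) + (a - p - b + \<gamma>) * A - \<gamma> * B) * M \<gamma> u - \<gamma> * (A - B) * M (\<gamma> + 2) u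
    \<le> p * (c * (M \<gamma> u powr (1 - 1 / p) * E u powr (1 / p)))"
proof -
  define s where "s = a - p - b + \<gamma>"
  define G where "G z = \<bar>u z\<bar> powr (p - 1) * sgn (u z) * (gradient u z \<bullet> (A *\<^sub>R fst z, B *\<^sub>R snd z))" for z
  define f where "f z = weight s (- \<gamma>) z * \<bar>u z\<bar> powr p" for z
  define g where "g z = weight a (- b) z * norm (gradient u z) powr p" for z
  note [measurable] = test_functions_measurable[OF u] gradient_measurable[OF u]
  have intG: "integrable lborel (\<lambda>z. weight s (- \<gamma>) z * G z)"
    using dilation_identity(1)[OF u \<gamma>] by (simp add: G_def s_def)
  have pt: "\<bar>weight s (- \<gamma>) z * G z\<bar> \<le> c * (f z powr (1 - 1 / p) * g z powr (1 / p))" for z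
  proof (cases "fst z = 0")
    case True
    then show ?thesis by (simp add: weight_def f_def)
  next
    case False
    then have z: "norm (fst z) > 0" "norm z > 0" by auto
    have "\<bar>gradient u z \<bullet> (A *\<^sub>R fst z, B *\<^sub>R snd z)\<bar> \<le> norm (gradient u z) * norm (A *\<^sub>R fst z, B *\<^sub>R snd z)"
      by (rule Cauchy_Schwarz_ineq2)
    also have "\<dots> \<le> norm (gradient u z) * (c * (norm (fst z) powr (1 - \<theta>) * norm z powr \<theta>))"
      using field[OF False, of "snd z"] by (intro mult_left_mono) auto
    finally have "\<bar>u z\<bar> powr (p - 1) * \<bar>gradient u z \<bullet> (A *\<^sub>R fst z, B *\<^sub>R snd z)\<bar> \<le>
      \<bar>u z\<bar> powr (p - 1) * (norm (gradient u z) * (c * (norm (fst z) powr (1 - \<theta>) * norm z powr \<theta>)))"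
      by (rule mult_left_mono) simp
    moreover have "\<bar>G z\<bar> \<le> \<bar>u z\<bar> powr (p - 1) * \<bar>gradient u z \<bullet> (A *\<^sub>R fst z, B *\<^sub>R snd z)\<bar>"
      by (simp add: G_def abs_mult abs_sgn_eq)
    ultimately have "\<bar>G z\<bar> \<le> \<bar>u z\<bar> powr (p - 1) * (norm (gradient u z) * (c * (norm (fst z) powr (1 - \<theta>) * norm z powr \<theta>)))"
      by linarith
    then have "\<bar>weight s (- \<gamma>) z * G z\<bar> \<le> weight s (- \<gamma>) z *
       (\<bar>u z\<bar> powr (p - 1) * (norm (gradient u z) * (c * (norm (fst z) powr (1 - \<theta>) * norm z powr \<theta>))))"
      by (simp add: abs_mult mult_left_mono)
    also have "\<dots> = c * (f z powr (1 - 1 / p) * g z powr (1 / p))"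
    proof -
      have e1: "s * (1 - 1 / p) + a * (1 / p) = s + (1 - \<theta>)" "- \<gamma> * (1 - 1 / p) + - b * (1 / p) = - \<gamma> + \<theta>"
        "p * (1 - 1 / p) = p - 1" "p * (1 / p) = 1"
        using p by (simp_all add: \<theta>_def s_def field_simps)
      have "f z powr (1 - 1 / p) * g z powr (1 / p) =
        (norm (fst z) powr (s * (1 - 1 / p)) * norm (fst z) powr (a * (1 / p))) *
        (norm z powr (- \<gamma> * (1 - 1 / p)) * norm z powr (- b * (1 / p))) *
        (\<bar>u z\<bar> powr (p * (1 - 1 / p)) * norm (gradient u z) powr (p * (1 / p)))"
        unfolding f_def g_def weight_def by (simp only: powr_mult powr_powr mult_ac)
      also have "\<dots> = norm (fst z) powr (s + (1 - \<theta>)) * norm z powr (- \<gamma> + \<theta>) * (\<bar>u z\<bar> powr (p - 1) * norm (gradient u z))"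
        by (simp only: powr_add[symmetric] e1) simp
      finally show ?thesis unfolding weight_def by (simp only: powr_add mult_ac)
    qed
    finally show ?thesis .
  qed
  have A1: "(\<integral>\<^sup>+z. f z \<partial>lborel) \<le> ennreal (M \<gamma> u)"
    using nn_integral_eq_integral[OF mass_integrable[OF u \<gamma>]] by (simp add: M_def f_def s_def)
  have A2: "(\<integral>\<^sup>+z. g z \<partial>lborel) \<le> ennreal (E u)"
    using nn_integral_eq_integral[OF energy_integrable[OF u]] by (simp add: E_def g_def)
  have "ennreal \<bar>\<integral>z. weight s (- \<gamma>) z * G z \<partial>lborel\<bar> \<le> ennreal (\<integral>z. \<bar>weight s (- \<gamma>) z * G z\<bar> \<partial>lborel)"
    by (intro ennreal_leI integral_abs_bound)
  also have "\<dots> = (\<integral>\<^sup>+z. \<bar>weight s (- \<gamma>) z * G z\<bar> \<partial>lborel)"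
    using intG by (intro nn_integral_eq_integral[symmetric]) auto
  also have "\<dots> \<le> (\<integral>\<^sup>+z. ennreal c * ennreal (f z powr (1 - 1 / p) * g z powr (1 / p)) \<partial>lborel)"
    using pt c by (intro nn_integral_mono) (simp add: ennreal_mult'[symmetric])
  also have "\<dots> = ennreal c * (\<integral>\<^sup>+z. f z powr (1 - 1 / p) * g z powr (1 / p) \<partial>lborel)"
    by (rule nn_integral_cmult) (simp add: f_def g_def)
  also have "\<dots> \<le> ennreal c * ennreal (M \<gamma> u powr (1 - 1 / p) * E u powr (1 / p))"
    by (rule mult_left_mono[OF nn_integral_Holder[OF _ _ _ _ _ _ A1 M_nonneg A2 E_nonneg]])
      (use p in \<open>simp_all add: f_def g_def\<close>)
  finally have "\<bar>\<integral>z. weight s (- \<gamma>) z * G z \<partial>lborel\<bar> \<le> c * (M \<gamma> u powr (1 - 1 / p) * E u powr (1 / p))"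
    using c by (simp add: ennreal_mult'[symmetric])
  then have "p * - (\<integral>z. weight s (- \<gamma>) z * G z \<partial>lborel) \<le> p * (c * (M \<gamma> u powr (1 - 1 / p) * E u powr (1 / p)))"
    using p by (intro mult_left_mono) auto
  then show ?thesis
    using dilation_identity(2)[OF u \<gamma>, of A B] by (simp add: G_def s_def)
qed

section \<open>Dependence of the best constant on \<open>\<gamma>\<close>\<close>

definition S :: "real \<Rightarrow> real" where
  "S \<gamma> = enn2real (S_const tk tm p a b \<gamma>)"

lemma quotient_eq:
  assumes "u \<in> tests" "u \<noteq> (\<lambda>_. 0)" "adm \<gamma>"
  shows "weighted_energy p a b u / weighted_mass p a b \<gamma> u = ennreal (E u / M \<gamma> u)"
  using assms M_pos[OF assms] E_nonneg by (simp add: weighted_mass_eq weighted_energy_eq divide_ennreal)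

text \<open>A nonzero test function has positive mass and finite energy, so the infimum is finite
  and \<open>enn2real\<close> loses nothing.\<close>

lemma S_const_eq:
  assumes "adm \<gamma>"
  shows "S_const tk tm p a b \<gamma> = ennreal (S \<gamma>)"
proof -
  obtain u where u: "u \<in> tests" "u \<noteq> (\<lambda>_. 0)" using test_functions_nontrivial by blast
  then have "S_const tk tm p a b \<gamma> \<le> weighted_energy p a b u / weighted_mass p a b \<gamma> u"
    unfolding S_const_def by (intro INF_lower) auto
  also have "\<dots> < \<infinity>" using quotient_eq[OF u assms] by simp
  finally show ?thesis by (simp add: S_def)
qed

lemma S_nonneg: "S \<gamma> \<ge> 0"
  by (simp add: S_def)

lemma S_le:
  assumes u: "u \<in> tests" "u \<noteq> (\<lambda>_. 0)" and \<gamma>: "adm \<gamma>"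
  shows "S \<gamma> * M \<gamma> u \<le> E u"
proof -
  have "S_const tk tm p a b \<gamma> \<le> weighted_energy p a b u / weighted_mass p a b \<gamma> u"
    unfolding S_const_def using u by (intro INF_lower) auto
  then have "S \<gamma> \<le> E u / M \<gamma> u"
    unfolding quotient_eq[OF u \<gamma>] S_const_eq[OF \<gamma>] using M_nonneg E_nonneg by simp
  then show ?thesis using M_pos[OF u \<gamma>] by (simp add: pos_le_divide_eq)
qed

lemma S_approx:
  assumes "adm \<gamma>" "c > S \<gamma>"
  obtains u where "u \<in> tests" "u \<noteq> (\<lambda>_. 0)" "E u < c * M \<gamma> u"
proof -
  have "S_const tk tm p a b \<gamma> < ennreal c"
    using assms S_nonneg[of \<gamma>] by (simp add: S_const_eq ennreal_less_iff)
  then obtain u where u: "u \<in> tests" "u \<noteq> (\<lambda>_. 0)"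
    "weighted_energy p a b u / weighted_mass p a b \<gamma> u < ennreal c"
    unfolding S_const_def by (subst (asm) INF_less_iff) auto
  then have "E u / M \<gamma> u < c"
    unfolding quotient_eq[OF u(1,2) assms(1)] using M_nonneg E_nonneg by (simp add: ennreal_less_iff)
  then have "E u < c * M \<gamma> u" using M_pos[OF u(1,2) assms(1)] by (simp add: pos_divide_less_eq)
  with u show thesis using that by blast
qed

lemma S_greatest:
  assumes \<gamma>: "adm \<gamma>" and "\<And>u. u \<in> tests \<Longrightarrow> u \<noteq> (\<lambda>_. 0) \<Longrightarrow> c * M \<gamma> u \<le> E u"
  shows "c \<le> S \<gamma>"
proof (rule ccontr)
  assume "\<not> c \<le> S \<gamma>"
  then obtain u where "u \<in> tests" "u \<noteq> (\<lambda>_. 0)" "E u < c * M \<gamma> u" using S_approx[OF \<gamma>, of c] by auto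
  then show False using assms(2)[of u] by simp
qed

lemma adm_mono: "adm \<gamma> \<Longrightarrow> \<gamma> \<le> \<gamma>' \<Longrightarrow> adm \<gamma>'"
  by (simp add: adm_def)

text \<open>Raising \<gamma> multiplies the weight by a nonnegative power of |y| / |z|, which is at
  most 1.\<close>

lemma M_antimono:
  assumes u: "u \<in> tests" and "adm \<gamma>" "\<gamma> \<le> \<gamma>'"
  shows "M \<gamma>' u \<le> M \<gamma> u"
  unfolding M_def
proof (rule integral_mono)
  fix z :: "(real^'k) \<times> (real^'m)"
  have "weight (a - p - b + \<gamma>') (- \<gamma>') z \<le> weight (a - p - b + \<gamma>) (- \<gamma>) z"
  proof (cases "fst z = 0")
    case False
    then have z: "norm (fst z) > 0" "norm z > 0" by auto
    have "norm (fst z) \<le> norm z" using norm_fst_le[of "fst z" "snd z"] by simp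
    then have r: "norm (fst z) powr (\<gamma>' - \<gamma>) / norm z powr (\<gamma>' - \<gamma>) \<le> 1"
      using assms(3) z by (simp add: powr_mono2)
    have "weight (a - p - b + \<gamma>') (- \<gamma>') z =
        weight (a - p - b + \<gamma>) (- \<gamma>) z * (norm (fst z) powr (\<gamma>' - \<gamma>) / norm z powr (\<gamma>' - \<gamma>))"
      using z by (simp add: weight_def powr_minus_divide powr_add[symmetric] field_simps)
    then show ?thesis using mult_left_mono[OF r weight_nonneg, of "a - p - b + \<gamma>" "- \<gamma>" z] by simp
  qed (simp add: weight_def)
  then show "weight (a - p - b + \<gamma>') (- \<gamma>') z * \<bar>u z\<bar> powr p \<le> weight (a - p - b + \<gamma>) (- \<gamma>) z * \<bar>u z\<bar> powr p"
    by (rule mult_right_mono) simp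
qed (use mass_integrable adm_mono assms in blast)+

lemma S_mono:
  assumes "adm \<gamma>" "\<gamma> \<le> \<gamma>'"
  shows "S \<gamma> \<le> S \<gamma>'"
proof (rule S_greatest[OF adm_mono[OF assms]])
  fix u assume u: "u \<in> tests" "u \<noteq> (\<lambda>_. 0)"
  have "S \<gamma> * M \<gamma>' u \<le> S \<gamma> * M \<gamma> u"
    by (intro mult_left_mono M_antimono u assms S_nonneg)
  then show "S \<gamma> * M \<gamma>' u \<le> E u" using S_le[OF u assms(1)] by simp
qed

text \<open>The exponents in the weight are affine in \<gamma>, so the integrand at the intermediate
  value is the weighted geometric mean of the integrands at the two ends.\<close>

lemma M_log_convex:
  assumes u: "u \<in> tests" and "adm \<gamma>" "adm \<gamma>'" and t: "0 < t" "t < 1"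
  shows "M ((1 - t) * \<gamma> + t * \<gamma>') u \<le> M \<gamma> u powr (1 - t) * M \<gamma>' u powr t"
proof -
  define f where "f \<gamma> z = weight (a - p - b + \<gamma>) (- \<gamma>) z * \<bar>u z\<bar> powr p" for \<gamma> z
  note [measurable] = test_functions_measurable[OF u]
  have adm': "adm ((1 - t) * \<gamma> + t * \<gamma>')"
  proof -
    have "(1 - t) * (real CARD('k) + a - p - b + \<gamma>) + t * (real CARD('k) + a - p - b + \<gamma>') > 0"
      using assms add_pos_pos[OF mult_pos_pos[of "1 - t" "real CARD('k) + a - p - b + \<gamma>"]
          mult_pos_pos[of t "real CARD('k) + a - p - b + \<gamma>'"]] by (simp add: adm_def)
    then show ?thesis by (simp add: adm_def algebra_simps)
  qed
  have nn: "(\<integral>\<^sup>+z. f \<gamma> z \<partial>lborel) = ennreal (M \<gamma> u)" if "adm \<gamma>" for \<gamma>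
    using nn_integral_eq_integral[OF mass_integrable[OF u that]] by (simp add: M_def f_def)
  have "f ((1 - t) * \<gamma> + t * \<gamma>') z = f \<gamma> z powr (1 - t) * f \<gamma>' z powr t" for z
  proof -
    have e: "(a - p - b + \<gamma>) * (1 - t) + (a - p - b + \<gamma>') * t = a - p - b + ((1 - t) * \<gamma> + t * \<gamma>')"
      "- \<gamma> * (1 - t) + - \<gamma>' * t = - ((1 - t) * \<gamma> + t * \<gamma>')" "p * (1 - t) + p * t = p"
      by (simp_all add: algebra_simps)
    have "f \<gamma> z powr (1 - t) * f \<gamma>' z powr t =
       (norm (fst z) powr ((a - p - b + \<gamma>) * (1 - t)) * norm (fst z) powr ((a - p - b + \<gamma>') * t)) *
       (norm z powr (- \<gamma> * (1 - t)) * norm z powr (- \<gamma>' * t)) *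
       (\<bar>u z\<bar> powr (p * (1 - t)) * \<bar>u z\<bar> powr (p * t))"
      unfolding f_def weight_def by (simp only: powr_mult powr_powr mult_ac)
    also have "\<dots> = f ((1 - t) * \<gamma> + t * \<gamma>') z"
      unfolding f_def weight_def by (simp only: powr_add[symmetric] e)
    finally show ?thesis by simp
  qed
  then have "ennreal (M ((1 - t) * \<gamma> + t * \<gamma>') u) = (\<integral>\<^sup>+z. f \<gamma> z powr (1 - t) * f \<gamma>' z powr t \<partial>lborel)"
    using nn[OF adm'] by simp
  also have "\<dots> \<le> ennreal (M \<gamma> u powr (1 - t) * M \<gamma>' u powr t)"
    by (rule nn_integral_Holder[OF _ _ _ _ t]) (use assms nn M_nonneg in \<open>auto simp: f_def\<close>)
  finally show ?thesis by simp
qed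

text \<open>Rewrites the Hoelder product in \<open>fundamental_inequality\<close> as the mass times
  a root of the quotient E / M.\<close>

lemma powr_quotient:
  fixes m e :: real
  assumes "m > 0" "e \<ge> 0"
  shows "m powr (1 - 1 / p) * e powr (1 / p) = m * (e / m) powr (1 / p)"
  using assms by (simp add: powr_divide powr_diff)

section \<open>Positivity of the best constant\<close>

text \<open>The field z itself, A = B = 1: it is admissible with c = 1 because \<theta> \<ge> 1, and
  the term with M (\<gamma> + 2) u cancels. The local \<open>H\<close> is p times the number
  \<open>Hb\<close>, so the lower bound obtained is \<open>Hb\<close> to the power p.\<close>

lemma S_pos_large:
  assumes "\<gamma> \<ge> b + p"
  shows "S \<gamma> > 0"
proof -
  have \<gamma>: "adm \<gamma>" using assms ka by (simp add: adm_def)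
  define H where "H = real CARD('k) + real CARD('m) + a - p - b"
  have H: "H > 0" using dab by (simp add: H_def)
  have \<theta>: "(\<gamma> - b) / p \<ge> 1" using assms p by simp
  have "(H / p) powr p \<le> S \<gamma>"
  proof (rule S_greatest[OF \<gamma>])
    fix u assume u: "u \<in> tests" "u \<noteq> (\<lambda>_. 0)"
    have "((1::real) * CARD('k) + (1::real) * CARD('m) + (a - p - b + \<gamma>) * 1 - \<gamma> * 1) * M \<gamma> u - \<gamma> * (1 - 1) * M (\<gamma> + 2) u
      \<le> p * (1 * (M \<gamma> u powr (1 - 1 / p) * E u powr (1 / p)))"
    proof (rule fundamental_inequality[OF u(1) \<gamma>])
      fix y :: "real^'k" and x :: "real^'m" assume y: "y \<noteq> 0"
      have n: "norm y \<le> norm (y, x)" "norm y > 0" using norm_fst_le y by auto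
      have "norm (y, x) powr (1 - (\<gamma> - b) / p) \<le> norm y powr (1 - (\<gamma> - b) / p)"
        using \<theta> n by (intro powr_mono2') auto
      then have "norm (y, x) powr (1 - (\<gamma> - b) / p) * norm (y, x) powr ((\<gamma> - b) / p) \<le>
         norm y powr (1 - (\<gamma> - b) / p) * norm (y, x) powr ((\<gamma> - b) / p)"
        by (rule mult_right_mono) simp
      then show "norm (1 *\<^sub>R y, 1 *\<^sub>R x) \<le> 1 * (norm y powr (1 - (\<gamma> - b) / p) * norm (y, x) powr ((\<gamma> - b) / p))"
        using y by (simp add: powr_add[symmetric])
    qed simp
    then have "H * M \<gamma> u \<le> p * (M \<gamma> u * (E u / M \<gamma> u) powr (1 / p))"
      using powr_quotient[OF M_pos[OF u \<gamma>] E_nonneg, of u] by (simp add: H_def algebra_simps)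
    then have "H / p \<le> (E u / M \<gamma> u) powr (1 / p)"
      using M_pos[OF u \<gamma>] p by (simp add: field_simps)
    then have "(H / p) powr p \<le> ((E u / M \<gamma> u) powr (1 / p)) powr p"
      using H p by (intro powr_mono2) auto
    then have "(H / p) powr p \<le> E u / M \<gamma> u"
      using p M_nonneg[of \<gamma> u] E_nonneg[of u] by (simp add: powr_powr)
    then show "(H / p) powr p * M \<gamma> u \<le> E u"
      using M_pos[OF u \<gamma>] by (simp add: pos_le_divide_eq)
  qed
  moreover have "(H / p) powr p > 0" using H p by simp
  ultimately show ?thesis by linarith
qed

text \<open>The field (y, 0), A = 1 and B = 0: it is admissible with c = 1 as soon as \<theta> \<ge>
  0, and the coefficient \<kappa> of M \<gamma> u is positive by \<open>adm\<close>. The price is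
  the term \<gamma> M (\<gamma> + 2) u, which is at most |\<gamma>| E u / S (\<gamma> + 2) because
  the constant at \<gamma> + 2 is positive.\<close>

lemma S_pos_step:
  assumes \<gamma>: "adm \<gamma>" "\<gamma> \<ge> b" and S2: "S (\<gamma> + 2) > 0"
  shows "S \<gamma> > 0"
proof -
  define \<kappa> where "\<kappa> = real CARD('k) + (a - p - b + \<gamma>)"
  define C where "C = \<bar>\<gamma>\<bar> / S (\<gamma> + 2) + p"
  have \<kappa>: "\<kappa> > 0" using \<gamma> by (simp add: adm_def \<kappa>_def)
  have C: "C > 0" using p S2 by (simp add: C_def add_nonneg_pos)
  have \<gamma>2: "adm (\<gamma> + 2)" using \<gamma> by (simp add: adm_def)
  \<comment> \<open>With r = E u / M \<gamma> u, the inequality bounds \<kappa> by a linear term in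
    r plus p r^(1/p). For r < 1 one has r \<le> r^(1/p), whence \<kappa> \<le> C r^(1/p); the
    minimum with 1 covers r \<ge> 1.\<close>
  have "min 1 ((\<kappa> / C) powr p) \<le> S \<gamma>"
  proof (rule S_greatest[OF \<gamma>(1)])
    fix u assume u: "u \<in> tests" "u \<noteq> (\<lambda>_. 0)"
    have Mp: "M \<gamma> u > 0" by (rule M_pos[OF u \<gamma>(1)])
    define r where "r = E u / M \<gamma> u"
    have r0: "r \<ge> 0" using E_nonneg[of u] M_nonneg[of \<gamma> u] by (simp add: r_def)
    have "((1::real) * CARD('k) + (0::real) * CARD('m) + (a - p - b + \<gamma>) * 1 - \<gamma> * 0) * M \<gamma> u - \<gamma> * (1 - 0) * M (\<gamma> + 2) u
      \<le> p * (1 * (M \<gamma> u powr (1 - 1 / p) * E u powr (1 / p)))"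
    proof (rule fundamental_inequality[OF u(1) \<gamma>(1)])
      fix y :: "real^'k" and x :: "real^'m" assume y: "y \<noteq> 0"
      have n: "norm y \<le> norm (y, x)" "norm y > 0" using norm_fst_le y by auto
      have "norm y powr ((\<gamma> - b) / p) \<le> norm (y, x) powr ((\<gamma> - b) / p)"
        using n \<gamma> p by (intro powr_mono2) auto
      then have "norm y powr (1 - (\<gamma> - b) / p) * norm y powr ((\<gamma> - b) / p) \<le>
         norm y powr (1 - (\<gamma> - b) / p) * norm (y, x) powr ((\<gamma> - b) / p)"
        by (rule mult_left_mono) simp
      then show "norm (1 *\<^sub>R y, 0 *\<^sub>R x) \<le> 1 * (norm y powr (1 - (\<gamma> - b) / p) * norm (y, x) powr ((\<gamma> - b) / p))"
        using y by (simp add: powr_add[symmetric] norm_Pair)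
    qed simp
    then have main: "\<kappa> * M \<gamma> u \<le> \<gamma> * M (\<gamma> + 2) u + p * (M \<gamma> u * r powr (1 / p))"
      unfolding powr_quotient[OF Mp E_nonneg[of u]] by (simp add: \<kappa>_def r_def)
    have "M (\<gamma> + 2) u \<le> E u / S (\<gamma> + 2)"
      using S_le[OF u \<gamma>2] S2 by (simp add: pos_le_divide_eq mult.commute)
    also have "E u = r * M \<gamma> u" using Mp by (simp add: r_def)
    finally have "\<bar>\<gamma>\<bar> * M (\<gamma> + 2) u \<le> \<bar>\<gamma>\<bar> * (r * M \<gamma> u / S (\<gamma> + 2))"
      by (rule mult_left_mono) simp
    moreover have "\<gamma> * M (\<gamma> + 2) u \<le> \<bar>\<gamma>\<bar> * M (\<gamma> + 2) u" by (intro mult_right_mono M_nonneg) simp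
    ultimately have "\<kappa> * M \<gamma> u \<le> (\<bar>\<gamma>\<bar> / S (\<gamma> + 2) * r + p * r powr (1 / p)) * M \<gamma> u"
      using main by (simp add: algebra_simps)
    then have k: "\<kappa> \<le> \<bar>\<gamma>\<bar> / S (\<gamma> + 2) * r + p * r powr (1 / p)" using Mp by simp
    have "min 1 ((\<kappa> / C) powr p) \<le> r"
    proof (cases "r \<ge> 1")
      case False
      have "r \<le> r powr (1 / p)"
        using powr_mono'[of "1 / p" 1 r] False r0 p by (cases "r = 0") auto
      then have "\<bar>\<gamma>\<bar> / S (\<gamma> + 2) * r \<le> \<bar>\<gamma>\<bar> / S (\<gamma> + 2) * r powr (1 / p)"
        using S2 by (intro mult_left_mono) auto
      then have "\<kappa> \<le> C * r powr (1 / p)" using k by (simp add: C_def distrib_right)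
      then have "\<kappa> / C \<le> r powr (1 / p)" using C by (simp add: pos_divide_le_eq mult.commute)
      then have "(\<kappa> / C) powr p \<le> (r powr (1 / p)) powr p"
        using \<kappa> C p by (intro powr_mono2) auto
      then show ?thesis using p r0 by (simp add: powr_powr min_le_iff_disj)
    qed auto
    then show "min 1 ((\<kappa> / C) powr p) * M \<gamma> u \<le> E u"
      using Mp by (simp add: r_def pos_le_divide_eq)
  qed
  moreover have "min 1 ((\<kappa> / C) powr p) > 0" using \<kappa> C by simp
  ultimately show ?thesis by linarith
qed

text \<open>Descent in steps of 2 from the range of \<open>S_pos_large\<close>: n counts enough
  steps to climb from \<gamma> above b + p.\<close>

lemma S_pos:
  assumes "adm \<gamma>" "\<gamma> \<ge> b"
  shows "S \<gamma> > 0"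
proof -
  have "adm \<gamma> \<Longrightarrow> \<gamma> \<ge> b \<Longrightarrow> \<gamma> + 2 * real n \<ge> b + p \<Longrightarrow> S \<gamma> > 0" for n \<gamma>
  proof (induction n arbitrary: \<gamma>)
    case 0
    then show ?case using S_pos_large by simp
  next
    case (Suc n)
    have "S (\<gamma> + 2) > 0" using Suc.prems by (intro Suc.IH) (auto intro: adm_mono)
    then show ?case using S_pos_step Suc.prems by blast
  qed
  moreover obtain n :: nat where "b + p - \<gamma> \<le> real n" using real_arch_simple by blast
  then have "\<gamma> + 2 * real n \<ge> b + p" using of_nat_0_le_iff[of n, where 'a = real] by linarith
  ultimately show ?thesis using assms by blast
qed

section \<open>Concavity in \<gamma> and continuity\<close>

definition gammas :: "real set" where
  "gammas = {\<gamma>. \<gamma> > b \<and> real CARD('k) + a - p > b - \<gamma>}"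

lemma gammas_eq: "gammas = {max b (b - (real CARD('k) + a - p))<..}"
  by (auto simp: gammas_def)

lemma gammasD: "\<gamma> \<in> gammas \<Longrightarrow> adm \<gamma>" "\<gamma> \<in> gammas \<Longrightarrow> \<gamma> \<ge> b"
  by (auto simp: gammas_def adm_def)

lemma S_pos_gammas: "\<gamma> \<in> gammas \<Longrightarrow> S \<gamma> > 0"
  using S_pos gammasD by blast

text \<open>\<open>ln S\<close> is an infimum of functions \<open>ln E - ln M\<close> that are concave by Hoelder's inequality.\<close>

lemma convex_on_neg_ln_S: "convex_on gammas (\<lambda>\<gamma>. - ln (S \<gamma>))"
proof (rule convex_onI)
  show "convex gammas" by (simp add: gammas_eq)
  fix t \<gamma> \<gamma>' :: real assume t: "0 < t" "t < 1" and \<gamma>: "\<gamma> \<in> gammas" "\<gamma>' \<in> gammas"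
  let ?g = "(1 - t) * \<gamma> + t * \<gamma>'"
  have g: "?g \<in> gammas"
    using convexD_alt[of gammas \<gamma> \<gamma>' t] \<gamma> t by (simp add: gammas_eq)
  have "S \<gamma> powr (1 - t) * S \<gamma>' powr t \<le> S ?g"
  proof (rule S_greatest[OF gammasD(1)[OF g]])
    fix u assume u: "u \<in> tests" "u \<noteq> (\<lambda>_. 0)"
    have "S \<gamma> powr (1 - t) * S \<gamma>' powr t * M ?g u \<le>
        S \<gamma> powr (1 - t) * S \<gamma>' powr t * (M \<gamma> u powr (1 - t) * M \<gamma>' u powr t)"
      by (intro mult_left_mono M_log_convex u gammasD \<gamma> t) simp
    also have "\<dots> = (S \<gamma> * M \<gamma> u) powr (1 - t) * (S \<gamma>' * M \<gamma>' u) powr t"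
      by (simp add: powr_mult)
    also have "\<dots> \<le> E u powr (1 - t) * E u powr t"
      using S_le[OF u] gammasD(1) \<gamma> t S_nonneg M_nonneg
      by (intro mult_mono powr_mono2) auto
    also have "\<dots> = E u" using E_nonneg[of u] by (simp add: powr_add[symmetric])
    finally show "S \<gamma> powr (1 - t) * S \<gamma>' powr t * M ?g u \<le> E u" .
  qed
  then have "ln (S \<gamma> powr (1 - t) * S \<gamma>' powr t) \<le> ln (S ?g)"
    using S_pos_gammas[OF \<gamma>(1)] S_pos_gammas[OF \<gamma>(2)] S_pos_gammas[OF g]
    by (subst ln_le_cancel_iff) auto
  then show "- ln (S ((1 - t) *\<^sub>R \<gamma> + t *\<^sub>R \<gamma>')) \<le> (1 - t) * - ln (S \<gamma>) + t * - ln (S \<gamma>')"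
    using S_pos_gammas[OF \<gamma>(1)] S_pos_gammas[OF \<gamma>(2)] by (simp add: ln_mult ln_powr)
qed

text \<open>A convex function is continuous on an open interval, and \<open>gammas\<close> is an
  open half-line by \<open>gammas_eq\<close>.\<close>

lemma continuous_on_S: "continuous_on gammas S"
proof -
  have "continuous_on gammas (\<lambda>\<gamma>. - ln (S \<gamma>))"
    by (rule convex_on_continuous[OF _ convex_on_neg_ln_S]) (simp add: gammas_eq)
  then have "continuous_on gammas (\<lambda>\<gamma>. exp (- (- ln (S \<gamma>))))"
    by (rule continuous_on_exp[OF continuous_on_minus])
  then show ?thesis
    by (rule continuous_on_eq) (use S_pos_gammas in auto)
qed

section \<open>Strict monotonicity\<close>

text \<open>The field (0, x) is admissible with a constant that decays as \<theta> grows. With X =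
  |x|^2 and Y = |y|^2, Bernoulli's inequality gives \<theta> X / Y \<le> (1 + X / Y)^\<theta>;
  multiplying by Y and taking square roots yields the factor \<theta>^(-1/2).\<close>

lemma perp_field_bound:
  fixes y :: "real^'k" and x :: "real^'m"
  assumes y: "y \<noteq> 0" and \<theta>: "\<theta> \<ge> 1"
  shows "norm x \<le> \<theta> powr (- 1 / 2) * (norm y powr (1 - \<theta>) * norm (y, x) powr \<theta>)"
proof -
  define Y where "Y = (norm y)\<^sup>2"
  define X where "X = (norm x)\<^sup>2"
  have Y: "Y > 0" using y by (simp add: Y_def)
  have X: "X \<ge> 0" by (simp add: X_def)
  have N: "norm (y, x) = (Y + X) powr (1 / 2)"
    by (simp add: norm_Pair Y_def X_def powr_half_sqrt)
  have pos: "1 + \<theta> * (X / Y) > 0" using X Y \<theta> by (simp add: add_pos_nonneg)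
  \<comment> \<open>Bernoulli's inequality in the form (1 + \<theta> v)^(1/\<theta>) \<le> 1 + v,
    from Young's inequality with second factor 1.\<close>
  have "(1 + \<theta> * (X / Y)) powr (1 / \<theta>) * 1 powr (1 - 1 / \<theta>) \<le>
      1 / \<theta> * (1 + \<theta> * (X / Y)) + (1 - 1 / \<theta>) * 1"
    by (rule Youngs_inequality_0) (use pos \<theta> in auto)
  also have "\<dots> = 1 + X / Y"
    using \<theta> by (simp add: distrib_left)
  finally have "(1 + \<theta> * (X / Y)) powr (1 / \<theta>) \<le> 1 + X / Y" by simp
  then have "((1 + \<theta> * (X / Y)) powr (1 / \<theta>)) powr \<theta> \<le> (1 + X / Y) powr \<theta>"
    using \<theta> by (intro powr_mono2) auto
  then have "1 + \<theta> * (X / Y) \<le> (1 + X / Y) powr \<theta>"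
    using \<theta> pos by (simp add: powr_powr)
  then have "\<theta> * (X / Y) \<le> (1 + X / Y) powr \<theta>" by linarith
  also have "1 + X / Y = (Y + X) / Y" using Y by (simp add: field_simps)
  also have "((Y + X) / Y) powr \<theta> = (Y + X) powr \<theta> * Y powr - \<theta>"
    using powr_divide[of "Y + X" Y \<theta>] X Y by (simp add: powr_minus divide_inverse)
  finally have "\<theta> * X \<le> Y * ((Y + X) powr \<theta> * Y powr - \<theta>)"
    using Y by (simp add: pos_divide_le_eq mult.commute)
  also have "\<dots> = Y powr (1 - \<theta>) * (Y + X) powr \<theta>"
    using Y by (simp add: powr_diff powr_minus divide_inverse)
  finally have "X \<le> \<theta> powr - 1 * (Y powr (1 - \<theta>) * (Y + X) powr \<theta>)"
    using \<theta> by (simp add: powr_minus_divide pos_le_divide_eq mult.commute)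
  then have "X powr (1 / 2) \<le> (\<theta> powr - 1 * (Y powr (1 - \<theta>) * (Y + X) powr \<theta>)) powr (1 / 2)"
    using X by (intro powr_mono2) auto
  also have "\<dots> = \<theta> powr (- 1 / 2) * (norm y powr (1 - \<theta>) * norm (y, x) powr \<theta>)"
  proof -
    have ny: "norm y = Y powr (1 / 2)" by (simp add: Y_def powr_half_sqrt)
    show ?thesis unfolding ny N powr_mult powr_powr by (simp add: mult.commute)
  qed
  also have "X powr (1 / 2) = norm x" by (simp add: X_def powr_half_sqrt)
  finally show ?thesis .
qed

text \<open>With the field \<open>(0, x)\<close>: if \<open>S\<close> were constant from some point on, a near minimiser for \<open>\<gamma> + 2\<close> would
  have \<open>M \<gamma> u\<close> close to \<open>M (\<gamma> + 2) u\<close>, leaving \<open>CARD('m) = O(\<gamma>\<^sup>-\<^sup>1\<^sup>/\<^sup>2)\<close>.\<close>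

lemma S_not_eventually_constant:
  assumes "\<And>\<gamma>. \<gamma> \<ge> \<gamma>0 \<Longrightarrow> S \<gamma> = s" and \<gamma>0: "\<gamma>0 \<in> gammas"
  shows False
proof -
  have s: "s > 0" using assms S_pos_gammas[OF \<gamma>0] by force
  \<comment> \<open>Since E u / M \<gamma> u will be at most 2 s, the Hoelder term is at most
    \<theta>^(-1/2) B M \<gamma> u.\<close>
  define B where "B = p * (2 * s) powr (1 / p)"
  have B: "B > 0" using s p by (simp add: B_def)
  \<comment> \<open>Large enough for \<theta> \<ge> 1, as \<open>perp_field_bound\<close> requires,
    and for \<theta> \<ge> 4 B^2, which makes the Hoelder term at most M \<gamma> u / 2.\<close>
  define \<gamma> where "\<gamma> = max (max \<gamma>0 1) (max (b + p) (b + p * (4 * B\<^sup>2)))"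
  define \<theta> where "\<theta> = (\<gamma> - b) / p"
  have \<gamma>: "\<gamma> \<ge> \<gamma>0" "\<gamma> \<ge> 1" "\<gamma> \<ge> b + p" "\<gamma> \<ge> b + p * (4 * B\<^sup>2)" by (simp_all add: \<gamma>_def)
  have \<theta>: "\<theta> \<ge> 1" "\<theta> \<ge> 4 * B\<^sup>2" using \<gamma> p by (simp_all add: \<theta>_def pos_le_divide_eq mult.commute)
  have adm: "adm \<gamma>" "adm (\<gamma> + 2)" using gammasD(1)[OF \<gamma>0] \<gamma>(1) adm_mono by auto
  have S: "S \<gamma> = s" "S (\<gamma> + 2) = s" using assms(1) \<gamma>(1) by auto
  \<comment> \<open>This closeness to the infimum makes \<gamma> (M \<gamma> u - M (\<gamma> + 2) u)
    at most M \<gamma> u / 4. Together with the 1/2 from the Hoelder term the total is 3/4, below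
    \<open>CARD('m)\<close>, which is at least 1.\<close>
  define e where "e = 1 / (4 * \<gamma>)"
  have e: "e > 0" "e \<le> 1" "\<gamma> * e = 1 / 4" using \<gamma>(2) by (simp_all add: e_def)
  have "s * (1 + e) > S (\<gamma> + 2)" using S s e by simp
  then obtain u where u: "u \<in> tests" "u \<noteq> (\<lambda>_. 0)" "E u < s * (1 + e) * M (\<gamma> + 2) u"
    using S_approx[OF adm(2)] by metis
  have Mp: "M \<gamma> u > 0" by (rule M_pos[OF u(1,2) adm(1)])
  have M2: "M (\<gamma> + 2) u \<le> M \<gamma> u" by (rule M_antimono[OF u(1) adm(1)]) simp
  have "s * M \<gamma> u < s * ((1 + e) * M (\<gamma> + 2) u)" using S_le[OF u(1,2) adm(1)] S u(3) by (simp add: mult.assoc)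
  then have "M \<gamma> u < (1 + e) * M (\<gamma> + 2) u" using s by simp
  also have "\<dots> \<le> M (\<gamma> + 2) u + e * M \<gamma> u" using M2 e by (simp add: distrib_right)
  finally have "\<gamma> * (M \<gamma> u - M (\<gamma> + 2) u) \<le> \<gamma> * (e * M \<gamma> u)" using \<gamma>(2) by (intro mult_left_mono) auto
  also have "\<dots> = M \<gamma> u / 4" using e(3) by (simp add: mult.assoc[symmetric])
  finally have diff: "\<gamma> * (M \<gamma> u - M (\<gamma> + 2) u) \<le> M \<gamma> u / 4" .
  have "((0::real) * CARD('k) + (1::real) * CARD('m) + (a - p - b + \<gamma>) * 0 - \<gamma> * 1) * M \<gamma> u - \<gamma> * (0 - 1) * M (\<gamma> + 2) u
      \<le> p * (\<theta> powr (- 1 / 2) * (M \<gamma> u powr (1 - 1 / p) * E u powr (1 / p)))"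
    by (rule fundamental_inequality[OF u(1) adm(1)])
      (use perp_field_bound \<theta> in \<open>auto simp: \<theta>_def[symmetric] norm_Pair\<close>)
  then have main: "CARD('m) * M \<gamma> u \<le> \<gamma> * (M \<gamma> u - M (\<gamma> + 2) u) + p * (\<theta> powr (- 1 / 2) * (M \<gamma> u * (E u / M \<gamma> u) powr (1 / p)))"
    unfolding powr_quotient[OF Mp E_nonneg[of u]] by (simp add: algebra_simps)
  have "E u \<le> s * (1 + e) * M \<gamma> u"
    by (rule order_trans[OF less_imp_le[OF u(3)] mult_left_mono[OF M2]]) (use s e in simp)
  also have "\<dots> \<le> 2 * s * M \<gamma> u" using s e Mp by (intro mult_right_mono) auto
  finally have "E u / M \<gamma> u \<le> 2 * s" using Mp by (simp add: pos_divide_le_eq)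
  then have "(E u / M \<gamma> u) powr (1 / p) \<le> (2 * s) powr (1 / p)"
    using p E_nonneg[of u] Mp by (intro powr_mono2) auto
  then have "p * (\<theta> powr (- 1 / 2) * (M \<gamma> u * (E u / M \<gamma> u) powr (1 / p))) \<le> p * (\<theta> powr (- 1 / 2) * (M \<gamma> u * (2 * s) powr (1 / p)))"
    using p Mp by (intro mult_left_mono) auto
  also have "\<dots> = \<theta> powr (- 1 / 2) * B * M \<gamma> u" by (simp add: B_def)
  also have "\<dots> \<le> 1 / 2 * M \<gamma> u"
  proof (intro mult_right_mono)
    have "(2 * B) powr 2 \<le> \<theta>" using \<theta> B by (simp add: power_mult_distrib)
    then have "((2 * B) powr 2) powr (1 / 2) \<le> \<theta> powr (1 / 2)" by (intro powr_mono2) auto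
    then have "2 * B \<le> \<theta> powr (1 / 2)" using B by (subst (asm) powr_powr) simp
    moreover have "\<theta> powr (1 / 2) > 0" using \<theta> by simp
    ultimately show "\<theta> powr (- 1 / 2) * B \<le> 1 / 2"
      by (simp add: powr_minus_divide[of \<theta> "1 / 2"] field_simps)
  qed (use Mp in simp)
  finally have "CARD('m) * M \<gamma> u \<le> 3 / 4 * M \<gamma> u" using main diff by simp
  then have "real CARD('m) \<le> 3 / 4" using Mp by simp
  moreover have "CARD('m) \<ge> 1" by (simp add: Suc_leI)
  ultimately show False by simp
qed

text \<open>If S agrees at \<gamma> and \<gamma>', then for any larger \<eta> concavity of ln S,
  with \<gamma>' between \<gamma> and \<eta>, gives S \<eta> \<le> S \<gamma>'; monotonicity gives
  the converse, so S is constant from \<gamma>' on.\<close>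

lemma S_strict_mono:
  assumes \<gamma>: "\<gamma> \<in> gammas" and "\<gamma> < \<gamma>'"
  shows "S \<gamma> < S \<gamma>'"
proof (rule ccontr)
  assume "\<not> S \<gamma> < S \<gamma>'"
  then have eq: "S \<gamma>' = S \<gamma>" using S_mono[OF gammasD(1)[OF \<gamma>], of \<gamma>'] assms by simp
  have up: "\<eta> \<in> gammas" if "\<eta> \<ge> \<gamma>" for \<eta> using \<gamma> that by (auto simp: gammas_eq)
  have "S \<eta> = S \<gamma>'" if \<eta>: "\<eta> \<ge> \<gamma>'" for \<eta>
  proof (cases "\<eta> = \<gamma>'")
    case False
    then have \<eta>: "\<eta> > \<gamma>'" using \<eta> by simp
    define t where "t = (\<gamma>' - \<gamma>) / (\<eta> - \<gamma>)"
    have t: "0 < t" "t < 1" using assms \<eta> by (simp_all add: t_def)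
    have "t * (\<eta> - \<gamma>) = \<gamma>' - \<gamma>" using assms \<eta> by (simp add: t_def)
    then have g': "(1 - t) *\<^sub>R \<gamma> + t *\<^sub>R \<eta> = \<gamma>'" by (simp add: algebra_simps)
    have "- ln (S \<gamma>') \<le> (1 - t) * - ln (S \<gamma>) + t * - ln (S \<eta>)"
      using convex_onD[OF convex_on_neg_ln_S, of t \<gamma> \<eta>] t up assms \<eta> unfolding g' by simp
    then have "t * ln (S \<eta>) \<le> t * ln (S \<gamma>')" unfolding eq by (simp add: algebra_simps)
    then have "ln (S \<eta>) \<le> ln (S \<gamma>')" using t by simp
    moreover have "S \<eta> > 0" "S \<gamma>' > 0" using S_pos_gammas up assms \<eta> by simp_all
    ultimately have "S \<eta> \<le> S \<gamma>'" by simp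
    moreover have "S \<gamma>' \<le> S \<eta>" using S_mono[of \<gamma>' \<eta>] gammasD(1) up assms \<eta> by simp
    ultimately show ?thesis by simp
  qed simp
  moreover have "\<gamma>' \<in> gammas" using up assms by simp
  ultimately show False by (rule S_not_eventually_constant)
qed

end

section \<open>Functions on the sphere\<close>

lemma gradientI:
  assumes "(f has_derivative (\<lambda>h. v \<bullet> h)) (at x)"
  shows "gradient f x = v"
  unfolding gradient_def has_derivative_frechetI[OF assms] by (rule euclidean_representation)

lemma has_derivative_sgn_sphere:
  fixes \<sigma> :: "'a::euclidean_space"
  assumes "norm \<sigma> = 1"
  shows "(sgn has_derivative (\<lambda>h. h - (\<sigma> \<bullet> h) *\<^sub>R \<sigma>)) (at \<sigma>)"
proof -
  have s: "sgn \<sigma> = \<sigma>" "\<sigma> \<noteq> 0" using assms by (auto simp: sgn_div_norm)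
  have n: "(norm has_derivative (\<lambda>h. h \<bullet> \<sigma>)) (at \<sigma>)"
    using has_derivative_norm[OF s(2)] s by simp
  have "((\<lambda>z. inverse (norm z) *\<^sub>R z) has_derivative (\<lambda>h. h - (\<sigma> \<bullet> h) *\<^sub>R \<sigma>)) (at \<sigma>)"
    by (rule has_derivative_eq_rhs[OF has_derivative_scaleR[OF Deriv.has_derivative_inverse[OF _ n] has_derivative_ident]])
      (use assms in \<open>auto simp: inner_commute\<close>)
  then show ?thesis by (simp add: sgn_div_norm[abs_def])
qed

lemma gradient_sgn_compose:
  fixes f :: "'a::euclidean_space \<Rightarrow> real"
  assumes "norm \<sigma> = 1" "f differentiable at (c *\<^sub>R \<sigma>)"
  shows "gradient (\<lambda>z. f (c *\<^sub>R sgn z)) \<sigma> =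
    c *\<^sub>R (gradient f (c *\<^sub>R \<sigma>) - (\<sigma> \<bullet> gradient f (c *\<^sub>R \<sigma>)) *\<^sub>R \<sigma>)"
proof (rule gradientI)
  have s: "sgn \<sigma> = \<sigma>" using assms by (auto simp: sgn_div_norm)
  have "((\<lambda>z. c *\<^sub>R sgn z) has_derivative (\<lambda>h. c *\<^sub>R (h - (\<sigma> \<bullet> h) *\<^sub>R \<sigma>))) (at \<sigma>)"
    by (intro derivative_intros has_derivative_sgn_sphere assms)
  then have "((\<lambda>z. f (c *\<^sub>R sgn z)) has_derivative
      (\<lambda>h. frechet_derivative f (at (c *\<^sub>R \<sigma>)) (c *\<^sub>R (h - (\<sigma> \<bullet> h) *\<^sub>R \<sigma>)))) (at \<sigma>)"
    by (rule has_derivative_compose) (use frechet_has_derivative[OF assms(2)] s in simp)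
  then show "((\<lambda>z. f (c *\<^sub>R sgn z)) has_derivative
      (\<lambda>h. c *\<^sub>R (gradient f (c *\<^sub>R \<sigma>) - (\<sigma> \<bullet> gradient f (c *\<^sub>R \<sigma>)) *\<^sub>R \<sigma>) \<bullet> h)) (at \<sigma>)"
    unfolding frechet_derivative_eq_gradient[OF assms(2)]
    by (rule has_derivative_eq_rhs) (auto simp: algebra_simps inner_commute)
qed

text \<open>Pythagoras for the tangential and radial parts of the gradient. For c = e^t the pair
  consists of the spherical gradient and the t-derivative of f (e^t \<sigma>), that is, of the
  gradient in logarithmic polar coordinates.\<close>

lemma norm_gradient_polar:
  fixes f :: "'a::euclidean_space \<Rightarrow> real"
  assumes "norm \<sigma> = 1" "f differentiable at (c *\<^sub>R \<sigma>)" "c \<ge> 0"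
  shows "norm (gradient (\<lambda>z. f (c *\<^sub>R sgn z)) \<sigma>, gradient f (c *\<^sub>R \<sigma>) \<bullet> (c *\<^sub>R \<sigma>)) =
    c * norm (gradient f (c *\<^sub>R \<sigma>))"
proof -
  let ?g = "gradient f (c *\<^sub>R \<sigma>)"
  have s: "\<sigma> \<bullet> \<sigma> = 1" using assms(1) by (simp add: dot_square_norm)
  have "(norm (c *\<^sub>R (?g - (\<sigma> \<bullet> ?g) *\<^sub>R \<sigma>)))\<^sup>2 + (?g \<bullet> (c *\<^sub>R \<sigma>))\<^sup>2 = c\<^sup>2 * (?g \<bullet> ?g)"
    unfolding dot_square_norm[symmetric]
    by (simp add: inner_diff_left inner_diff_right s inner_commute power2_eq_square algebra_simps)
  then show ?thesis
    unfolding gradient_sgn_compose[OF assms(1,2)] norm_Pair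
    using assms(3) by (simp add: dot_square_norm real_sqrt_mult)
qed

lemma smooth_sphere_continuous:
  assumes "smooth_sphere \<psi>"
  shows "continuous_on (sphere 0 1) \<psi>" "continuous_on (sphere 0 1) (sphere_gradient \<psi>)"
proof -
  have s: "smooth_on (- {0}) (\<psi> \<circ> sgn)" using assms by (simp add: smooth_sphere_def)
  have sub: "sphere 0 1 \<subseteq> - {0 :: 'a}" by auto
  have "continuous_on (sphere 0 1) (\<psi> \<circ> sgn)"
    using smooth_on_continuous[OF s] sub by (rule continuous_on_subset)
  then show "continuous_on (sphere 0 1) \<psi>"
    by (rule continuous_on_eq) (auto simp: sgn_div_norm)
  have "continuous_on (sphere 0 1) (gradient (\<psi> \<circ> sgn))"
    using continuous_on_gradient[OF s] sub by (rule continuous_on_subset)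
  then show "continuous_on (sphere 0 1) (sphere_gradient \<psi>)"
    by (simp add: sphere_gradient_def[abs_def])
qed

lemma continuous_on_sphere_measurable:
  assumes "continuous_on (sphere 0 1) f"
  shows "f \<in> borel_measurable sphere_measure"
  using borel_measurable_continuous_on_restrict[OF assms]
  by (simp add: measurable_cong_sets[OF sets_sphere_measure refl])

lemma AE_sphere_fst_nonzero:
  "AE \<sigma> in sphere_measure. fst (\<sigma> :: (real^'k::finite) \<times> (real^'m::finite)) \<noteq> 0"
proof -
  let ?Z = "{z :: (real^'k) \<times> (real^'m). fst z = 0}"
  have [measurable]: "?Z \<in> sets borel"
    by (intro borel_closed closed_Collect_eq continuous_intros)
  have "(\<integral>\<^sup>+\<sigma>. indicator ?Z \<sigma> \<partial>sphere_measure) =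
      ennreal (DIM((real^'k) \<times> (real^'m))) * (\<integral>\<^sup>+z. indicator ?Z (sgn z) * indicator (ball 0 1 - {0}) z \<partial>lborel)"
    by (rule nn_integral_sphere_measure) (rule borel_measurable_sphere, measurable)
  also have "(\<integral>\<^sup>+z. indicator ?Z (sgn z) * indicator (ball 0 1 - {0}) z \<partial>lborel) = (\<integral>\<^sup>+(z::(real^'k) \<times> (real^'m)). 0 \<partial>lborel)"
    using AE_fst_nonzero
    by (intro nn_integral_cong_AE) (auto simp: sgn_div_norm indicator_def elim!: eventually_mono)
  finally have "(\<integral>\<^sup>+\<sigma>. indicator ?Z \<sigma> \<partial>sphere_measure) = 0" by simp
  then have "AE \<sigma> in sphere_measure. indicator ?Z \<sigma> = (0::ennreal)"
    by (subst (asm) nn_integral_0_iff_AE) (auto intro!: borel_measurable_sphere)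
  then show ?thesis by eventually_elim (auto simp: indicator_def split: if_splits)
qed

text \<open>Two limits in succession: e tends to 0 for fixed l, which removes the error even though
  Z l may blow up as l tends to 0, and only afterwards l tends to 0. This is the shape of every
  estimate obtained by splitting with \<open>powr_add_le_weighted\<close>.\<close>

lemma ennreal_le_limit:
  fixes X Y :: ennreal and c :: "real \<Rightarrow> real" and Z :: "real \<Rightarrow> ennreal"
  assumes X: "\<And>l e. 0 < l \<Longrightarrow> l < 1 \<Longrightarrow> 0 < e \<Longrightarrow> X \<le> ennreal (c l) * Y + ennreal e * Z l"
    and Z: "\<And>l. Z l < \<infinity>" and c: "(c \<longlongrightarrow> 1) (at_right 0)"
  shows "X \<le> Y"
proof (cases "Y = \<infinity>")
  case False
  have l: "X \<le> ennreal (c l) * Y" if "0 < l" "l < 1" for l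
  proof (rule ennreal_le_epsilon)
    fix e :: real assume e: "0 < e"
    define z where "z = enn2real (Z l)"
    have z: "Z l = ennreal z" "z \<ge> 0" using Z[of l] by (simp_all add: z_def)
    have "ennreal (e / (z + 1)) * Z l = ennreal (e / (z + 1) * z)"
      using e z by (simp add: ennreal_mult[symmetric])
    also have "\<dots> \<le> ennreal e"
      using e z by (intro ennreal_leI) (simp add: field_simps)
    finally have "ennreal (c l) * Y + ennreal (e / (z + 1)) * Z l \<le> ennreal (c l) * Y + ennreal e"
      by (rule add_left_mono)
    moreover have "e / (z + 1) > 0" using e z by simp
    ultimately show "X \<le> ennreal (c l) * Y + ennreal e"
      using X[OF that, of "e / (z + 1)"] by (meson order_trans)
  qed
  obtain y where y: "Y = ennreal y" "y \<ge> 0" using False by (cases Y) auto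
  have "((\<lambda>l. ennreal (c l * y)) \<longlongrightarrow> ennreal (1 * y)) (at_right 0)"
    by (intro tendsto_ennrealI tendsto_mult c tendsto_const)
  then have "((\<lambda>l. ennreal (c l) * Y) \<longlongrightarrow> Y) (at_right 0)"
    using y by (simp add: ennreal_mult'')
  then show ?thesis
    by (rule tendsto_lowerbound) (auto intro!: eventually_at_rightI[of 0 1] l)
qed simp

section \<open>Mass and energy in logarithmic polar coordinates\<close>

context hardy_weights
begin

definition H :: real where
  "H = Hb (real DIM((real^'k) \<times> (real^'m))) p a b"

lemma H_pos: "H > 0"
  using p dab by (simp add: H_def Hb_def)

lemma pH: "p * H = real (CARD('k) + CARD('m)) + a - p - b"
  using p by (simp add: H_def Hb_def)

text \<open>The radial rate is p H for every \<gamma>, so \<gamma> is visible only in the weight on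
  the sphere.\<close>

lemma weighted_mass_polar:
  assumes [measurable]: "u \<in> borel_measurable borel"
  shows "weighted_mass p a b \<gamma> u = (\<integral>\<^sup>+\<sigma>. \<omega> (a - p - b + \<gamma>) \<sigma> *
      (\<integral>\<^sup>+t. ennreal (exp (p * H * t) * \<bar>u (exp t *\<^sub>R \<sigma>)\<bar> powr p) \<partial>lborel) \<partial>\<Omega>)"
proof -
  have "weighted_mass p a b \<gamma> u = (\<integral>\<^sup>+z. ennreal (weight (a - p - b + \<gamma>) (- \<gamma>) z) * ennreal (\<bar>u z\<bar> powr p) \<partial>lborel)"
    by (simp add: weighted_mass_def weight_def ennreal_mult')
  moreover have "real (CARD('k) + CARD('m)) + (a - p - b + \<gamma>) + - \<gamma> = p * H" unfolding pH by simp
  ultimately show ?thesis by (subst (asm) nn_integral_weight_polar) (simp_all add: ennreal_mult')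
qed

text \<open>The energy weight leads to the rate p H + p; the surplus e^(p t) is absorbed into the
  gradient, whose norm in the coordinates (t, \<sigma>) is e^t times the Euclidean one.\<close>

lemma weighted_energy_polar:
  assumes [measurable]: "gradient u \<in> borel_measurable borel"
  shows "weighted_energy p a b u = (\<integral>\<^sup>+\<sigma>. \<omega> a \<sigma> *
      (\<integral>\<^sup>+t. ennreal (exp (p * H * t) * (exp t * norm (gradient u (exp t *\<^sub>R \<sigma>))) powr p) \<partial>lborel) \<partial>\<Omega>)"
proof -
  have "weighted_energy p a b u = (\<integral>\<^sup>+z. ennreal (weight a (- b) z) * ennreal (norm (gradient u z) powr p) \<partial>lborel)"
    by (simp add: weighted_energy_def weight_def ennreal_mult')
  moreover have "real (CARD('k) + CARD('m)) + a + - b = p * H + p" unfolding pH by simp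
  moreover have "exp (p * H * t) * (exp t * x) powr p = exp ((p * H + p) * t) * x powr p" if "x \<ge> 0" for t x
  proof -
    have "exp ((p * H + p) * t) = exp (p * H * t) * exp t powr p"
      by (simp add: exp_powr_real exp_add[symmetric] algebra_simps)
    then show ?thesis using that by (simp add: powr_mult)
  qed
  ultimately show ?thesis by (subst (asm) nn_integral_weight_polar) (simp_all add: ennreal_mult')
qed

lemma norm_proj_y [simp]: "norm (proj_y z) = norm (fst z)"
  by (simp add: proj_y_def norm_Pair)

lemma sphere_mass_eq:
  "sphere_mass p a b \<gamma> \<phi> = (\<integral>\<^sup>+\<sigma>. \<omega> (a - p - b + \<gamma>) \<sigma> * ennreal (\<bar>\<phi> \<sigma>\<bar> powr p) \<partial>\<Omega>)"
  by (simp add: sphere_mass_def ennreal_mult')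

text \<open>The bracket is the squared norm of the pair (G, H \<phi>), which makes triangle and
  convexity inequalities for norms available.\<close>

lemma sphere_energy_eq:
  "sphere_energy p a b \<phi> G = (\<integral>\<^sup>+\<sigma>. \<omega> a \<sigma> * ennreal (norm (G \<sigma>, H * \<phi> \<sigma>) powr p) \<partial>\<Omega>)"
proof -
  have "((norm g)\<^sup>2 + h\<^sup>2 * x\<^sup>2) powr (p / 2) = norm (g, h * x) powr p" for g :: "(real^'k) \<times> (real^'m)" and h x :: real
  proof -
    have "norm (g, h * x) = ((norm g)\<^sup>2 + h\<^sup>2 * x\<^sup>2) powr (1 / 2)"
      by (simp add: norm_Pair powr_half_sqrt power_mult_distrib)
    then show ?thesis by (simp add: powr_powr)
  qed
  then show ?thesis by (simp add: sphere_energy_def ennreal_mult' H_def)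
qed

section \<open>Logarithmic test functions\<close>

text \<open>The first factor is |z|^(-H), which exactly compensates the radial growth e^(p H t) of
  the mass. The case z = 0 is separate because \<open>ln 0\<close> is only a default value there,
  not a limit.\<close>

definition log_test :: "real \<Rightarrow> ((real^'k) \<times> (real^'m) \<Rightarrow> real) \<Rightarrow> (real^'k) \<times> (real^'m) \<Rightarrow> real" where
  "log_test \<epsilon> \<psi> z = (if z = 0 then 0 else exp (- H * ln (norm z)) * bump (\<epsilon> * ln (norm z)) * \<psi> (sgn z))"

lemma log_test_exp:
  assumes "z \<noteq> 0"
  shows "log_test \<epsilon> \<psi> (exp t *\<^sub>R sgn z) = exp (- H * t) * bump (\<epsilon> * t) * \<psi> (sgn z)"
proof -
  have "sgn (exp t *\<^sub>R sgn z) = sgn z" using assms by (simp add: sgn_scaleR sgn_div_norm[of "sgn z"] norm_sgn)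
  moreover have "norm (exp t *\<^sub>R sgn z) = exp t" using assms by (simp add: norm_sgn)
  ultimately show ?thesis using assms by (simp add: log_test_def sgn_zero_iff)
qed

lemma log_test_in_tests:
  assumes \<psi>: "smooth_sphere \<psi>" and \<epsilon>: "\<epsilon> > 0"
  shows "log_test \<epsilon> \<psi> \<in> tests"
proof -
  let ?L = "\<lambda>z::(real^'k) \<times> (real^'m). ln (norm z)"
  have L: "smooth_on (- {0}) ?L"
    by (rule smooth_on_compose_real[OF _ _ smooth_on_norm smooth_on_ln]) auto
  have L': "smooth_on (- {0}) (\<lambda>z. c * ?L z)" for c
    by (intro smooth_on_mult smooth_on_const L) auto
  have s: "smooth_on (- {0}) (\<lambda>z. \<psi> (sgn z))"
    using \<psi> by (simp add: smooth_sphere_def o_def)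
  have "smooth_on (- {0}) (\<lambda>z. exp (- H * ?L z) * bump (\<epsilon> * ?L z) * \<psi> (sgn z))"
    by (intro smooth_on_mult smooth_on_compose_real[OF _ _ L' smooth_on_exp] smooth_on_compose_real[OF _ _ L' smooth_on_bump] s) auto
  then have 1: "smooth_on (- {0}) (log_test \<epsilon> \<psi>)"
    by (subst smooth_on_cong[where g = "\<lambda>z. exp (- H * ?L z) * bump (\<epsilon> * ?L z) * \<psi> (sgn z)"])
      (auto simp: log_test_def)
  \<comment> \<open>For |z| < r the argument of \<open>bump\<close> is below -1, so the function
    vanishes near the origin; this gives smoothness there, where \<open>ln\<close> and
    \<open>sgn\<close> have none.\<close>
  define r where "r = exp (- (1 / \<epsilon>))"
  have zero: "log_test \<epsilon> \<psi> z = 0" if "norm z < r" for z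
  proof (cases "z = 0")
    case False
    then have "ln (norm z) < - (1 / \<epsilon>)"
      using that ln_less_cancel_iff[of "norm z" r] by (simp add: r_def)
    then have "\<epsilon> * ln (norm z) < \<epsilon> * - (1 / \<epsilon>)" using \<epsilon> by (intro mult_strict_left_mono) auto
    then have "bump (\<epsilon> * ln (norm z)) = 0" using \<epsilon> by (intro bump_zero) auto
    then show ?thesis by (simp add: log_test_def)
  qed (simp add: log_test_def)
  have "smooth_on (ball 0 r) (log_test \<epsilon> \<psi>)"
    by (subst smooth_on_cong[where g = "\<lambda>_. 0"]) (auto intro: zero smooth_on_const)
  then have "smooth_on (- {0} \<union> ball 0 r) (log_test \<epsilon> \<psi>)"
    by (intro smooth_on_Un 1) auto
  moreover have "- {0} \<union> ball 0 r = (UNIV :: ((real^'k) \<times> (real^'m)) set)" by (auto simp: r_def)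
  ultimately have sm: "smooth_on UNIV (log_test \<epsilon> \<psi>)" by simp
  have "norm z \<le> exp (1 / \<epsilon>)" if "log_test \<epsilon> \<psi> z \<noteq> 0" for z
  proof (rule ccontr)
    assume "\<not> norm z \<le> exp (1 / \<epsilon>)"
    then have n: "exp (1 / \<epsilon>) < norm z" by simp
    then have "1 / \<epsilon> < ln (norm z)"
      using ln_less_cancel_iff[of "exp (1 / \<epsilon>)" "norm z"] less_trans[OF exp_gt_zero n] by (simp del: ln_less_cancel_iff)
    then have "\<epsilon> * (1 / \<epsilon>) < \<epsilon> * ln (norm z)" using \<epsilon> by (intro mult_strict_left_mono) auto
    then have "bump (\<epsilon> * ln (norm z)) = 0" using \<epsilon> by (intro bump_zero) auto
    then show False using that by (simp add: log_test_def split: if_splits)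
  qed
  then have "bounded {z. log_test \<epsilon> \<psi> z \<noteq> 0}" unfolding bounded_iff by auto
  then show ?thesis using sm by (simp add: test_functions_def compact_closure)
qed

lemma DERIV_bump: "(bump has_real_derivative deriv bump x) (at x)"
  using smooth_on_differentiable[OF smooth_on_bump, of x]
  by (simp add: DERIV_deriv_iff_real_differentiable)

lemma continuous_on_deriv_bump: "continuous_on UNIV (deriv bump)"
proof -
  have "deriv bump = (\<lambda>x. frechet_derivative bump (at x) 1)"
    using has_derivative_frechetI[OF DERIV_bump[unfolded has_field_derivative_def]] by auto
  then show ?thesis
    using smooth_on_continuous[OF smooth_on_partial[OF smooth_on_bump, of 1]] by simp
qed

lemma deriv_bump_measurable [measurable]: "deriv bump \<in> borel_measurable borel"
  by (rule borel_measurable_continuous_onI[OF continuous_on_deriv_bump])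

lemma bump_measurable [measurable]: "bump \<in> borel_measurable borel"
  using smooth_on_continuous[OF smooth_on_bump] by (rule borel_measurable_continuous_onI)

lemma deriv_bump_zero: "\<bar>x\<bar> > 1 \<Longrightarrow> deriv bump x = 0"
proof -
  assume x: "\<bar>x\<bar> > 1"
  have z: "bump y = 0" if "y \<in> - {-1..1}" for y using that by (intro bump_zero) auto
  have "open (- {-1..1::real})" by (simp add: open_Compl)
  moreover have "x \<in> - {-1..1}" using x by auto
  ultimately have "(bump has_real_derivative 0) (at x)"
    by (rule has_field_derivative_transform_within_open[OF DERIV_const[of 0]])
      (simp add: z)
  then show ?thesis using DERIV_unique[OF DERIV_bump] by blast
qed

lemma log_test_gradient:
  assumes \<psi>: "smooth_sphere \<psi>" and \<epsilon>: "\<epsilon> > 0" and \<sigma>: "norm \<sigma> = 1"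
  shows "exp t * norm (gradient (log_test \<epsilon> \<psi>) (exp t *\<^sub>R \<sigma>)) =
    exp (- H * t) * norm (bump (\<epsilon> * t) *\<^sub>R sphere_gradient \<psi> \<sigma>, (\<epsilon> * deriv bump (\<epsilon> * t) - H * bump (\<epsilon> * t)) * \<psi> \<sigma>)"
proof -
  let ?u = "log_test \<epsilon> \<psi>"
  have s: "sgn \<sigma> = \<sigma>" "\<sigma> \<noteq> 0" using \<sigma> by (auto simp: sgn_div_norm)
  have du: "?u differentiable at z" for z
    using test_functions_differentiable[OF log_test_in_tests[OF \<psi> \<epsilon>]] .
  \<comment> \<open>Both sides are the t-derivative of the test function along the ray.\<close>
  have "gradient ?u (exp t *\<^sub>R \<sigma>) \<bullet> (exp t *\<^sub>R \<sigma>) = exp (- H * t) * ((\<epsilon> * deriv bump (\<epsilon> * t) - H * bump (\<epsilon> * t)) * \<psi> \<sigma>)"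
  proof (rule DERIV_unique)
    have "((\<lambda>t. exp t *\<^sub>R \<sigma>) has_vector_derivative exp t *\<^sub>R \<sigma>) (at t)"
      by (auto intro!: derivative_eq_intros)
    then show "((\<lambda>t. ?u (exp t *\<^sub>R \<sigma>)) has_real_derivative gradient ?u (exp t *\<^sub>R \<sigma>) \<bullet> (exp t *\<^sub>R \<sigma>)) (at t)"
      by (rule DERIV_gradient_compose[OF _ du])
    have b: "((\<lambda>t. bump (\<epsilon> * t)) has_real_derivative deriv bump (\<epsilon> * t) * \<epsilon>) (at t)"
      by (rule DERIV_chain2[OF DERIV_bump]) (auto intro!: derivative_eq_intros)
    have "((\<lambda>t. exp (- H * t) * bump (\<epsilon> * t) * \<psi> \<sigma>) has_real_derivative
        exp (- H * t) * ((\<epsilon> * deriv bump (\<epsilon> * t) - H * bump (\<epsilon> * t)) * \<psi> \<sigma>)) (at t)"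
    proof (rule DERIV_cong[OF DERIV_mult[OF DERIV_mult[OF _ b] DERIV_const]])
      show "((\<lambda>t. exp (- H * t)) has_real_derivative - H * exp (- H * t)) (at t)"
        by (auto intro!: derivative_eq_intros)
    qed (simp add: algebra_simps)
    then show "((\<lambda>t. ?u (exp t *\<^sub>R \<sigma>)) has_real_derivative
        exp (- H * t) * ((\<epsilon> * deriv bump (\<epsilon> * t) - H * bump (\<epsilon> * t)) * \<psi> \<sigma>)) (at t)"
      using log_test_exp[OF s(2), of \<epsilon> \<psi>] by (simp add: s)
  qed
  moreover have "gradient (\<lambda>z. ?u (exp t *\<^sub>R sgn z)) \<sigma> = (exp (- H * t) * bump (\<epsilon> * t)) *\<^sub>R sphere_gradient \<psi> \<sigma>"
  proof (rule gradientI)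
    have d: "(\<psi> \<circ> sgn) differentiable at \<sigma>"
      using \<psi> s smooth_on_differentiable unfolding smooth_sphere_def by blast
    have "frechet_derivative (\<psi> \<circ> sgn) (at \<sigma>) = (\<lambda>h. sphere_gradient \<psi> \<sigma> \<bullet> h)"
      by (simp add: fun_eq_iff sphere_gradient_def frechet_derivative_eq_gradient[OF d])
    then have "((\<psi> \<circ> sgn) has_derivative (\<lambda>h. sphere_gradient \<psi> \<sigma> \<bullet> h)) (at \<sigma>)"
      using frechet_has_derivative[OF d] by simp
    then have "((\<lambda>z. (exp (- H * t) * bump (\<epsilon> * t)) * (\<psi> \<circ> sgn) z) has_derivative
        (\<lambda>h. (exp (- H * t) * bump (\<epsilon> * t)) * (sphere_gradient \<psi> \<sigma> \<bullet> h))) (at \<sigma>)"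
      by (rule has_derivative_mult_right)
    then have "((\<lambda>z. ?u (exp t *\<^sub>R sgn z)) has_derivative
        (\<lambda>h. (exp (- H * t) * bump (\<epsilon> * t)) * (sphere_gradient \<psi> \<sigma> \<bullet> h))) (at \<sigma>)"
      by (rule has_derivative_transform_within_open[where s = "- {0}"]) (use s in \<open>auto simp: log_test_exp\<close>)
    then show "((\<lambda>z. ?u (exp t *\<^sub>R sgn z)) has_derivative
        (\<lambda>h. (exp (- H * t) * bump (\<epsilon> * t)) *\<^sub>R sphere_gradient \<psi> \<sigma> \<bullet> h)) (at \<sigma>)"
      by simp
  qed
  ultimately have "exp t * norm (gradient ?u (exp t *\<^sub>R \<sigma>)) =
      norm ((exp (- H * t) * bump (\<epsilon> * t)) *\<^sub>R sphere_gradient \<psi> \<sigma>, exp (- H * t) * ((\<epsilon> * deriv bump (\<epsilon> * t) - H * bump (\<epsilon> * t)) * \<psi> \<sigma>))"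
    using norm_gradient_polar[OF \<sigma> du, of "exp t"] by simp
  also have "((exp (- H * t) * bump (\<epsilon> * t)) *\<^sub>R sphere_gradient \<psi> \<sigma>, exp (- H * t) * ((\<epsilon> * deriv bump (\<epsilon> * t) - H * bump (\<epsilon> * t)) * \<psi> \<sigma>))
    = exp (- H * t) *\<^sub>R (bump (\<epsilon> * t) *\<^sub>R sphere_gradient \<psi> \<sigma>, (\<epsilon> * deriv bump (\<epsilon> * t) - H * bump (\<epsilon> * t)) * \<psi> \<sigma>)"
    by simp
  finally show ?thesis by (simp only: norm_scaleR abs_exp_cancel)
qed


text \<open>The product form includes u = 0, a case that arises when \<psi> vanishes on the
  sphere.\<close>

lemma S_ennreal_le:
  assumes "u \<in> tests" "adm \<gamma>"
  shows "ennreal (S \<gamma>) * weighted_mass p a b \<gamma> u \<le> weighted_energy p a b u"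
proof (cases "u = (\<lambda>_. 0)")
  case True
  then show ?thesis using p by (simp add: weighted_mass_def)
next
  case False
  then show ?thesis
    using ennreal_leI[OF S_le[OF assms(1) False assms(2)]] S_nonneg
    by (simp add: weighted_mass_eq weighted_energy_eq assms ennreal_mult'[symmetric])
qed

lemma nn_integral_sphere_continuous_finite:
  fixes f :: "(real^'k) \<times> (real^'m) \<Rightarrow> 'c::real_normed_vector"
  assumes "continuous_on (sphere 0 1) f"
  shows "(\<integral>\<^sup>+\<sigma>. \<omega> a \<sigma> * ennreal (norm (f \<sigma>) powr p) \<partial>\<Omega>) < \<infinity>"
proof -
  have "bounded (f ` sphere 0 1)"
    using assms by (intro compact_imp_bounded compact_continuous_image) auto
  then obtain C where "\<forall>\<sigma>\<in>sphere 0 1. norm (f \<sigma>) \<le> C" unfolding bounded_iff by auto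
  then have C: "norm (f \<sigma>) \<le> C" if "norm \<sigma> = 1" for \<sigma> using that by simp
  have "(\<integral>\<^sup>+\<sigma>. \<omega> a \<sigma> * ennreal (norm (f \<sigma>) powr p) \<partial>\<Omega>) \<le>
      (\<integral>\<^sup>+\<sigma>. \<omega> a \<sigma> * ennreal (C powr p) \<partial>\<Omega>)"
    using p by (intro nn_integral_mono mult_left_mono ennreal_leI powr_mono2 C) auto
  also have "\<dots> = (\<integral>\<^sup>+\<sigma>. \<omega> a \<sigma> \<partial>\<Omega>) * ennreal (C powr p)"
    by (rule nn_integral_multc, rule borel_measurable_sphere) measurable
  also have "\<dots> < \<infinity>"
    using nn_integral_sphere_weight_finite[where 'k = 'k and 'm = 'm, OF ka] by (simp add: ennreal_mult_less_top)
  finally show ?thesis .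
qed

lemma nn_integral_rescale:
  fixes f :: "real \<Rightarrow> ennreal"
  assumes "f \<in> borel_measurable borel" "\<epsilon> > 0"
  shows "ennreal \<epsilon> * (\<integral>\<^sup>+t. f (\<epsilon> * t) \<partial>lborel) = (\<integral>\<^sup>+t. f t \<partial>lborel)"
  using nn_integral_real_affine[OF assms(1), of \<epsilon> 0] assms(2) by simp

lemma nn_integral_powr_support_finite:
  fixes f :: "real \<Rightarrow> real"
  assumes "continuous_on UNIV f" "\<And>x. \<bar>x\<bar> > 1 \<Longrightarrow> f x = 0"
  shows "(\<integral>\<^sup>+t. ennreal (\<bar>f t\<bar> powr p) \<partial>lborel) < \<infinity>"
proof -
  have "bounded (f ` {-1..1})"
    by (intro compact_imp_bounded compact_continuous_image continuous_on_subset[OF assms(1)]) auto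
  then obtain C where "\<forall>x\<in>{-1..1}. \<bar>f x\<bar> \<le> C" unfolding bounded_iff by auto
  then have C: "\<bar>f x\<bar> \<le> C" if "x \<in> {-1..1}" for x using that by blast
  have "(\<integral>\<^sup>+t. ennreal (\<bar>f t\<bar> powr p) \<partial>lborel) \<le> (\<integral>\<^sup>+t. ennreal (C powr p) * indicator {-1..1::real} t \<partial>lborel)"
  proof (rule nn_integral_mono)
    fix t :: real
    show "ennreal (\<bar>f t\<bar> powr p) \<le> ennreal (C powr p) * indicator {-1..1} t"
    proof (cases "t \<in> {-1..1}")
      case True
      then show ?thesis using C[OF True] p by (auto intro!: ennreal_leI powr_mono2)
    next
      case False
      then have "\<bar>t\<bar> > 1" by auto
      then show ?thesis using assms(2) p by simp
    qed
  qed
  also have "\<dots> < \<infinity>" by (simp add: nn_integral_cmult ennreal_mult_less_top)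
  finally show ?thesis .
qed

text \<open>The mass and the main part of the energy of the test function are the spherical
  quantities times the integral of \<open>bump (\<epsilon> * t) powr p\<close>, which is K /
  \<epsilon>; the derivative of the cutoff contributes an extra factor \<epsilon>^p. After
  multiplication by \<epsilon> and passage to the limit only the common factor K is left.\<close>

lemma smooth_sphere_inequality:
  fixes \<psi> :: "(real^'k) \<times> (real^'m) \<Rightarrow> real"
  assumes \<psi>: "smooth_sphere \<psi>" and \<gamma>: "adm \<gamma>"
  shows "ennreal (S \<gamma>) * sphere_mass p a b \<gamma> \<psi> \<le> sphere_energy p a b \<psi> (sphere_gradient \<psi>)"
proof -
  define K where "K = (\<integral>\<^sup>+t. ennreal (\<bar>bump t\<bar> powr p) \<partial>lborel)"
  define K' where "K' = (\<integral>\<^sup>+t. ennreal (\<bar>deriv bump t\<bar> powr p) \<partial>lborel)"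
  define L where "L = (\<integral>\<^sup>+\<sigma>. \<omega> a \<sigma> * ennreal (\<bar>\<psi> \<sigma>\<bar> powr p) \<partial>\<Omega>)"
  have K: "K < \<infinity>" unfolding K_def
    by (rule nn_integral_powr_support_finite[OF smooth_on_continuous[OF smooth_on_bump]]) (simp add: bump_zero)
  have K': "K' < \<infinity>" unfolding K'_def
    by (rule nn_integral_powr_support_finite[OF continuous_on_deriv_bump deriv_bump_zero])
  \<comment> \<open>K is cancelled at the end, which in \<open>ennreal\<close> requires it to be
    nonzero and finite.\<close>
  have K0: "K \<noteq> 0"
  proof
    assume "K = 0"
    then have "AE t in lborel. ennreal (\<bar>bump t\<bar> powr p) = 0"
      unfolding K_def by (subst (asm) nn_integral_0_iff_AE) auto
    then have "AE t in lborel. t \<notin> {-1<..<1::real}"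
    proof eventually_elim
      case (elim t)
      then have "bump t = 0" by simp
      then show ?case using bump_pos[of t] by (auto simp: abs_less_iff)
    qed
    then have "{-1<..<1::real} \<in> null_sets lborel" by (subst AE_iff_null_sets) auto
    then have "emeasure lborel {-1<..<1::real} = 0" by blast
    then show False by simp
  qed
  note cont = smooth_sphere_continuous[OF \<psi>]
  have L: "L < \<infinity>" using nn_integral_sphere_continuous_finite[OF cont(1)] by (simp add: L_def)
  note [measurable] = cont[THEN continuous_on_sphere_measurable]
  have [measurable]: "fst \<in> borel_measurable \<Omega>"
    by (rule borel_measurable_sphere) measurable
  have "ennreal (S \<gamma>) * sphere_mass p a b \<gamma> \<psi> * K \<le> sphere_energy p a b \<psi> (sphere_gradient \<psi>) * K"
  proof (rule ennreal_le_limit)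
    show "((\<lambda>l. (1 - l) powr (1 - p)) \<longlongrightarrow> 1) (at_right 0)"
      by (rule tendsto_eq_intros | simp)+
    show "ennreal (l powr (1 - p)) * (L * K') < \<infinity>" for l
      using L K' by (simp add: ennreal_mult_less_top)
    fix l e :: real assume l: "0 < l" "l < 1" and e: "0 < e"
    \<comment> \<open>Chosen so that the error of order \<epsilon>^p is e times a quantity depending
      on l but not on e.\<close>
    define \<epsilon> where "\<epsilon> = e powr (1 / p)"
    have \<epsilon>: "\<epsilon> > 0" "\<epsilon> powr p = e" using e p by (simp_all add: \<epsilon>_def powr_powr)
    let ?u = "log_test \<epsilon> \<psi>"
    have u: "?u \<in> tests" by (rule log_test_in_tests[OF \<psi> \<epsilon>(1)])
    let ?K = "\<integral>\<^sup>+t. ennreal (\<bar>bump (\<epsilon> * t)\<bar> powr p) \<partial>lborel"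
    let ?K' = "\<integral>\<^sup>+t. ennreal (\<bar>deriv bump (\<epsilon> * t)\<bar> powr p) \<partial>lborel"
    have mass: "weighted_mass p a b \<gamma> ?u = sphere_mass p a b \<gamma> \<psi> * ?K"
    proof -
      have "weighted_mass p a b \<gamma> ?u = (\<integral>\<^sup>+\<sigma>. \<omega> (a - p - b + \<gamma>) \<sigma> *
        (\<integral>\<^sup>+t. ennreal (exp (p * H * t) * \<bar>?u (exp t *\<^sub>R \<sigma>)\<bar> powr p) \<partial>lborel) \<partial>\<Omega>)"
        by (rule weighted_mass_polar[OF test_functions_measurable[OF u]])
      also have "\<dots> = (\<integral>\<^sup>+\<sigma>. (\<omega> (a - p - b + \<gamma>) \<sigma> * ennreal (\<bar>\<psi> \<sigma>\<bar> powr p)) * ?K \<partial>\<Omega>)"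
      proof (rule nn_integral_cong)
        fix \<sigma> :: "(real^'k) \<times> (real^'m)" assume "\<sigma> \<in> space \<Omega>"
        then have s: "sgn \<sigma> = \<sigma>" "\<sigma> \<noteq> 0" by (auto simp: sgn_div_norm)
        have "exp (p * H * t) * \<bar>?u (exp t *\<^sub>R \<sigma>)\<bar> powr p = \<bar>\<psi> \<sigma>\<bar> powr p * \<bar>bump (\<epsilon> * t)\<bar> powr p" for t
        proof -
          have "?u (exp t *\<^sub>R \<sigma>) = exp (- H * t) * bump (\<epsilon> * t) * \<psi> \<sigma>"
            using log_test_exp[OF s(2), of \<epsilon> \<psi> t] by (simp only: s)
          moreover have "exp (p * H * t) * exp (- H * t) powr p = 1"
            by (simp add: exp_powr_real exp_add[symmetric] algebra_simps)
          ultimately show ?thesis by (simp add: abs_mult powr_mult)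
        qed
        then have "(\<integral>\<^sup>+t. ennreal (exp (p * H * t) * \<bar>?u (exp t *\<^sub>R \<sigma>)\<bar> powr p) \<partial>lborel) = ennreal (\<bar>\<psi> \<sigma>\<bar> powr p) * ?K"
          by (simp add: ennreal_mult' nn_integral_cmult)
        then show "\<omega> (a - p - b + \<gamma>) \<sigma> * (\<integral>\<^sup>+t. ennreal (exp (p * H * t) * \<bar>?u (exp t *\<^sub>R \<sigma>)\<bar> powr p) \<partial>lborel)
          = (\<omega> (a - p - b + \<gamma>) \<sigma> * ennreal (\<bar>\<psi> \<sigma>\<bar> powr p)) * ?K"
          by (simp add: mult.assoc)
      qed
      also have "\<dots> = sphere_mass p a b \<gamma> \<psi> * ?K"
        unfolding sphere_mass_eq by (rule nn_integral_multc) measurable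
      finally show ?thesis .
    qed
    have energy: "weighted_energy p a b ?u \<le> ennreal ((1 - l) powr (1 - p)) * sphere_energy p a b \<psi> (sphere_gradient \<psi>) * ?K
      + ennreal (l powr (1 - p)) * ennreal e * L * ?K'"
    proof -
      have "weighted_energy p a b ?u = (\<integral>\<^sup>+\<sigma>. \<omega> a \<sigma> *
        (\<integral>\<^sup>+t. ennreal (exp (p * H * t) * (exp t * norm (gradient ?u (exp t *\<^sub>R \<sigma>))) powr p) \<partial>lborel) \<partial>\<Omega>)"
        by (rule weighted_energy_polar[OF gradient_measurable[OF u]])
      also have "\<dots> \<le> (\<integral>\<^sup>+(\<sigma>::(real^'k) \<times> (real^'m)).
          (ennreal ((1 - l) powr (1 - p)) * (\<omega> a \<sigma> * ennreal (norm (sphere_gradient \<psi> \<sigma>, H * \<psi> \<sigma>) powr p))) * ?K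
        + (ennreal (l powr (1 - p)) * ennreal e * (\<omega> a \<sigma> * ennreal (\<bar>\<psi> \<sigma>\<bar> powr p))) * ?K' \<partial>\<Omega>)"
      proof (rule nn_integral_mono)
        fix \<sigma> :: "(real^'k) \<times> (real^'m)" assume "\<sigma> \<in> space \<Omega>"
        then have n: "norm \<sigma> = 1" by simp
        let ?g = "sphere_gradient \<psi> \<sigma>"
        let ?N = "norm (?g, H * \<psi> \<sigma>) powr p"
        have pt: "exp (p * H * t) * (exp t * norm (gradient ?u (exp t *\<^sub>R \<sigma>))) powr p \<le>
          (1 - l) powr (1 - p) * ?N * \<bar>bump (\<epsilon> * t)\<bar> powr p + l powr (1 - p) * e * \<bar>\<psi> \<sigma>\<bar> powr p * \<bar>deriv bump (\<epsilon> * t)\<bar> powr p" for t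
        proof -
          let ?v = "(bump (\<epsilon> * t) *\<^sub>R ?g, (\<epsilon> * deriv bump (\<epsilon> * t) - H * bump (\<epsilon> * t)) * \<psi> \<sigma>)"
          have one: "exp (p * H * t) * exp (- H * t) powr p = 1"
            by (simp add: exp_powr_real exp_add[symmetric] algebra_simps)
          have "exp (p * H * t) * (exp t * norm (gradient ?u (exp t *\<^sub>R \<sigma>))) powr p
             = (exp (p * H * t) * exp (- H * t) powr p) * norm ?v powr p"
            unfolding log_test_gradient[OF \<psi> \<epsilon>(1) n] by (simp add: powr_mult)
          also have "\<dots> = norm ?v powr p" using one by simp
          \<comment> \<open>The derivative of the cutoff is split off; the rest is a multiple of
            (grad \<psi>, -H \<psi>), whose norm does not see the sign.\<close>
          also have "?v = bump (\<epsilon> * t) *\<^sub>R (?g, - H * \<psi> \<sigma>) + (0, \<epsilon> * deriv bump (\<epsilon> * t) * \<psi> \<sigma>)"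
            by (simp add: algebra_simps)
          also have "norm \<dots> powr p \<le> (1 - l) powr (1 - p) * norm (bump (\<epsilon> * t) *\<^sub>R (?g, - H * \<psi> \<sigma>)) powr p
             + l powr (1 - p) * norm (0 :: (real^'k) \<times> (real^'m), \<epsilon> * deriv bump (\<epsilon> * t) * \<psi> \<sigma>) powr p"
            by (rule norm_add_powr_le_weighted) (use p l in auto)
          also have "norm (bump (\<epsilon> * t) *\<^sub>R (?g, - H * \<psi> \<sigma>)) = \<bar>bump (\<epsilon> * t)\<bar> * norm (?g, H * \<psi> \<sigma>)"
            unfolding norm_scaleR by (simp add: norm_Pair)
          also have "norm (0 :: (real^'k) \<times> (real^'m), \<epsilon> * deriv bump (\<epsilon> * t) * \<psi> \<sigma>) = \<epsilon> * \<bar>deriv bump (\<epsilon> * t)\<bar> * \<bar>\<psi> \<sigma>\<bar>"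
            using \<epsilon> by (simp add: norm_Pair abs_mult)
          finally show ?thesis using \<epsilon> by (simp add: powr_mult mult_ac)
        qed
        have "(\<integral>\<^sup>+t. ennreal (exp (p * H * t) * (exp t * norm (gradient ?u (exp t *\<^sub>R \<sigma>))) powr p) \<partial>lborel) \<le>
          (\<integral>\<^sup>+t. ennreal ((1 - l) powr (1 - p) * ?N) * ennreal (\<bar>bump (\<epsilon> * t)\<bar> powr p) +
            ennreal (l powr (1 - p) * e * \<bar>\<psi> \<sigma>\<bar> powr p) * ennreal (\<bar>deriv bump (\<epsilon> * t)\<bar> powr p) \<partial>lborel)"
          using pt e by (intro nn_integral_mono) (simp add: ennreal_mult'[symmetric] ennreal_plus[symmetric] del: ennreal_plus)
        also have "\<dots> = ennreal ((1 - l) powr (1 - p) * ?N) * ?K + ennreal (l powr (1 - p) * e * \<bar>\<psi> \<sigma>\<bar> powr p) * ?K'"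
          by (simp add: nn_integral_add nn_integral_cmult)
        finally have "\<omega> a \<sigma> * (\<integral>\<^sup>+t. ennreal (exp (p * H * t) * (exp t * norm (gradient ?u (exp t *\<^sub>R \<sigma>))) powr p) \<partial>lborel)
          \<le> \<omega> a \<sigma> * (ennreal ((1 - l) powr (1 - p) * ?N) * ?K + ennreal (l powr (1 - p) * e * \<bar>\<psi> \<sigma>\<bar> powr p) * ?K')"
          by (rule mult_left_mono) simp
        then show "\<omega> a \<sigma> * (\<integral>\<^sup>+t. ennreal (exp (p * H * t) * (exp t * norm (gradient ?u (exp t *\<^sub>R \<sigma>))) powr p) \<partial>lborel)
          \<le> (ennreal ((1 - l) powr (1 - p)) * (\<omega> a \<sigma> * ennreal ?N)) * ?K
        + (ennreal (l powr (1 - p)) * ennreal e * (\<omega> a \<sigma> * ennreal (\<bar>\<psi> \<sigma>\<bar> powr p))) * ?K'"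
          using e by (simp add: ennreal_mult' distrib_left mult_ac)
      qed
      also have "\<dots> = ennreal ((1 - l) powr (1 - p)) * sphere_energy p a b \<psi> (sphere_gradient \<psi>) * ?K
        + ennreal (l powr (1 - p)) * ennreal e * L * ?K'"
        unfolding sphere_energy_eq L_def
        by (subst nn_integral_add) (simp_all add: nn_integral_cmult nn_integral_multc)
      finally show ?thesis .
    qed
    have KK: "ennreal \<epsilon> * ?K = K"
      unfolding K_def by (rule nn_integral_rescale) (use \<epsilon> in simp_all)
    have "ennreal (S \<gamma>) * sphere_mass p a b \<gamma> \<psi> * K = ennreal \<epsilon> * (ennreal (S \<gamma>) * weighted_mass p a b \<gamma> ?u)"
      unfolding mass KK[symmetric] by (simp only: mult_ac)
    also have "\<dots> \<le> ennreal \<epsilon> * (ennreal ((1 - l) powr (1 - p)) * sphere_energy p a b \<psi> (sphere_gradient \<psi>) * ?K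
      + ennreal (l powr (1 - p)) * ennreal e * L * ?K')"
      using order_trans[OF S_ennreal_le[OF u \<gamma>] energy] by (rule mult_left_mono) simp
    also have "\<dots> = ennreal ((1 - l) powr (1 - p)) * (sphere_energy p a b \<psi> (sphere_gradient \<psi>) * (ennreal \<epsilon> * ?K))
      + ennreal e * (ennreal (l powr (1 - p)) * (L * (ennreal \<epsilon> * ?K')))"
      by (simp add: distrib_left mult_ac)
    also have "ennreal \<epsilon> * ?K = K" by (rule KK)
    also have "ennreal \<epsilon> * ?K' = K'"
      unfolding K'_def by (rule nn_integral_rescale) (use \<epsilon> in simp_all)
    finally show "ennreal (S \<gamma>) * sphere_mass p a b \<gamma> \<psi> * K \<le>
      ennreal ((1 - l) powr (1 - p)) * (sphere_energy p a b \<psi> (sphere_gradient \<psi>) * K) + ennreal e * (ennreal (l powr (1 - p)) * (L * K'))" .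
  qed
  then show ?thesis
    using K K0 ennreal_mult_le_mult_iff[of K] by (simp add: mult.commute[of _ K])
qed

section \<open>Passage to the completion\<close>

text \<open>The p-th power of the distance in the weighted Sobolev norm, for pairs of a function and
  its gradient; its convergence to 0 is the one demanded in \<open>W1p_sphere\<close>.\<close>

definition sphere_dist ::
    "((real^'k) \<times> (real^'m) \<Rightarrow> real) \<Rightarrow> ((real^'k) \<times> (real^'m) \<Rightarrow> (real^'k) \<times> (real^'m)) \<Rightarrow>
     ((real^'k) \<times> (real^'m) \<Rightarrow> real) \<Rightarrow> ((real^'k) \<times> (real^'m) \<Rightarrow> (real^'k) \<times> (real^'m)) \<Rightarrow> ennreal" where
  "sphere_dist \<phi> G \<phi>' G' = (\<integral>\<^sup>+\<sigma>. ennreal (norm (fst \<sigma>) powr a * (norm (G \<sigma> - G' \<sigma>) powr p + \<bar>\<phi> \<sigma> - \<phi>' \<sigma>\<bar> powr p)) \<partial>\<Omega>)"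

lemma sphere_dist_commute: "sphere_dist \<phi> G \<phi>' G' = sphere_dist \<phi>' G' \<phi> G"
  by (simp add: sphere_dist_def norm_minus_commute abs_minus_commute)

text \<open>The splitting inequality at l = 1/2. The constant, which is 2^(p - 1) (1 + H^p), will
  multiply \<open>sphere_dist\<close>.\<close>

lemma norm_Pair_H_powr_le:
  fixes x :: "(real^'k) \<times> (real^'m)" and y :: real
  shows "norm (x, H * y) powr p \<le> (1 / 2) powr (1 - p) * (1 + H powr p) * (norm x powr p + \<bar>y\<bar> powr p)"
proof -
  have "norm (x, H * y) powr p \<le> (norm x + H * \<bar>y\<bar>) powr p"
    using norm_Pair_le[of x "H * y"] H_pos p by (intro powr_mono2) (auto simp: abs_mult)
  also have "\<dots> \<le> (1 - 1 / 2) powr (1 - p) * norm x powr p + (1 / 2) powr (1 - p) * (H * \<bar>y\<bar>) powr p"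
    by (rule powr_add_le_weighted) (use p H_pos in auto)
  also have "\<dots> = (1 / 2) powr (1 - p) * (norm x powr p + H powr p * \<bar>y\<bar> powr p)"
    using H_pos by (simp add: powr_mult distrib_left)
  also have "\<dots> \<le> (1 / 2) powr (1 - p) * ((1 + H powr p) * (norm x powr p + \<bar>y\<bar> powr p))"
    by (intro mult_left_mono) (auto simp: distrib_left distrib_right)
  finally show ?thesis by (simp add: mult.assoc)
qed

text \<open>The splitting inequality for the pair (G, H \<phi>) and its increment: the energies of
  nearby pairs are comparable up to a factor that tends to 1 with l.\<close>

lemma sphere_energy_perturb:
  fixes \<phi> \<phi>' :: "(real^'k) \<times> (real^'m) \<Rightarrow> real" and G G' :: "(real^'k) \<times> (real^'m) \<Rightarrow> (real^'k) \<times> (real^'m)"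
  assumes [measurable]: "\<phi> \<in> borel_measurable \<Omega>" "G \<in> borel_measurable \<Omega>"
    "\<phi>' \<in> borel_measurable \<Omega>" "G' \<in> borel_measurable \<Omega>"
    and l: "0 < l" "l < 1"
  shows "sphere_energy p a b \<phi>' G' \<le> ennreal ((1 - l) powr (1 - p)) * sphere_energy p a b \<phi> G
    + ennreal (l powr (1 - p) * ((1 / 2) powr (1 - p) * (1 + H powr p))) * sphere_dist \<phi>' G' \<phi> G"
proof -
  have [measurable]: "fst \<in> borel_measurable \<Omega>"
    by (rule borel_measurable_sphere) measurable
  define C where "C = (1 / 2) powr (1 - p) * (1 + H powr p)"
  have C: "C \<ge> 0" by (simp add: C_def)
  have pt: "norm (fst \<sigma>) powr a * norm (G' \<sigma>, H * \<phi>' \<sigma>) powr p \<le>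
    (1 - l) powr (1 - p) * (norm (fst \<sigma>) powr a * norm (G \<sigma>, H * \<phi> \<sigma>) powr p) +
    l powr (1 - p) * C * (norm (fst \<sigma>) powr a * (norm (G' \<sigma> - G \<sigma>) powr p + \<bar>\<phi>' \<sigma> - \<phi> \<sigma>\<bar> powr p))" for \<sigma>
  proof -
    have "norm (G' \<sigma>, H * \<phi>' \<sigma>) powr p = norm ((G \<sigma>, H * \<phi> \<sigma>) + (G' \<sigma> - G \<sigma>, H * (\<phi>' \<sigma> - \<phi> \<sigma>))) powr p"
      by (simp add: algebra_simps)
    also have "\<dots> \<le> (1 - l) powr (1 - p) * norm (G \<sigma>, H * \<phi> \<sigma>) powr p + l powr (1 - p) * norm (G' \<sigma> - G \<sigma>, H * (\<phi>' \<sigma> - \<phi> \<sigma>)) powr p"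
      by (rule norm_add_powr_le_weighted) (use p l in auto)
    also have "\<dots> \<le> (1 - l) powr (1 - p) * norm (G \<sigma>, H * \<phi> \<sigma>) powr p +
        l powr (1 - p) * (C * (norm (G' \<sigma> - G \<sigma>) powr p + \<bar>\<phi>' \<sigma> - \<phi> \<sigma>\<bar> powr p))"
      unfolding C_def by (intro add_left_mono mult_left_mono norm_Pair_H_powr_le) simp
    finally have "norm (fst \<sigma>) powr a * norm (G' \<sigma>, H * \<phi>' \<sigma>) powr p \<le> norm (fst \<sigma>) powr a *
       ((1 - l) powr (1 - p) * norm (G \<sigma>, H * \<phi> \<sigma>) powr p +
        l powr (1 - p) * (C * (norm (G' \<sigma> - G \<sigma>) powr p + \<bar>\<phi>' \<sigma> - \<phi> \<sigma>\<bar> powr p)))"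
      by (rule mult_left_mono) simp
    then show ?thesis by (simp add: algebra_simps)
  qed
  have "sphere_energy p a b \<phi>' G' \<le> (\<integral>\<^sup>+\<sigma>. ennreal ((1 - l) powr (1 - p)) * (\<omega> a \<sigma> * ennreal (norm (G \<sigma>, H * \<phi> \<sigma>) powr p)) +
    ennreal (l powr (1 - p) * C) * ennreal (norm (fst \<sigma>) powr a * (norm (G' \<sigma> - G \<sigma>) powr p + \<bar>\<phi>' \<sigma> - \<phi> \<sigma>\<bar> powr p)) \<partial>\<Omega>)"
    unfolding sphere_energy_eq using pt C
    by (intro nn_integral_mono) (simp add: ennreal_mult'[symmetric] ennreal_plus[symmetric] del: ennreal_plus)
  also have "\<dots> = ennreal ((1 - l) powr (1 - p)) * sphere_energy p a b \<phi> G + ennreal (l powr (1 - p) * C) * sphere_dist \<phi>' G' \<phi> G"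
    unfolding sphere_energy_eq sphere_dist_def
    by (subst nn_integral_add) (simp_all add: nn_integral_cmult)
  finally show ?thesis by (simp add: C_def)
qed

text \<open>Away from \<open>fst \<sigma> = 0\<close> the two weights are comparable.\<close>

lemma sphere_mass_perturb:
  fixes \<phi> \<phi>' :: "(real^'k) \<times> (real^'m) \<Rightarrow> real" and G G' :: "(real^'k) \<times> (real^'m) \<Rightarrow> (real^'k) \<times> (real^'m)"
  assumes [measurable]: "\<phi> \<in> borel_measurable \<Omega>" "G \<in> borel_measurable \<Omega>"
    "\<phi>' \<in> borel_measurable \<Omega>" "G' \<in> borel_measurable \<Omega>"
    and l: "0 < l" "l < 1" and \<tau>: "\<tau> > 0"
  shows "(\<integral>\<^sup>+\<sigma>. \<omega> (a - p - b + \<gamma>) \<sigma> * ennreal (\<bar>\<phi>' \<sigma>\<bar> powr p) * indicator {\<sigma>. norm (fst \<sigma>) \<ge> \<tau>} \<sigma> \<partial>\<Omega>)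
    \<le> ennreal ((1 - l) powr (1 - p)) * sphere_mass p a b \<gamma> \<phi> + ennreal (l powr (1 - p) * (1 + \<tau> powr (\<gamma> - p - b))) * sphere_dist \<phi>' G' \<phi> G"
proof -
  have [measurable]: "fst \<in> borel_measurable \<Omega>"
    by (rule borel_measurable_sphere) measurable
  let ?\<alpha> = "a - p - b + \<gamma>"
  define C where "C = 1 + \<tau> powr (\<gamma> - p - b)"
  have C: "C \<ge> 0" by (simp add: C_def)
  have "(\<integral>\<^sup>+\<sigma>. \<omega> ?\<alpha> \<sigma> * ennreal (\<bar>\<phi>' \<sigma>\<bar> powr p) * indicator {\<sigma>. norm (fst \<sigma>) \<ge> \<tau>} \<sigma> \<partial>\<Omega>)
    \<le> (\<integral>\<^sup>+\<sigma>. ennreal ((1 - l) powr (1 - p)) * (\<omega> ?\<alpha> \<sigma> * ennreal (\<bar>\<phi> \<sigma>\<bar> powr p)) +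
    ennreal (l powr (1 - p) * C) * ennreal (norm (fst \<sigma>) powr a * (norm (G' \<sigma> - G \<sigma>) powr p + \<bar>\<phi>' \<sigma> - \<phi> \<sigma>\<bar> powr p)) \<partial>\<Omega>)"
  proof (rule nn_integral_mono)
    fix \<sigma> :: "(real^'k) \<times> (real^'m)" assume "\<sigma> \<in> space \<Omega>"
    then have n: "norm \<sigma> = 1" by simp
    show "\<omega> ?\<alpha> \<sigma> * ennreal (\<bar>\<phi>' \<sigma>\<bar> powr p) * indicator {\<sigma>. norm (fst \<sigma>) \<ge> \<tau>} \<sigma> \<le>
      ennreal ((1 - l) powr (1 - p)) * (\<omega> ?\<alpha> \<sigma> * ennreal (\<bar>\<phi> \<sigma>\<bar> powr p)) +
      ennreal (l powr (1 - p) * C) * ennreal (norm (fst \<sigma>) powr a * (norm (G' \<sigma> - G \<sigma>) powr p + \<bar>\<phi>' \<sigma> - \<phi> \<sigma>\<bar> powr p))"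
    proof (cases "norm (fst \<sigma>) \<ge> \<tau>")
      case True
      define r where "r = norm (fst \<sigma>)"
      have r: "r > 0" "r \<le> 1" "\<tau> \<le> r" using True \<tau> n norm_fst_le[of "fst \<sigma>" "snd \<sigma>"] by (auto simp: r_def)
      have "r powr (\<gamma> - p - b) \<le> C"
      proof (cases "\<gamma> - p - b \<ge> 0")
        case True
        then have "r powr (\<gamma> - p - b) \<le> 1" using r by (simp add: powr_le1)
        then show ?thesis by (simp add: C_def add_increasing2)
      next
        case False
        then have "r powr (\<gamma> - p - b) \<le> \<tau> powr (\<gamma> - p - b)" using r \<tau> by (intro powr_mono2') auto
        then show ?thesis by (simp add: C_def)
      qed
      then have "r powr a * r powr (\<gamma> - p - b) \<le> r powr a * C" by (rule mult_left_mono) simp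
      then have w: "r powr ?\<alpha> \<le> C * r powr a" by (simp add: powr_add[symmetric] algebra_simps)
      have "\<bar>\<phi>' \<sigma>\<bar> powr p \<le> (1 - l) powr (1 - p) * \<bar>\<phi> \<sigma>\<bar> powr p + l powr (1 - p) * \<bar>\<phi>' \<sigma> - \<phi> \<sigma>\<bar> powr p"
        using norm_add_powr_le_weighted[of p l "\<phi> \<sigma>" "\<phi>' \<sigma> - \<phi> \<sigma>"] p l by simp
      then have "r powr ?\<alpha> * \<bar>\<phi>' \<sigma>\<bar> powr p \<le> r powr ?\<alpha> * ((1 - l) powr (1 - p) * \<bar>\<phi> \<sigma>\<bar> powr p + l powr (1 - p) * \<bar>\<phi>' \<sigma> - \<phi> \<sigma>\<bar> powr p)"
        by (rule mult_left_mono) simp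
      also have "\<dots> = (1 - l) powr (1 - p) * (r powr ?\<alpha> * \<bar>\<phi> \<sigma>\<bar> powr p) + l powr (1 - p) * (r powr ?\<alpha> * \<bar>\<phi>' \<sigma> - \<phi> \<sigma>\<bar> powr p)"
        by (simp add: algebra_simps)
      also have "\<dots> \<le> (1 - l) powr (1 - p) * (r powr ?\<alpha> * \<bar>\<phi> \<sigma>\<bar> powr p) +
         l powr (1 - p) * (C * r powr a * (norm (G' \<sigma> - G \<sigma>) powr p + \<bar>\<phi>' \<sigma> - \<phi> \<sigma>\<bar> powr p))"
        using w C by (intro add_left_mono mult_left_mono mult_mono) auto
      finally show ?thesis using True C
        by (simp add: r_def ennreal_mult'[symmetric] ennreal_plus[symmetric] mult_ac del: ennreal_plus)
    qed simp
  qed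
  also have "\<dots> = ennreal ((1 - l) powr (1 - p)) * sphere_mass p a b \<gamma> \<phi> + ennreal (l powr (1 - p) * C) * sphere_dist \<phi>' G' \<phi> G"
    unfolding sphere_mass_eq sphere_dist_def
    by (subst nn_integral_add) (simp_all add: nn_integral_cmult)
  finally show ?thesis by (simp add: C_def)
qed


lemma sphere_energy_smooth_finite:
  fixes \<psi> :: "(real^'k) \<times> (real^'m) \<Rightarrow> real"
  assumes "smooth_sphere \<psi>"
  shows "sphere_energy p a b \<psi> (sphere_gradient \<psi>) < \<infinity>"
  unfolding sphere_energy_eq
  by (rule nn_integral_sphere_continuous_finite)
    (intro continuous_on_Pair continuous_on_mult continuous_on_const smooth_sphere_continuous assms)

text \<open>Monotone convergence as the lower bound on |y| tends to 0. Nothing is lost on y = 0,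
  where the integrand is 0 because \<open>0 powr t = 0\<close>.\<close>

lemma sphere_mass_SUP:
  fixes \<phi> :: "(real^'k) \<times> (real^'m) \<Rightarrow> real"
  assumes [measurable]: "\<phi> \<in> borel_measurable \<Omega>"
  shows "sphere_mass p a b \<gamma> \<phi> = (SUP n. \<integral>\<^sup>+\<sigma>. \<omega> (a - p - b + \<gamma>) \<sigma> *
      ennreal (\<bar>\<phi> \<sigma>\<bar> powr p) * indicator {\<sigma>. norm (fst \<sigma>) \<ge> 1 / real (Suc n)} \<sigma> \<partial>\<Omega>)"
proof -
  have [measurable]: "fst \<in> borel_measurable \<Omega>"
    by (rule borel_measurable_sphere) measurable
  define F where "F \<sigma> = \<omega> (a - p - b + \<gamma>) \<sigma> * ennreal (\<bar>\<phi> \<sigma>\<bar> powr p)" for \<sigma>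
  define F' where "F' n \<sigma> = F \<sigma> * indicator {\<sigma>. norm (fst \<sigma>) \<ge> 1 / real (Suc n)} \<sigma>" for n \<sigma>
  have mono: "incseq F'"
  proof (intro incseq_SucI le_funI)
    fix n \<sigma>
    have "1 / real (Suc (Suc n)) \<le> 1 / real (Suc n)" by (simp add: field_simps)
    then show "F' n \<sigma> \<le> F' (Suc n) \<sigma>" by (auto simp: F'_def indicator_def)
  qed
  have "(SUP n. F' n \<sigma>) = F \<sigma>" for \<sigma>
  proof (cases "fst \<sigma> = 0")
    case True
    then show ?thesis by (simp add: F'_def F_def)
  next
    case False
    then obtain n where "1 / real (Suc n) < norm (fst \<sigma>)"
      using reals_Archimedean[of "norm (fst \<sigma>)"] by (auto simp: inverse_eq_divide)
    then have "F \<sigma> \<le> F' n \<sigma>" by (simp add: F'_def)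
    moreover have "F' n \<sigma> \<le> F \<sigma>" for n by (simp add: F'_def indicator_def)
    ultimately show ?thesis by (intro antisym SUP_least SUP_upper2[of n]) auto
  qed
  then have "sphere_mass p a b \<gamma> \<phi> = (\<integral>\<^sup>+\<sigma>. (SUP n. F' n \<sigma>) \<partial>\<Omega>)"
    by (simp add: sphere_mass_eq F_def)
  also have "\<dots> = (SUP n. \<integral>\<^sup>+\<sigma>. F' n \<sigma> \<partial>\<Omega>)"
  proof (rule nn_integral_monotone_convergence_SUP[OF mono])
    show "F' n \<in> borel_measurable \<Omega>" for n
      unfolding F'_def F_def by measurable
  qed
  finally show ?thesis by (simp add: F'_def F_def)
qed

text \<open>On |y| \<ge> \<tau> the mass of \<phi> is bounded by that of a smooth approximant, for
  which the inequality is known, and the energy of the approximant is bounded back by that of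
  (\<phi>, G). Each comparison costs a factor (1 - l)^(1 - p) and an error proportional to the
  distance. The errors vanish for fixed \<tau>, and the resulting bound is uniform in
  \<tau>.\<close>

lemma W1p_sphere_inequality:
  fixes \<phi> :: "(real^'k) \<times> (real^'m) \<Rightarrow> real"
  assumes W: "W1p_sphere p a \<phi> G" and \<gamma>: "adm \<gamma>"
  shows "ennreal (S \<gamma>) * sphere_mass p a b \<gamma> \<phi> \<le> sphere_energy p a b \<phi> G"
    and "sphere_energy p a b \<phi> G < \<infinity>"
proof -
  obtain \<psi> where \<psi>: "\<And>n::nat. smooth_sphere (\<psi> n)"
    and lim: "(\<lambda>n. sphere_dist (\<psi> n) (sphere_gradient (\<psi> n)) \<phi> G) \<longlonglongrightarrow> 0"
    using W by (auto simp: W1p_sphere_def sphere_dist_def)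
  have m: "\<phi> \<in> borel_measurable \<Omega>" "G \<in> borel_measurable \<Omega>"
    using W by (auto simp: W1p_sphere_def)
  have m': "\<psi> n \<in> borel_measurable \<Omega>" "sphere_gradient (\<psi> n) \<in> borel_measurable \<Omega>" for n
    using smooth_sphere_continuous[OF \<psi>] by (auto intro: continuous_on_sphere_measurable)
  have ex: "\<exists>n. sphere_dist (\<psi> n) (sphere_gradient (\<psi> n)) \<phi> G \<le> ennreal e" if "e > 0" for e
  proof -
    have "eventually (\<lambda>n. sphere_dist (\<psi> n) (sphere_gradient (\<psi> n)) \<phi> G < ennreal e) sequentially"
      using order_tendstoD(2)[OF lim] that by simp
    then show ?thesis by (meson eventually_sequentially le_refl less_imp_le)
  qed
  \<comment> \<open>A single approximant at finite distance already shows that the energy is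
    finite.\<close>
  obtain n where n: "sphere_dist (\<psi> n) (sphere_gradient (\<psi> n)) \<phi> G \<le> ennreal 1" using ex[of 1] by auto
  have "sphere_energy p a b \<phi> G \<le> ennreal ((1 - 1 / 2) powr (1 - p)) * sphere_energy p a b (\<psi> n) (sphere_gradient (\<psi> n))
    + ennreal ((1 / 2) powr (1 - p) * ((1 / 2) powr (1 - p) * (1 + H powr p))) * sphere_dist \<phi> G (\<psi> n) (sphere_gradient (\<psi> n))"
    by (rule sphere_energy_perturb) (use m m' in auto)
  also have "\<dots> < \<infinity>"
    using sphere_energy_smooth_finite[OF \<psi>, of n] le_less_trans[OF n]
    by (simp add: ennreal_mult_less_top sphere_dist_commute[of \<phi>])
  finally show "sphere_energy p a b \<phi> G < \<infinity>" .
  have "ennreal (S \<gamma>) * (\<integral>\<^sup>+\<sigma>. \<omega> (a - p - b + \<gamma>) \<sigma> *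
      ennreal (\<bar>\<phi> \<sigma>\<bar> powr p) * indicator {\<sigma>. norm (fst \<sigma>) \<ge> \<tau>} \<sigma> \<partial>\<Omega>) \<le> sphere_energy p a b \<phi> G"
    (is "_ * ?X \<le> _") if \<tau>: "\<tau> > 0" for \<tau>
  proof (rule ennreal_le_limit)
    show "((\<lambda>l. (1 - l) powr (1 - p) * (1 - l) powr (1 - p)) \<longlongrightarrow> 1) (at_right 0)"
      by (rule tendsto_eq_intros | simp)+
    define d1 where "d1 l = ennreal (l powr (1 - p) * (1 + \<tau> powr (\<gamma> - p - b)))" for l
    define d2 where "d2 l = ennreal (l powr (1 - p) * ((1 / 2) powr (1 - p) * (1 + H powr p)))" for l
    show "ennreal ((1 - l) powr (1 - p)) * d2 l + ennreal (S \<gamma>) * d1 l < \<infinity>" for l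
      by (simp add: d1_def d2_def ennreal_mult_less_top)
    fix l e :: real assume l: "0 < l" "l < 1" and e: "0 < e"
    obtain n where n: "sphere_dist (\<psi> n) (sphere_gradient (\<psi> n)) \<phi> G \<le> ennreal e" using ex[OF e] by auto
    let ?c = "ennreal ((1 - l) powr (1 - p))"
    have "?X \<le> ?c * sphere_mass p a b \<gamma> (\<psi> n) + d1 l * sphere_dist \<phi> G (\<psi> n) (sphere_gradient (\<psi> n))"
      unfolding d1_def by (rule sphere_mass_perturb[OF m'(1) m'(2) m l \<tau>])
    also have "\<dots> \<le> ?c * sphere_mass p a b \<gamma> (\<psi> n) + d1 l * ennreal e"
      using n by (intro add_left_mono mult_left_mono) (simp_all add: sphere_dist_commute[of \<phi>])
    finally have "ennreal (S \<gamma>) * ?X \<le> ennreal (S \<gamma>) * (?c * sphere_mass p a b \<gamma> (\<psi> n) + d1 l * ennreal e)"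
      by (rule mult_left_mono) simp
    also have "\<dots> = ?c * (ennreal (S \<gamma>) * sphere_mass p a b \<gamma> (\<psi> n)) + ennreal e * (ennreal (S \<gamma>) * d1 l)"
      by (simp add: distrib_left mult_ac)
    also have "\<dots> \<le> ?c * sphere_energy p a b (\<psi> n) (sphere_gradient (\<psi> n)) + ennreal e * (ennreal (S \<gamma>) * d1 l)"
      by (intro add_right_mono mult_left_mono smooth_sphere_inequality \<psi> \<gamma>) simp
    also have "\<dots> \<le> ?c * (?c * sphere_energy p a b \<phi> G + d2 l * ennreal e) + ennreal e * (ennreal (S \<gamma>) * d1 l)"
    proof (intro add_right_mono mult_left_mono)
      have "sphere_energy p a b (\<psi> n) (sphere_gradient (\<psi> n)) \<le> ?c * sphere_energy p a b \<phi> G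
          + d2 l * sphere_dist (\<psi> n) (sphere_gradient (\<psi> n)) \<phi> G"
        unfolding d2_def by (rule sphere_energy_perturb[OF m m' l])
      also have "\<dots> \<le> ?c * sphere_energy p a b \<phi> G + d2 l * ennreal e"
        using n by (intro add_left_mono mult_left_mono) simp_all
      finally show "sphere_energy p a b (\<psi> n) (sphere_gradient (\<psi> n)) \<le> ?c * sphere_energy p a b \<phi> G + d2 l * ennreal e" .
    qed simp
    also have "\<dots> = ennreal ((1 - l) powr (1 - p) * (1 - l) powr (1 - p)) * sphere_energy p a b \<phi> G +
        ennreal e * (?c * d2 l + ennreal (S \<gamma>) * d1 l)"
      by (simp add: ennreal_mult' distrib_left mult_ac add_ac)
    finally show "ennreal (S \<gamma>) * ?X \<le> ennreal ((1 - l) powr (1 - p) * (1 - l) powr (1 - p)) * sphere_energy p a b \<phi> G +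
        ennreal e * (?c * d2 l + ennreal (S \<gamma>) * d1 l)" .
  qed
  then show "ennreal (S \<gamma>) * sphere_mass p a b \<gamma> \<phi> \<le> sphere_energy p a b \<phi> G"
    unfolding sphere_mass_SUP[OF m(1)] by (subst SUP_mult_left_ennreal) (auto intro!: SUP_least)
qed

lemma S_le_S_sphere_const:
  assumes "\<gamma> \<in> gammas"
  shows "S_const tk tm p a b \<gamma> \<le> S_sphere_const tk tm p a b \<gamma>"
  unfolding S_sphere_const_def
proof (rule INF_greatest, clarsimp)
  fix \<phi> :: "(real^'k) \<times> (real^'m) \<Rightarrow> real" and G
  assume W: "W1p_sphere p a \<phi> G" and nz: "\<not> (AE \<sigma> in sphere_measure. \<phi> \<sigma> = 0)"
  note adm = gammasD(1)[OF assms]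
  note ineq = W1p_sphere_inequality[OF W adm]
  have [measurable]: "\<phi> \<in> borel_measurable \<Omega>" using W by (simp add: W1p_sphere_def)
  have [measurable]: "fst \<in> borel_measurable \<Omega>"
    by (rule borel_measurable_sphere) measurable
  let ?M = "sphere_mass p a b \<gamma> \<phi>"
  have M0: "?M \<noteq> 0"
  proof
    assume "?M = 0"
    then have "AE \<sigma> in sphere_measure. \<omega> (a - p - b + \<gamma>) \<sigma> * ennreal (\<bar>\<phi> \<sigma>\<bar> powr p) = 0"
      unfolding sphere_mass_eq by (subst (asm) nn_integral_0_iff_AE) auto
    with AE_sphere_fst_nonzero have "AE \<sigma> in sphere_measure. \<phi> \<sigma> = 0"
      by eventually_elim (auto simp: zero_prod_def prod_eq_iff)
    then show False using nz by contradiction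
  qed
  \<comment> \<open>With infinite mass the quotient would be 0 in \<open>ennreal\<close>; S \<gamma>
    > 0 together with the finite energy excludes this.\<close>
  have M1: "?M \<noteq> \<infinity>"
  proof
    assume "?M = \<infinity>"
    then have "ennreal (S \<gamma>) * ?M = \<infinity>" using S_pos_gammas[OF assms] by (simp add: ennreal_mult_top)
    then show False using ineq by (simp add: top_unique)
  qed
  have "ennreal (S \<gamma>) * ?M / ?M \<le> sphere_energy p a b \<phi> G / ?M"
    by (rule divide_right_mono_ennreal[OF ineq(1)])
  then show "S_const tk tm p a b \<gamma> \<le> sphere_energy p a b \<phi> G / ?M"
    using M0 M1 by (simp add: mult_divide_eq_ennreal S_const_eq[OF adm])
qed

end

section \<open>Spherical averages\<close>

lemma nn_integral_Icc_eq_integral: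
  fixes f :: "real \<Rightarrow> real"
  assumes "continuous_on {c..d} f" "\<And>t. t \<in> {c..d} \<Longrightarrow> f t \<ge> 0"
  shows "(\<integral>\<^sup>+t. ennreal (f t * indicator {c..d} t) \<partial>lborel) = ennreal (integral {c..d} f)"
proof -
  have i: "set_integrable lborel {c..d} f" by (rule borel_integrable_atLeastAtMost'[OF assms(1)])
  have "(\<integral>\<^sup>+t. ennreal (f t * indicator {c..d} t) \<partial>lborel) = ennreal (\<integral>t. f t * indicator {c..d} t \<partial>lborel)"
    using i assms(2) by (intro nn_integral_eq_integral) (auto simp: set_integrable_def mult.commute indicator_def)
  also have "(\<integral>t. f t * indicator {c..d} t \<partial>lborel) = integral {c..d} f"
    using set_borel_integral_eq_integral(2)[OF i] by (simp add: set_lebesgue_integral_def mult.commute)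
  finally show ?thesis .
qed

lemma integral_Holder:
  fixes f g :: "real \<Rightarrow> real"
  assumes f: "continuous_on {c..d} f" "\<And>t. t \<in> {c..d} \<Longrightarrow> f t \<ge> 0"
    and g: "continuous_on {c..d} g" "\<And>t. t \<in> {c..d} \<Longrightarrow> g t \<ge> 0"
    and fg: "continuous_on {c..d} (\<lambda>t. f t powr (1 - s) * g t powr s)" and s: "0 < s" "s < 1"
  shows "integral {c..d} (\<lambda>t. f t powr (1 - s) * g t powr s) \<le> integral {c..d} f powr (1 - s) * integral {c..d} g powr s"
proof -
  have m: "(\<lambda>t. h t * indicator {c..d} t) \<in> borel_measurable lborel" if "continuous_on {c..d} h" for h :: "real \<Rightarrow> real"
    using borel_integrable_atLeastAtMost'[OF that]
    by (auto simp: set_integrable_def mult.commute dest: borel_measurable_integrable)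
  have "ennreal (integral {c..d} (\<lambda>t. f t powr (1 - s) * g t powr s)) =
     (\<integral>\<^sup>+t. ennreal ((f t powr (1 - s) * g t powr s) * indicator {c..d} t) \<partial>lborel)"
    by (rule nn_integral_Icc_eq_integral[symmetric, OF fg]) simp
  also have "\<dots> = (\<integral>\<^sup>+t. (f t * indicator {c..d} t) powr (1 - s) * (g t * indicator {c..d} t) powr s \<partial>lborel)"
    by (intro nn_integral_cong) (simp add: indicator_def)
  also have "\<dots> \<le> ennreal (integral {c..d} f powr (1 - s) * integral {c..d} g powr s)"
  proof (rule nn_integral_Holder)
    show "(\<integral>\<^sup>+t. ennreal (f t * indicator {c..d} t) \<partial>lborel) \<le> ennreal (integral {c..d} f)"
      by (simp only: nn_integral_Icc_eq_integral[OF f] order_refl)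
    show "(\<integral>\<^sup>+t. ennreal (g t * indicator {c..d} t) \<partial>lborel) \<le> ennreal (integral {c..d} g)"
      by (simp only: nn_integral_Icc_eq_integral[OF g] order_refl)
  qed (use m f g s in \<open>auto simp: indicator_def intro!: integral_nonneg integrable_continuous_interval\<close>)
  finally show ?thesis by simp
qed

context hardy_weights
begin

text \<open>The test function \<open>u\<close> is replaced by the \<open>L\<^sup>p\<close>-norms of \<open>(u\<^sup>2 + \<epsilon>\<^sup>2)\<^sup>1\<^sup>/\<^sup>2\<close> along rays; \<open>\<epsilon> > 0\<close> makes
  these norms smooth.\<close>

definition ray_integrand :: "real \<Rightarrow> ((real^'k) \<times> (real^'m) \<Rightarrow> real) \<Rightarrow> real \<times> ((real^'k) \<times> (real^'m)) \<Rightarrow> real" where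
  "ray_integrand \<epsilon> u q = exp (p * H * fst q) * ((u (exp (fst q) *\<^sub>R sgn (snd q)))\<^sup>2 + \<epsilon>\<^sup>2) powr (p / 2)"

text \<open>The range of t is cut to a compact interval so that differentiation under the integral
  needs only continuity of the derivatives.\<close>

definition ray_integral :: "real \<Rightarrow> real \<Rightarrow> ((real^'k) \<times> (real^'m) \<Rightarrow> real) \<Rightarrow> (real^'k) \<times> (real^'m) \<Rightarrow> real" where
  "ray_integral N \<epsilon> u z = integral {- N..N} (\<lambda>t. ray_integrand \<epsilon> u (t, z))"

definition ray_norm :: "real \<Rightarrow> real \<Rightarrow> ((real^'k) \<times> (real^'m) \<Rightarrow> real) \<Rightarrow> (real^'k) \<times> (real^'m) \<Rightarrow> real" where
  "ray_norm N \<epsilon> u z = ray_integral N \<epsilon> u z powr (1 / p)"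

text \<open>As u^2 + \<epsilon>^2 is positive, the real power is only taken where it is
  smooth.\<close>

lemma ray_integrand_smooth:
  assumes u: "u \<in> tests" and \<epsilon>: "\<epsilon> > 0"
  shows "smooth_on (UNIV \<times> - {0}) (ray_integrand \<epsilon> u)"
proof -
  let ?O = "UNIV \<times> - {0} :: (real \<times> ((real^'k) \<times> (real^'m))) set"
  have O: "open ?O" by (intro open_Times) auto
  have s1: "smooth_on ?O (\<lambda>q. exp (c * fst q))" for c
    by (rule smooth_on_compose_real[OF O subset_UNIV smooth_on_bounded_linear smooth_on_exp])
      (intro bounded_linear_const_mult bounded_linear_fst)
  have s2: "smooth_on ?O (\<lambda>q. sgn (snd q) \<bullet> b)" for b
    by (rule smooth_on_compose[OF O _ smooth_on_bounded_linear smooth_on_sgn])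
      (auto intro!: bounded_linear_compose[OF bounded_linear_inner_left bounded_linear_snd])
  have s3: "smooth_on ?O (\<lambda>q. (exp (fst q) *\<^sub>R sgn (snd q)) \<bullet> b)" for b
    using smooth_on_mult[OF O s1[of 1] s2[of b]] by simp
  have s4: "smooth_on ?O (\<lambda>q. u (exp (fst q) *\<^sub>R sgn (snd q)))"
    by (rule smooth_on_compose[OF O subset_UNIV s3 test_functions_smooth[OF u]])
  have "smooth_on ?O (\<lambda>q. u (exp (fst q) *\<^sub>R sgn (snd q)) * u (exp (fst q) *\<^sub>R sgn (snd q)) + \<epsilon>\<^sup>2)"
    by (intro smooth_on_add smooth_on_mult O s4 smooth_on_const)
  then have s5: "smooth_on ?O (\<lambda>q. (u (exp (fst q) *\<^sub>R sgn (snd q)))\<^sup>2 + \<epsilon>\<^sup>2)"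
    by (simp add: power2_eq_square)
  have "smooth_on ?O (\<lambda>q. ((u (exp (fst q) *\<^sub>R sgn (snd q)))\<^sup>2 + \<epsilon>\<^sup>2) powr (p / 2))"
    by (rule smooth_on_compose_real[OF O _ s5 smooth_on_powr]) (use \<epsilon> in \<open>auto intro: add_nonneg_pos\<close>)
  from smooth_on_mult[OF O s1[of "p * H"] this] show ?thesis
    by (simp add: ray_integrand_def[abs_def])
qed

lemma ray_integral_smooth:
  assumes "u \<in> tests" "\<epsilon> > 0"
  shows "smooth_on (- {0}) (ray_integral N \<epsilon> u)"
  using ray_integrand_smooth[OF assms] unfolding smooth_on_def ray_integral_def
  by (auto intro!: Ck_on_param_integral)

lemma ray_integrand_continuous:
  assumes "u \<in> tests" "\<epsilon> > 0" "z \<noteq> 0"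
  shows "continuous_on T (\<lambda>t. ray_integrand \<epsilon> u (t, z))"
  by (rule continuous_on_compose2[OF smooth_on_continuous[OF ray_integrand_smooth[OF assms(1,2)]]])
    (use assms(3) in \<open>auto intro!: continuous_intros\<close>)

text \<open>The power 1 - 1/p of this bound is of order \<epsilon>^(p - 1); a boundary term of order
  \<epsilon>^p divided by it leaves an error of order \<epsilon>.\<close>

lemma ray_integral_lower_bound:
  assumes "u \<in> tests" "\<epsilon> > 0" "z \<noteq> 0" "N > 0"
  shows "2 * N * exp (- p * H * N) * \<epsilon> powr p \<le> ray_integral N \<epsilon> u z"
proof -
  have "integral {- N..N} (\<lambda>t. exp (- p * H * N) * \<epsilon> powr p) \<le> ray_integral N \<epsilon> u z"
    unfolding ray_integral_def
  proof (rule integral_le)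
    show "(\<lambda>t. ray_integrand \<epsilon> u (t, z)) integrable_on {- N..N}"
      by (intro integrable_continuous_interval ray_integrand_continuous assms)
    fix t assume t: "t \<in> {- N..N}"
    have "p * H * - N \<le> p * H * t" using t p H_pos by (intro mult_left_mono) auto
    then have "exp (- p * H * N) \<le> exp (p * H * t)" by simp
    moreover have "\<epsilon> powr p \<le> ((u (exp t *\<^sub>R sgn z))\<^sup>2 + \<epsilon>\<^sup>2) powr (p / 2)"
    proof -
      have "\<epsilon> powr p = (\<epsilon> powr 2) powr (p / 2)" by (simp only: powr_powr) simp
      also have "\<dots> = (\<epsilon>\<^sup>2) powr (p / 2)" using assms(2) by simp
      also have "\<dots> \<le> ((u (exp t *\<^sub>R sgn z))\<^sup>2 + \<epsilon>\<^sup>2) powr (p / 2)" using p by (intro powr_mono2) auto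
      finally show ?thesis .
    qed
    ultimately show "exp (- p * H * N) * \<epsilon> powr p \<le> ray_integrand \<epsilon> u (t, z)"
      unfolding ray_integrand_def by (auto intro!: mult_mono)
  qed auto
  then show ?thesis using assms(4) by (simp add: mult_ac)
qed

lemma ray_integral_pos:
  assumes "u \<in> tests" "\<epsilon> > 0" "z \<noteq> 0" "N > 0"
  shows "ray_integral N \<epsilon> u z > 0"
proof -
  have "2 * N * exp (- p * H * N) * \<epsilon> powr p > 0" using assms by simp
  then show ?thesis using ray_integral_lower_bound[OF assms] by linarith
qed

lemma sgn_sgn_eq: "sgn (sgn z) = sgn (z :: 'a::real_normed_vector)"
  by (cases "z = 0") (auto simp: sgn_div_norm[of "sgn z"] norm_sgn)

lemma ray_norm_sgn: "ray_norm N \<epsilon> u \<circ> sgn = ray_norm N \<epsilon> u"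
  by (simp add: fun_eq_iff ray_norm_def ray_integral_def ray_integrand_def sgn_sgn_eq)

lemma ray_norm_smooth:
  assumes "u \<in> tests" "\<epsilon> > 0" "N > 0"
  shows "smooth_sphere (ray_norm N \<epsilon> u)"
  unfolding smooth_sphere_def ray_norm_sgn unfolding ray_norm_def
proof (rule smooth_on_compose_real[OF _ _ ray_integral_smooth[OF assms(1,2)] smooth_on_powr])
  show "ray_integral N \<epsilon> u ` (- {0}) \<subseteq> {0<..}"
    by (rule image_subsetI) (use ray_integral_pos[OF assms(1,2) _ assms(3)] in blast)
qed (simp add: open_Compl)

text \<open>Both \<Phi>^(1 - 1/p) grad \<psi> and, up to boundary terms and sign, H \<Phi> are
  integrals of the same weight w against the tangential derivative g and the t-derivative r of u.
  Pairing (grad \<psi>, H \<psi>) with its own direction therefore leads to w times a unit-vector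
  component of (g, r), whose norm is e^t |grad u|, and Hoelder's inequality in t finishes.\<close>

lemma ray_norm_gradient_bound:
  fixes \<sigma> :: "(real^'k) \<times> (real^'m)"
  assumes u: "u \<in> tests" and \<epsilon>: "\<epsilon> > 0" and N: "N > 0" and \<sigma>: "norm \<sigma> = 1" and vanish: "u (exp N *\<^sub>R \<sigma>) = 0"
  shows "norm (sphere_gradient (ray_norm N \<epsilon> u) \<sigma>, H * ray_norm N \<epsilon> u \<sigma>) \<le>
    integral {- N..N} (\<lambda>t. exp (p * H * t) * (exp t * norm (gradient u (exp t *\<^sub>R \<sigma>))) powr p) powr (1 / p) +
    exp (p * H * N) / p / (2 * N * exp (- p * H * N)) powr (1 - 1 / p) * \<epsilon>"
proof -
  have s: "sgn \<sigma> = \<sigma>" "\<sigma> \<noteq> 0" using \<sigma> by (auto simp: sgn_div_norm)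
  have du: "u differentiable at z" for z by (rule test_functions_differentiable[OF u])
  define \<Phi> where "\<Phi> = ray_integral N \<epsilon> u \<sigma>"
  define \<psi> where "\<psi> = ray_norm N \<epsilon> u"
  define v2 where "v2 t = (u (exp t *\<^sub>R \<sigma>))\<^sup>2 + \<epsilon>\<^sup>2" for t
  define f where "f t = exp (p * H * t) * v2 t powr (p / 2)" for t
  \<comment> \<open>This is 1/p times the derivative of the integrand with respect to the value of
    u.\<close>
  define w where "w t = exp (p * H * t) * v2 t powr (p / 2 - 1) * u (exp t *\<^sub>R \<sigma>)" for t
  define r where "r t = gradient u (exp t *\<^sub>R \<sigma>) \<bullet> (exp t *\<^sub>R \<sigma>)" for t
  define g where "g t = gradient (\<lambda>z. u (exp t *\<^sub>R sgn z)) \<sigma>" for t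
  define q where "q t = exp t * norm (gradient u (exp t *\<^sub>R \<sigma>))" for t
  define A where "A = integral {- N..N} (\<lambda>t. exp (p * H * t) * q t powr p)"
  have v2: "v2 t > 0" for t using \<epsilon> by (simp add: v2_def add_nonneg_pos)
  have ray: "ray_integrand \<epsilon> u (t, \<sigma>) = f t" for t
    by (simp add: ray_integrand_def f_def v2_def s)
  have \<Phi>: "\<Phi> = integral {- N..N} f" by (simp add: \<Phi>_def ray_integral_def ray)
  have \<Phi>_pos: "\<Phi> > 0" unfolding \<Phi>_def by (rule ray_integral_pos[OF u \<epsilon> s(2) N])
  have cu: "continuous_on T (\<lambda>t. u (exp t *\<^sub>R \<sigma>))" for T
    by (rule continuous_on_compose2[OF test_functions_continuous[OF u]]) (auto intro!: continuous_intros)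
  have cg: "continuous_on T (\<lambda>t. gradient u (exp t *\<^sub>R \<sigma>))" for T
    by (rule continuous_on_compose2[OF continuous_on_gradient[OF test_functions_smooth[OF u]]]) (auto intro!: continuous_intros)
  have cv2: "continuous_on T v2" for T unfolding v2_def by (intro continuous_intros cu)
  have cpow: "continuous_on T (\<lambda>t. v2 t powr c)" for T c
    by (intro continuous_on_powr cv2 continuous_on_const) (use v2 less_irrefl in metis)
  have cf: "continuous_on T f" for T unfolding f_def by (intro continuous_intros cpow)
  have cw: "continuous_on T w" for T unfolding w_def by (intro continuous_intros cpow cu)
  have cr: "continuous_on T r" for T unfolding r_def by (intro continuous_intros cg)
  have cq: "continuous_on T q" for T unfolding q_def by (intro continuous_intros cg)
  have g_eq: "g t = exp t *\<^sub>R (gradient u (exp t *\<^sub>R \<sigma>) - (\<sigma> \<bullet> gradient u (exp t *\<^sub>R \<sigma>)) *\<^sub>R \<sigma>)" for t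
    unfolding g_def by (rule gradient_sgn_compose[OF \<sigma> du])
  have cgt: "continuous_on T g" for T unfolding g_eq by (intro continuous_intros cg)
  have cqp: "continuous_on T (\<lambda>t. q t powr p)" for T
    by (intro continuous_on_powr' cq continuous_on_const) (use p in \<open>auto simp: q_def\<close>)
  note ii = integrable_continuous_interval
  have grq: "norm (g t, r t) = q t" for t
    unfolding g_def r_def q_def by (rule norm_gradient_polar[OF \<sigma> du]) simp
  have partial: "frechet_derivative (ray_integrand \<epsilon> u) (at (t, \<sigma>)) (0, h) = p * (w t * (g t \<bullet> h))" for t h
  proof -
    have d: "ray_integrand \<epsilon> u differentiable at (t, \<sigma>)"
      by (rule smooth_on_differentiable[OF ray_integrand_smooth[OF u \<epsilon>]]) (use s in auto)
    have "((\<lambda>z. ray_integrand \<epsilon> u (t, z)) has_derivative (\<lambda>h. frechet_derivative (ray_integrand \<epsilon> u) (at (t, \<sigma>)) (0, h))) (at \<sigma>)"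
      by (rule has_derivative_compose[of "\<lambda>z. (t, z)" "\<lambda>h. (0, h)" \<sigma> UNIV "ray_integrand \<epsilon> u"])
        (use frechet_has_derivative[OF d] in \<open>auto intro!: derivative_eq_intros\<close>)
    moreover have "((\<lambda>z. ray_integrand \<epsilon> u (t, z)) has_derivative (\<lambda>h. p * (w t * (g t \<bullet> h)))) (at \<sigma>)"
    proof -
      have "((\<lambda>z. exp t *\<^sub>R sgn z) has_derivative (\<lambda>h. exp t *\<^sub>R (h - (\<sigma> \<bullet> h) *\<^sub>R \<sigma>))) (at \<sigma>)"
        by (intro derivative_intros has_derivative_sgn_sphere \<sigma>)
      then have "(\<lambda>z. exp t *\<^sub>R sgn z) differentiable at \<sigma>" by (rule differentiableI)
      then have "(u \<circ> (\<lambda>z. exp t *\<^sub>R sgn z)) differentiable at \<sigma>"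
        using du by (rule differentiable_chain_at)
      then have dd: "(\<lambda>z. u (exp t *\<^sub>R sgn z)) differentiable at \<sigma>" by (simp add: o_def)
      have "frechet_derivative (\<lambda>z. u (exp t *\<^sub>R sgn z)) (at \<sigma>) = (\<lambda>h. g t \<bullet> h)"
        by (simp add: fun_eq_iff g_def frechet_derivative_eq_gradient[OF dd])
      then have 1: "((\<lambda>z. u (exp t *\<^sub>R sgn z)) has_derivative (\<lambda>h. g t \<bullet> h)) (at \<sigma>)"
        using frechet_has_derivative[OF dd] by simp
      have "((\<lambda>x. exp (p * H * t) * (x\<^sup>2 + \<epsilon>\<^sup>2) powr (p / 2)) has_real_derivative p * w t) (at (u (exp t *\<^sub>R sgn \<sigma>)))"
      proof -
        let ?x = "u (exp t *\<^sub>R \<sigma>)"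
        have "((\<lambda>x. x\<^sup>2 + \<epsilon>\<^sup>2) has_real_derivative 2 * ?x) (at ?x)"
          by (auto intro!: derivative_eq_intros)
        from DERIV_fun_powr[OF this, of "p / 2"] v2[of t]
        have "((\<lambda>x. (x\<^sup>2 + \<epsilon>\<^sup>2) powr (p / 2)) has_real_derivative p / 2 * (?x\<^sup>2 + \<epsilon>\<^sup>2) powr (p / 2 - of_nat 1) * (2 * ?x)) (at ?x)"
          by (simp add: v2_def)
        from DERIV_cmult[OF this, of "exp (p * H * t)"] show ?thesis
          unfolding s by (rule DERIV_cong) (simp add: w_def v2_def)
      qed
      from has_derivative_compose[OF 1 this[unfolded has_field_derivative_def]]
      show ?thesis by (simp add: ray_integrand_def mult.assoc)
    qed
    ultimately have "(\<lambda>h. frechet_derivative (ray_integrand \<epsilon> u) (at (t, \<sigma>)) (0, h)) = (\<lambda>h. p * (w t * (g t \<bullet> h)))"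
      by (rule has_derivative_unique)
    then show ?thesis by meson
  qed
  have D\<Phi>: "(ray_integral N \<epsilon> u has_derivative (\<lambda>h. p * integral {- N..N} (\<lambda>t. w t * (g t \<bullet> h)))) (at \<sigma>)"
  proof -
    have "Ck_on (Suc 0) (UNIV \<times> - {0}) (ray_integrand \<epsilon> u)"
      using ray_integrand_smooth[OF u \<epsilon>] by (simp add: smooth_on_def)
    from has_derivative_param_integral[OF _ this, of \<sigma> "- N" N] s show ?thesis
      by (simp add: partial ray_integral_def[abs_def] open_Compl)
  qed
  \<comment> \<open>The left-hand side is 1/p times the derivative of \<Phi> = \<psi>^p in the
    direction h.\<close>
  have grad: "\<Phi> powr (1 - 1 / p) * (sphere_gradient \<psi> \<sigma> \<bullet> h) = integral {- N..N} (\<lambda>t. w t * (g t \<bullet> h))" for h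
  proof -
    have "((\<lambda>x. x powr (1 / p)) has_real_derivative 1 / p * \<Phi> powr (1 / p - 1)) (at \<Phi>)"
      by (rule has_real_derivative_powr[OF \<Phi>_pos])
    from has_derivative_compose[OF D\<Phi> this[unfolded has_field_derivative_def \<Phi>_def]]
    have d\<psi>: "(\<psi> has_derivative (\<lambda>h. 1 / p * \<Phi> powr (1 / p - 1) * (p * integral {- N..N} (\<lambda>t. w t * (g t \<bullet> h))))) (at \<sigma>)"
      by (simp add: \<psi>_def ray_norm_def[abs_def] \<Phi>_def)
    have "sphere_gradient \<psi> \<sigma> \<bullet> h = frechet_derivative \<psi> (at \<sigma>) h"
      using frechet_derivative_eq_gradient[OF differentiableI[OF d\<psi>]]
      by (simp add: sphere_gradient_def \<psi>_def ray_norm_sgn)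
    also have "\<dots> = \<Phi> powr (1 / p - 1) * integral {- N..N} (\<lambda>t. w t * (g t \<bullet> h))"
      unfolding has_derivative_frechetI[OF d\<psi>] using p by simp
    finally have "\<Phi> powr (1 - 1 / p) * (sphere_gradient \<psi> \<sigma> \<bullet> h) =
        (\<Phi> powr (1 - 1 / p) * \<Phi> powr (1 / p - 1)) * integral {- N..N} (\<lambda>t. w t * (g t \<bullet> h))" by simp
    also have "\<Phi> powr (1 - 1 / p) * \<Phi> powr (1 / p - 1) = 1"
      using \<Phi>_pos by (simp add: powr_add[symmetric])
    finally show ?thesis by simp
  qed
  \<comment> \<open>Integration of f' = p H f + p w r over [-N, N]. The value f (-N) \<ge> 0 is
    dropped, and f N is known because u vanishes at the outer end of the ray.\<close>
  have parts: "H * \<Phi> \<le> exp (p * H * N) * \<epsilon> powr p / p - integral {- N..N} (\<lambda>t. w t * r t)"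
  proof -
    have "(f has_real_derivative p * H * f t + p * (w t * r t)) (at t)" for t
    proof -
      have "((\<lambda>t. exp t *\<^sub>R \<sigma>) has_vector_derivative exp t *\<^sub>R \<sigma>) (at t)"
        by (auto intro!: derivative_eq_intros)
      then have "((\<lambda>t. u (exp t *\<^sub>R \<sigma>)) has_real_derivative r t) (at t)"
        unfolding r_def by (rule DERIV_gradient_compose[OF _ du])
      then have "(v2 has_real_derivative 2 * u (exp t *\<^sub>R \<sigma>) * r t) (at t)"
        unfolding v2_def by (auto intro!: derivative_eq_intros)
      from DERIV_fun_powr[OF this v2, of "p / 2"]
      have 1: "((\<lambda>t. v2 t powr (p / 2)) has_real_derivative p / 2 * v2 t powr (p / 2 - of_nat 1) * (2 * u (exp t *\<^sub>R \<sigma>) * r t)) (at t)" .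
      have 2: "((\<lambda>t. exp (p * H * t)) has_real_derivative p * H * exp (p * H * t)) (at t)"
        by (auto intro!: derivative_eq_intros)
      show ?thesis
        unfolding f_def[abs_def] by (rule DERIV_cong[OF DERIV_mult[OF 2 1]]) (simp add: w_def f_def)
    qed
    then have "((\<lambda>t. p * H * f t + p * (w t * r t)) has_integral f N - f (- N)) {- N..N}"
      using N by (intro fundamental_theorem_of_calculus)
        (auto simp: has_real_derivative_iff_has_vector_derivative[symmetric] intro: has_field_derivative_at_within)
    then have "integral {- N..N} (\<lambda>t. p * H * f t + p * (w t * r t)) = f N - f (- N)" by (rule integral_unique)
    moreover have "integral {- N..N} (\<lambda>t. p * H * f t + p * (w t * r t)) = p * H * \<Phi> + p * integral {- N..N} (\<lambda>t. w t * r t)"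
      unfolding \<Phi> by (subst integral_add) (auto intro!: ii continuous_intros cf cw cr)
    moreover have "f (- N) \<ge> 0" by (simp add: f_def)
    moreover have "f N = exp (p * H * N) * \<epsilon> powr p"
    proof -
      have "(\<epsilon>\<^sup>2) powr (p / 2) = (\<epsilon> powr 2) powr (p / 2)" using \<epsilon> by simp
      also have "\<dots> = \<epsilon> powr p" by (simp only: powr_powr) simp
      finally show ?thesis by (simp add: f_def v2_def vanish)
    qed
    ultimately have "p * (H * \<Phi> + integral {- N..N} (\<lambda>t. w t * r t)) \<le> exp (p * H * N) * \<epsilon> powr p"
      by (simp add: algebra_simps)
    then have "H * \<Phi> + integral {- N..N} (\<lambda>t. w t * r t) \<le> exp (p * H * N) * \<epsilon> powr p / p"
      using p by (simp add: pos_le_divide_eq mult.commute)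
    then show ?thesis by linarith
  qed
  define n where "n = norm (sphere_gradient \<psi> \<sigma>, H * \<psi> \<sigma>)"
  have \<psi>_eq: "\<psi> \<sigma> = \<Phi> powr (1 / p)" by (simp add: \<psi>_def ray_norm_def \<Phi>_def)
  then have \<psi>_pos: "\<psi> \<sigma> > 0" using \<Phi>_pos by simp
  have nH: "H * \<psi> \<sigma> \<le> n" using norm_snd_le[of "H * \<psi> \<sigma>" "sphere_gradient \<psi> \<sigma>"] by (simp add: n_def)
  then have n: "n > 0" using H_pos \<psi>_pos by (meson less_le_trans mult_pos_pos)
  \<comment> \<open>(h, \<eta>) is the unit vector in the direction of (grad \<psi>, H \<psi>), so
    pairing with it recovers n. The integration by parts introduces a minus sign, hence (h, -\<eta>)
    in \<open>unit\<close>; \<eta> \<ge> 0 lets the inequality \<open>parts\<close> be multiplied by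
    \<eta>.\<close>
  define h where "h = (1 / n) *\<^sub>R sphere_gradient \<psi> \<sigma>"
  define \<eta> where "\<eta> = H * \<psi> \<sigma> / n"
  have \<eta>: "0 \<le> \<eta>" "\<eta> \<le> 1" using nH n H_pos \<psi>_pos by (simp_all add: \<eta>_def)
  have unit: "norm (h, - \<eta>) = 1"
  proof -
    have "(h, - \<eta>) = (1 / n) *\<^sub>R (sphere_gradient \<psi> \<sigma>, - (H * \<psi> \<sigma>))" by (simp add: h_def \<eta>_def)
    moreover have "norm (sphere_gradient \<psi> \<sigma>, - (H * \<psi> \<sigma>)) = n" by (simp add: n_def norm_Pair)
    ultimately show ?thesis using n by (simp only: norm_scaleR) simp
  qed
  have n_eq: "n = sphere_gradient \<psi> \<sigma> \<bullet> h + \<eta> * (H * \<psi> \<sigma>)"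
  proof -
    have "n * n = sphere_gradient \<psi> \<sigma> \<bullet> sphere_gradient \<psi> \<sigma> + (H * \<psi> \<sigma>) * (H * \<psi> \<sigma>)"
      unfolding n_def power2_eq_square[symmetric] power2_norm_eq_inner by (simp add: inner_prod_def power2_eq_square)
    then have "n = (sphere_gradient \<psi> \<sigma> \<bullet> sphere_gradient \<psi> \<sigma> + (H * \<psi> \<sigma>) * (H * \<psi> \<sigma>)) / n"
      using n by (simp add: nonzero_eq_divide_eq)
    then show ?thesis by (simp add: h_def \<eta>_def add_divide_distrib)
  qed
  have wq: "w t * (g t \<bullet> h) - \<eta> * (w t * r t) \<le> f t powr (1 - 1 / p) * (exp (p * H * t) * q t powr p) powr (1 / p)" for t
  proof -
    have "w t * (g t \<bullet> h) - \<eta> * (w t * r t) = w t * ((g t, r t) \<bullet> (h, - \<eta>))"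
      by (simp add: algebra_simps)
    also have "\<dots> \<le> \<bar>w t\<bar> * \<bar>(g t, r t) \<bullet> (h, - \<eta>)\<bar>"
      unfolding abs_mult[symmetric] by (rule abs_ge_self)
    also have "\<dots> \<le> \<bar>w t\<bar> * q t"
      using Cauchy_Schwarz_ineq2[of "(g t, r t)" "(h, - \<eta>)"] unfolding unit grq by (intro mult_left_mono) auto
    \<comment> \<open>Bounding |u| by (u^2 + \<epsilon>^2)^(1/2) produces exactly the power of f
      that Hoelder's inequality with exponents 1 - 1/p and 1/p calls for.\<close>
    also have "\<dots> \<le> (exp (p * H * t) * v2 t powr (p / 2 - 1 / 2)) * q t"
    proof (rule mult_right_mono)
      have "\<bar>u (exp t *\<^sub>R \<sigma>)\<bar> = ((u (exp t *\<^sub>R \<sigma>))\<^sup>2) powr (1 / 2)" by (simp add: powr_half_sqrt)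
      also have "\<dots> \<le> v2 t powr (1 / 2)" by (intro powr_mono2) (auto simp: v2_def)
      finally have "v2 t powr (p / 2 - 1) * \<bar>u (exp t *\<^sub>R \<sigma>)\<bar> \<le> v2 t powr (p / 2 - 1) * v2 t powr (1 / 2)"
        by (rule mult_left_mono) simp
      also have "\<dots> = v2 t powr (p / 2 - 1 / 2)" by (simp add: powr_add[symmetric])
      finally show "\<bar>w t\<bar> \<le> exp (p * H * t) * v2 t powr (p / 2 - 1 / 2)"
        by (simp add: w_def abs_mult mult.assoc)
    qed (simp add: q_def)
    also have "\<dots> = f t powr (1 - 1 / p) * (exp (p * H * t) * q t powr p) powr (1 / p)"
    proof -
      have e: "p / 2 * (1 - 1 / p) = p / 2 - 1 / 2" "p * (1 / p) = 1" using p by (simp_all add: field_simps)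
      have "f t powr (1 - 1 / p) * (exp (p * H * t) * q t powr p) powr (1 / p) =
        (exp (p * H * t) powr (1 - 1 / p) * exp (p * H * t) powr (1 / p)) * (v2 t powr (p / 2 * (1 - 1 / p)) * q t powr (p * (1 / p)))"
        unfolding f_def by (simp only: powr_mult powr_powr mult_ac)
      also have "exp (p * H * t) powr (1 - 1 / p) * exp (p * H * t) powr (1 / p) = exp (p * H * t)"
        by (simp add: powr_add[symmetric])
      finally show ?thesis unfolding e by (simp add: q_def)
    qed
    finally show ?thesis .
  qed
  have cH: "continuous_on T (\<lambda>t. f t powr (1 - 1 / p) * (exp (p * H * t) * q t powr p) powr (1 / p))" for T
  proof (intro continuous_on_mult)
    have "f t > 0" for t using v2[of t] by (simp add: f_def)
    then show "continuous_on T (\<lambda>t. f t powr (1 - 1 / p))"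
      by (intro continuous_on_powr cf continuous_on_const) (metis less_irrefl)
    show "continuous_on T (\<lambda>t. (exp (p * H * t) * q t powr p) powr (1 / p))"
      by (intro continuous_on_powr' continuous_on_mult continuous_on_exp cqp continuous_on_const continuous_on_id) (use p in auto)
  qed
  have "\<Phi> powr (1 - 1 / p) * n = integral {- N..N} (\<lambda>t. w t * (g t \<bullet> h)) + \<eta> * (H * \<Phi>)"
  proof -
    have "\<Phi> powr (1 - 1 / p) * \<psi> \<sigma> = \<Phi>"
      unfolding \<psi>_eq using \<Phi>_pos by (simp add: powr_add[symmetric])
    then have "\<Phi> powr (1 - 1 / p) * (\<eta> * (H * \<psi> \<sigma>)) = \<eta> * (H * \<Phi>)" by (metis mult.left_commute)
    moreover have "\<Phi> powr (1 - 1 / p) * n = \<Phi> powr (1 - 1 / p) * (sphere_gradient \<psi> \<sigma> \<bullet> h) + \<Phi> powr (1 - 1 / p) * (\<eta> * (H * \<psi> \<sigma>))"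
      by (subst n_eq) (simp add: distrib_left)
    ultimately show ?thesis by (simp add: grad)
  qed
  also have "\<dots> \<le> integral {- N..N} (\<lambda>t. w t * (g t \<bullet> h)) + \<eta> * (exp (p * H * N) * \<epsilon> powr p / p - integral {- N..N} (\<lambda>t. w t * r t))"
    by (intro add_left_mono mult_left_mono parts \<eta>)
  also have "\<dots> = integral {- N..N} (\<lambda>t. w t * (g t \<bullet> h) - \<eta> * (w t * r t)) + \<eta> * (exp (p * H * N) * \<epsilon> powr p / p)"
    by (subst integral_diff) (auto intro!: ii continuous_intros cw cr cgt simp: algebra_simps)
  also have "\<dots> \<le> integral {- N..N} (\<lambda>t. f t powr (1 - 1 / p) * (exp (p * H * t) * q t powr p) powr (1 / p)) + 1 * (exp (p * H * N) * \<epsilon> powr p / p)"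
    using \<eta> p by (intro add_mono mult_right_mono integral_le wq ii cH) (auto intro!: continuous_intros cw cr cgt)
  also have "integral {- N..N} (\<lambda>t. f t powr (1 - 1 / p) * (exp (p * H * t) * q t powr p) powr (1 / p)) \<le> \<Phi> powr (1 - 1 / p) * A powr (1 / p)"
    unfolding \<Phi> A_def
  proof (rule integral_Holder[OF cf _ _ _ cH])
    show "continuous_on {- N..N} (\<lambda>t. exp (p * H * t) * q t powr p)"
      by (intro continuous_on_mult continuous_on_exp cqp continuous_on_const continuous_on_id)
  qed (use p in \<open>simp_all add: f_def\<close>)
  finally have main: "\<Phi> powr (1 - 1 / p) * n \<le> \<Phi> powr (1 - 1 / p) * A powr (1 / p) + exp (p * H * N) / p * \<epsilon> powr p"
    by simp
  define c where "c = 2 * N * exp (- p * H * N)"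
  have c: "c > 0" using N by (simp add: c_def)
  have lower: "c powr (1 - 1 / p) * \<epsilon> powr (p - 1) \<le> \<Phi> powr (1 - 1 / p)"
  proof -
    have "(c * \<epsilon> powr p) powr (1 - 1 / p) \<le> \<Phi> powr (1 - 1 / p)"
      using ray_integral_lower_bound[OF u \<epsilon> s(2) N] c p by (intro powr_mono2) (auto simp: c_def \<Phi>_def)
    moreover have "p * (1 - 1 / p) = p - 1" using p by (simp add: field_simps)
    ultimately show ?thesis by (simp add: powr_mult powr_powr)
  qed
  \<comment> \<open>The boundary term divided by the bound in \<open>lower\<close> is B
    \<epsilon>.\<close>
  define B where "B = exp (p * H * N) / p / c powr (1 - 1 / p)"
  have "exp (p * H * N) / p * \<epsilon> powr p = B * \<epsilon> * (c powr (1 - 1 / p) * \<epsilon> powr (p - 1))"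
    using c \<epsilon> by (simp add: B_def powr_diff)
  also have "\<dots> \<le> B * \<epsilon> * \<Phi> powr (1 - 1 / p)"
    using lower \<epsilon> p by (intro mult_left_mono) (auto simp: B_def)
  finally have "\<Phi> powr (1 - 1 / p) * n \<le> \<Phi> powr (1 - 1 / p) * (A powr (1 / p) + B * \<epsilon>)"
    using main by (simp add: distrib_left mult_ac)
  then have "n \<le> A powr (1 / p) + B * \<epsilon>" using \<Phi>_pos by simp
  then show ?thesis by (simp add: n_def \<psi>_def A_def B_def c_def q_def)
qed


section \<open>Comparison of the two constants\<close>

text \<open>A smooth function with its gradient lies in the completion, by the constant sequence. If
  its mass is infinite, the quotient and hence the spherical constant are 0, and
  \<open>0 * \<infinity> = 0\<close>.\<close>

lemma S_sphere_const_le_smooth: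
  fixes \<psi> :: "(real^'k) \<times> (real^'m) \<Rightarrow> real"
  assumes \<psi>: "smooth_sphere \<psi>"
  shows "S_sphere_const tk tm p a b \<gamma> * sphere_mass p a b \<gamma> \<psi> \<le> sphere_energy p a b \<psi> (sphere_gradient \<psi>)"
proof (cases "sphere_mass p a b \<gamma> \<psi> = 0")
  case False
  let ?E = "sphere_energy p a b \<psi> (sphere_gradient \<psi>)" and ?M = "sphere_mass p a b \<gamma> \<psi>"
  note m = smooth_sphere_continuous[OF \<psi>, THEN continuous_on_sphere_measurable]
  have "W1p_sphere p a \<psi> (sphere_gradient \<psi>)"
    unfolding W1p_sphere_def using m \<psi> p by (auto intro!: exI[of _ "\<lambda>_. \<psi>"])
  moreover have "\<not> (AE \<sigma> in sphere_measure. \<psi> \<sigma> = 0)"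
  proof
    assume "AE \<sigma> in sphere_measure. \<psi> \<sigma> = 0"
    then have "?M = (\<integral>\<^sup>+\<sigma>. 0 \<partial>\<Omega>)"
      unfolding sphere_mass_eq using p by (intro nn_integral_cong_AE) (auto elim: eventually_mono)
    then show False using False by simp
  qed
  ultimately have le: "S_sphere_const tk tm p a b \<gamma> \<le> ?E / ?M"
    unfolding S_sphere_const_def by (intro INF_lower2[of "(\<psi>, sphere_gradient \<psi>)"]) auto
  show ?thesis
  proof (cases "?M = \<infinity>")
    case True
    then have "S_sphere_const tk tm p a b \<gamma> = 0" using le by (simp add: divide_ennreal_def)
    then show ?thesis by simp
  next
    case False
    have "S_sphere_const tk tm p a b \<gamma> * ?M \<le> ?E / ?M * ?M" by (rule mult_right_mono[OF le]) simp
    also have "\<dots> = ?E" using False \<open>?M \<noteq> 0\<close> by (simp add: ennreal_divide_times ennreal_divide_self less_top[symmetric])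
    finally show ?thesis .
  qed
qed simp

text \<open>In logarithmic coordinates the annulus is the range |t| \<le> N of the truncated ray,
  and the regularisation only increases the integrand.\<close>

lemma ray_norm_mass:
  assumes u: "u \<in> tests" and \<epsilon>: "\<epsilon> > 0" and N: "N > 0"
  shows "weighted_mass p a b \<gamma> (\<lambda>z. u z * indicator {z. exp (- N) \<le> norm z \<and> norm z \<le> exp N} z) \<le>
    sphere_mass p a b \<gamma> (ray_norm N \<epsilon> u)"
proof -
  note [measurable] = test_functions_measurable[OF u]
  let ?u = "\<lambda>z. u z * indicator {z. exp (- N) \<le> norm z \<and> norm z \<le> exp N} z"
  have [measurable]: "?u \<in> borel_measurable borel" by measurable
  show ?thesis
    unfolding weighted_mass_polar[OF \<open>?u \<in> borel_measurable borel\<close>] sphere_mass_eq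
  proof (intro nn_integral_mono mult_left_mono)
    fix \<sigma> :: "(real^'k) \<times> (real^'m)" assume "\<sigma> \<in> space \<Omega>"
    then have n: "norm \<sigma> = 1" by simp
    then have s: "sgn \<sigma> = \<sigma>" "\<sigma> \<noteq> 0" by (auto simp: sgn_div_norm)
    have "(\<integral>\<^sup>+t. ennreal (exp (p * H * t) * \<bar>?u (exp t *\<^sub>R \<sigma>)\<bar> powr p) \<partial>lborel) \<le>
      (\<integral>\<^sup>+t. ennreal (ray_integrand \<epsilon> u (t, \<sigma>) * indicator {- N..N} t) \<partial>lborel)"
    proof (intro nn_integral_mono ennreal_leI)
      fix t
      show "exp (p * H * t) * \<bar>?u (exp t *\<^sub>R \<sigma>)\<bar> powr p \<le> ray_integrand \<epsilon> u (t, \<sigma>) * indicator {- N..N} t"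
      proof (cases "t \<in> {- N..N}")
        case True
        have "\<bar>u (exp t *\<^sub>R \<sigma>)\<bar> powr p = ((u (exp t *\<^sub>R \<sigma>))\<^sup>2) powr (p / 2)"
        proof -
          have "\<bar>u (exp t *\<^sub>R \<sigma>)\<bar> = ((u (exp t *\<^sub>R \<sigma>))\<^sup>2) powr (1 / 2)" by (simp add: powr_half_sqrt)
          then show ?thesis by (simp only: powr_powr) simp
        qed
        also have "\<dots> \<le> ((u (exp t *\<^sub>R \<sigma>))\<^sup>2 + \<epsilon>\<^sup>2) powr (p / 2)" using p by (intro powr_mono2) auto
        finally show ?thesis using True by (simp add: ray_integrand_def s indicator_def n)
      next
        case False
        then have u0: "?u (exp t *\<^sub>R \<sigma>) = 0" by (auto simp: indicator_def n)
        show ?thesis unfolding u0 using False by simp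
      qed
    qed
    also have "\<dots> = ennreal (ray_integral N \<epsilon> u \<sigma>)"
      unfolding ray_integral_def
      by (rule nn_integral_Icc_eq_integral[OF ray_integrand_continuous[OF u \<epsilon> s(2)]]) (simp add: ray_integrand_def)
    also have "ray_integral N \<epsilon> u \<sigma> = \<bar>ray_norm N \<epsilon> u \<sigma>\<bar> powr p"
      using ray_integral_pos[OF u \<epsilon> s(2) N] p by (simp add: ray_norm_def powr_powr)
    finally show "(\<integral>\<^sup>+t. ennreal (exp (p * H * t) * \<bar>?u (exp t *\<^sub>R \<sigma>)\<bar> powr p) \<partial>lborel) \<le> ennreal (\<bar>ray_norm N \<epsilon> u \<sigma>\<bar> powr p)" .
  qed simp
qed

text \<open>The p-th power of the pointwise bound, with the error of order \<epsilon> split off,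
  integrated against |y|^a. The truncated ray integral is below the full one, which is that of
  \<open>weighted_energy_polar\<close>.\<close>

lemma ray_norm_energy:
  assumes u: "u \<in> tests" and \<epsilon>: "\<epsilon> > 0" and N: "N > 0" and l: "0 < l" "l < 1"
    and vanish: "\<And>\<sigma>. norm \<sigma> = 1 \<Longrightarrow> u (exp N *\<^sub>R \<sigma>) = 0"
  defines "B \<equiv> exp (p * H * N) / p / (2 * N * exp (- p * H * N)) powr (1 - 1 / p)"
  shows "sphere_energy p a b (ray_norm N \<epsilon> u) (sphere_gradient (ray_norm N \<epsilon> u)) \<le>
    ennreal ((1 - l) powr (1 - p)) * weighted_energy p a b u +
    ennreal (\<epsilon> powr p) * (ennreal (l powr (1 - p) * B powr p) *
      (\<integral>\<^sup>+\<sigma>. \<omega> a \<sigma> \<partial>\<Omega>))"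
proof -
  have B: "B \<ge> 0" using p by (simp add: B_def)
  have [measurable]: "fst \<in> borel_measurable \<Omega>"
    by (rule borel_measurable_sphere) measurable
  note [measurable] = gradient_measurable[OF u]
  define I where "I \<sigma> = (\<integral>\<^sup>+t. ennreal (exp (p * H * t) * (exp t * norm (gradient u (exp t *\<^sub>R \<sigma>))) powr p) \<partial>lborel)" for \<sigma>
  have [measurable]: "I \<in> borel_measurable \<Omega>"
    unfolding I_def by (rule borel_measurable_sphere) measurable
  have "sphere_energy p a b (ray_norm N \<epsilon> u) (sphere_gradient (ray_norm N \<epsilon> u)) \<le>
    (\<integral>\<^sup>+\<sigma>. ennreal ((1 - l) powr (1 - p)) * (\<omega> a \<sigma> * I \<sigma>) +
      ennreal (\<epsilon> powr p) * (ennreal (l powr (1 - p) * B powr p) * \<omega> a \<sigma>) \<partial>\<Omega>)"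
    unfolding sphere_energy_eq
  proof (rule nn_integral_mono)
    fix \<sigma> :: "(real^'k) \<times> (real^'m)" assume "\<sigma> \<in> space \<Omega>"
    then have n: "norm \<sigma> = 1" by simp
    define q where "q t = exp (p * H * t) * (exp t * norm (gradient u (exp t *\<^sub>R \<sigma>))) powr p" for t
    define A where "A = integral {- N..N} q"
    have cq: "continuous_on {- N..N} q"
    proof -
      have ch: "continuous_on {- N..N} (\<lambda>t. exp t * norm (gradient u (exp t *\<^sub>R \<sigma>)))"
        by (intro continuous_intros continuous_on_compose2[OF continuous_on_gradient[OF test_functions_smooth[OF u]]]) auto
      have "continuous_on {- N..N} (\<lambda>t. (exp t * norm (gradient u (exp t *\<^sub>R \<sigma>))) powr p)"
        by (rule continuous_on_powr'[OF ch continuous_on_const]) (use p in auto)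
      then show ?thesis
        unfolding q_def by (intro continuous_on_mult continuous_on_const continuous_on_exp continuous_on_id)
    qed
    have A0: "A \<ge> 0" unfolding A_def by (intro integral_nonneg integrable_continuous_interval cq) (simp add: q_def)
    have AI: "ennreal A \<le> I \<sigma>"
    proof -
      have "ennreal A = (\<integral>\<^sup>+t. ennreal (q t * indicator {- N..N} t) \<partial>lborel)"
        unfolding A_def by (rule nn_integral_Icc_eq_integral[symmetric, OF cq]) (simp add: q_def)
      also have "\<dots> \<le> I \<sigma>"
        unfolding I_def q_def by (intro nn_integral_mono ennreal_leI) (simp add: indicator_def)
      finally show ?thesis .
    qed
    have "norm (sphere_gradient (ray_norm N \<epsilon> u) \<sigma>, H * ray_norm N \<epsilon> u \<sigma>) powr p \<le> (A powr (1 / p) + B * \<epsilon>) powr p"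
      using ray_norm_gradient_bound[OF u \<epsilon> N n vanish[OF n]] p
      by (intro powr_mono2) (auto simp: A_def q_def[abs_def] B_def)
    also have "\<dots> \<le> (1 - l) powr (1 - p) * (A powr (1 / p)) powr p + l powr (1 - p) * (B * \<epsilon>) powr p"
      by (rule powr_add_le_weighted) (use p l B \<epsilon> in auto)
    also have "\<dots> = (1 - l) powr (1 - p) * A + \<epsilon> powr p * (l powr (1 - p) * B powr p)"
      using A0 B \<epsilon> p by (simp add: powr_powr powr_mult)
    finally have "ennreal (norm (sphere_gradient (ray_norm N \<epsilon> u) \<sigma>, H * ray_norm N \<epsilon> u \<sigma>) powr p) \<le>
      ennreal ((1 - l) powr (1 - p)) * ennreal A + ennreal (\<epsilon> powr p) * ennreal (l powr (1 - p) * B powr p)"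
      using A0 by (simp add: ennreal_mult'[symmetric] ennreal_plus[symmetric] del: ennreal_plus)
    also have "\<dots> \<le> ennreal ((1 - l) powr (1 - p)) * I \<sigma> + ennreal (\<epsilon> powr p) * ennreal (l powr (1 - p) * B powr p)"
      by (intro add_right_mono mult_left_mono AI) simp
    finally have "\<omega> a \<sigma> * ennreal (norm (sphere_gradient (ray_norm N \<epsilon> u) \<sigma>, H * ray_norm N \<epsilon> u \<sigma>) powr p) \<le>
      \<omega> a \<sigma> * (ennreal ((1 - l) powr (1 - p)) * I \<sigma> + ennreal (\<epsilon> powr p) * ennreal (l powr (1 - p) * B powr p))"
      by (rule mult_left_mono) simp
    then show "\<omega> a \<sigma> * ennreal (norm (sphere_gradient (ray_norm N \<epsilon> u) \<sigma>, H * ray_norm N \<epsilon> u \<sigma>) powr p) \<le>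
      ennreal ((1 - l) powr (1 - p)) * (\<omega> a \<sigma> * I \<sigma>) +
      ennreal (\<epsilon> powr p) * (ennreal (l powr (1 - p) * B powr p) * \<omega> a \<sigma>)"
      by (simp only: distrib_left mult_ac)
  qed
  also have "\<dots> = ennreal ((1 - l) powr (1 - p)) * weighted_energy p a b u +
    ennreal (\<epsilon> powr p) * (ennreal (l powr (1 - p) * B powr p) *
      (\<integral>\<^sup>+\<sigma>. \<omega> a \<sigma> \<partial>\<Omega>))"
    unfolding weighted_energy_polar[OF gradient_measurable[OF u]] I_def[symmetric]
    by (subst nn_integral_add) (simp_all add: nn_integral_cmult)
  finally show ?thesis .
qed

text \<open>The regularised ray norm is a competitor on the sphere for every \<epsilon>; for fixed N
  the regularisation is removed by \<open>ennreal_le_limit\<close>, with e = \<epsilon>^p.\<close>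

lemma S_sphere_const_annulus:
  assumes u: "u \<in> tests" and N: "N > 0" and vanish: "\<And>\<sigma>. norm \<sigma> = 1 \<Longrightarrow> u (exp N *\<^sub>R \<sigma>) = 0"
  shows "S_sphere_const tk tm p a b \<gamma> * weighted_mass p a b \<gamma> (\<lambda>z. u z * indicator {z. exp (- N) \<le> norm z \<and> norm z \<le> exp N} z)
    \<le> weighted_energy p a b u"
proof (rule ennreal_le_limit)
  show "((\<lambda>l. (1 - l) powr (1 - p)) \<longlongrightarrow> 1) (at_right 0)"
    by (rule tendsto_eq_intros | simp)+
  let ?Z = "\<lambda>l. ennreal (l powr (1 - p) * (exp (p * H * N) / p / (2 * N * exp (- p * H * N)) powr (1 - 1 / p)) powr p) *
      (\<integral>\<^sup>+\<sigma>. \<omega> a \<sigma> \<partial>\<Omega>)"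
  show "?Z l < \<infinity>" for l
    using nn_integral_sphere_weight_finite[where 'k = 'k and 'm = 'm, OF ka] by (simp add: ennreal_mult_less_top)
  fix l e :: real assume l: "0 < l" "l < 1" and e: "0 < e"
  define \<epsilon> where "\<epsilon> = e powr (1 / p)"
  have \<epsilon>: "\<epsilon> > 0" "\<epsilon> powr p = e" using e p by (simp_all add: \<epsilon>_def powr_powr)
  have "S_sphere_const tk tm p a b \<gamma> * weighted_mass p a b \<gamma> (\<lambda>z. u z * indicator {z. exp (- N) \<le> norm z \<and> norm z \<le> exp N} z)
    \<le> S_sphere_const tk tm p a b \<gamma> * sphere_mass p a b \<gamma> (ray_norm N \<epsilon> u)"
    by (rule mult_left_mono[OF ray_norm_mass[OF u \<epsilon>(1) N]]) simp
  also have "\<dots> \<le> sphere_energy p a b (ray_norm N \<epsilon> u) (sphere_gradient (ray_norm N \<epsilon> u))"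
    by (rule S_sphere_const_le_smooth[OF ray_norm_smooth[OF u \<epsilon>(1) N]])
  also have "\<dots> \<le> ennreal ((1 - l) powr (1 - p)) * weighted_energy p a b u + ennreal e * ?Z l"
    using ray_norm_energy[OF u \<epsilon>(1) N l vanish] by (simp only: \<epsilon>(2))
  finally show "S_sphere_const tk tm p a b \<gamma> * weighted_mass p a b \<gamma> (\<lambda>z. u z * indicator {z. exp (- N) \<le> norm z \<and> norm z \<le> exp N} z)
    \<le> ennreal ((1 - l) powr (1 - p)) * weighted_energy p a b u + ennreal e * ?Z l" .
qed

text \<open>A test function need not vanish near the origin, so the mass is exhausted by annuli,
  while the energy bound is the same for all of them.\<close>

lemma S_sphere_const_le_test:
  assumes u: "u \<in> tests"
  shows "S_sphere_const tk tm p a b \<gamma> * weighted_mass p a b \<gamma> u \<le> weighted_energy p a b u"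
proof -
  obtain R K where R: "R > 0" "K > 0" "\<And>z. \<bar>u z\<bar> \<le> K" "\<And>z. norm (gradient u z) \<le> K"
    "\<And>z. norm z > R \<Longrightarrow> u z = 0" "\<And>z. norm z > R \<Longrightarrow> gradient u z = 0"
    by (rule test_functions_bounds[OF u]) (rule that; assumption)
  note [measurable] = test_functions_measurable[OF u]
  \<comment> \<open>Starting at R makes exp (N n) larger than R, so u vanishes on the outer sphere,
    as the integration by parts requires at t = N.\<close>
  define N where "N n = R + real n" for n
  define An where "An n = {z :: (real^'k) \<times> (real^'m). exp (- N n) \<le> norm z \<and> norm z \<le> exp (N n)}" for n
  have vanish: "u (exp (N n) *\<^sub>R \<sigma>) = 0" if "norm \<sigma> = 1" for n \<sigma>
  proof (rule R(5))
    have "R < exp R" using exp_ge_add_one_self[of R] by linarith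
    also have "\<dots> \<le> exp (N n)" by (simp add: N_def)
    finally show "R < norm (exp (N n) *\<^sub>R \<sigma>)" using that by simp
  qed
  define F where "F z = weight (a - p - b + \<gamma>) (- \<gamma>) z * \<bar>u z\<bar> powr p" for z
  have mass: "weighted_mass p a b \<gamma> (\<lambda>z. u z * indicator (An n) z) = (\<integral>\<^sup>+z. ennreal (F z) * indicator (An n) z \<partial>lborel)" for n
    unfolding weighted_mass_def using p
    by (intro nn_integral_cong) (simp add: F_def weight_def indicator_def)
  have "weighted_mass p a b \<gamma> u = (\<integral>\<^sup>+z. (SUP n. ennreal (F z) * indicator (An n) z) \<partial>lborel)"
  proof -
    have "(SUP n. ennreal (F z) * indicator (An n) z) = ennreal (F z)" for z
    proof (cases "z = 0")
      case True
      then show ?thesis by (simp add: F_def weight_def)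
    next
      case False
      obtain n :: nat where n: "\<bar>ln (norm z)\<bar> \<le> real n" using real_arch_simple by blast
      have "exp (- N n) \<le> exp (ln (norm z))" "exp (ln (norm z)) \<le> exp (N n)" using n R(1) by (simp_all add: N_def)
      then have "z \<in> An n" using False by (simp add: An_def)
      then have "ennreal (F z) \<le> ennreal (F z) * indicator (An n) z" by simp
      moreover have "ennreal (F z) * indicator (An n) z \<le> ennreal (F z)" for n by (simp add: indicator_def)
      ultimately show ?thesis by (intro antisym SUP_least SUP_upper2[of n]) auto
    qed
    then show ?thesis by (simp add: weighted_mass_def F_def weight_def)
  qed
  also have "\<dots> = (SUP n. \<integral>\<^sup>+z. ennreal (F z) * indicator (An n) z \<partial>lborel)"
  proof (rule nn_integral_monotone_convergence_SUP)
    show "incseq (\<lambda>n z. ennreal (F z) * indicator (An n) z)"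
    proof (intro incseq_SucI le_funI)
      fix n z
      have "An n \<subseteq> An (Suc n)"
      proof
        fix z assume "z \<in> An n"
        then have z: "exp (- N n) \<le> norm z" "norm z \<le> exp (N n)" by (simp_all add: An_def)
        have "exp (- N (Suc n)) \<le> exp (- N n)" "exp (N n) \<le> exp (N (Suc n))" by (simp_all add: N_def)
        from order_trans[OF this(1) z(1)] order_trans[OF z(2) this(2)] show "z \<in> An (Suc n)"
          by (simp add: An_def)
      qed
      then show "ennreal (F z) * indicator (An n) z \<le> ennreal (F z) * indicator (An (Suc n)) z"
        by (auto simp: indicator_def)
    qed
    show "(\<lambda>z. ennreal (F z) * indicator (An n) z) \<in> borel_measurable lborel" for n
      unfolding F_def An_def by measurable
  qed
  finally have "weighted_mass p a b \<gamma> u = (SUP n. weighted_mass p a b \<gamma> (\<lambda>z. u z * indicator (An n) z))"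
    by (simp only: mass)
  then show ?thesis
    using S_sphere_const_annulus[OF u _ vanish] R(1) unfolding An_def
    by (simp add: SUP_mult_left_ennreal N_def) (auto intro!: SUP_least)
qed

lemma S_const_eq_S_sphere_const:
  assumes "\<gamma> \<in> gammas"
  shows "S_const tk tm p a b \<gamma> = S_sphere_const tk tm p a b \<gamma>"
proof (rule antisym[OF S_le_S_sphere_const[OF assms]])
  note adm = gammasD(1)[OF assms]
  show "S_sphere_const tk tm p a b \<gamma> \<le> S_const tk tm p a b \<gamma>"
    unfolding S_const_def
  proof (rule INF_greatest)
    fix u :: "(real^'k) \<times> (real^'m) \<Rightarrow> real" assume "u \<in> tests - {\<lambda>_. 0}"
    then have u: "u \<in> tests" "u \<noteq> (\<lambda>_. 0)" by auto
    have M: "weighted_mass p a b \<gamma> u \<noteq> 0" "weighted_mass p a b \<gamma> u \<noteq> \<infinity>"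
      using M_pos[OF u adm] by (simp_all add: weighted_mass_eq[OF u(1) adm])
    have "S_sphere_const tk tm p a b \<gamma> * weighted_mass p a b \<gamma> u / weighted_mass p a b \<gamma> u \<le> weighted_energy p a b u / weighted_mass p a b \<gamma> u"
      by (rule divide_right_mono_ennreal[OF S_sphere_const_le_test[OF u(1)]])
    then show "S_sphere_const tk tm p a b \<gamma> \<le> weighted_energy p a b u / weighted_mass p a b \<gamma> u"
      using M by (simp add: mult_divide_eq_ennreal)
  qed
qed

end

theorem theorem1p2:
  fixes d k :: nat and p a b :: real
  assumes k: "k = CARD('k::finite)"
    and d: "d = k + CARD('m::finite)"
    and p: "p > 1"
    and ka: "real k + a > 0"
    and dab: "real d + a - p > b"
  shows "(\<forall>\<gamma>. real k + a - p > b - \<gamma> \<and> \<gamma> > b \<longrightarrow>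
            S_const TYPE('k) TYPE('m) p a b \<gamma> = S_sphere_const TYPE('k) TYPE('m) p a b \<gamma>) \<and>
         continuous_on {\<gamma>. \<gamma> > b \<and> real k + a - p > b - \<gamma>}
           (\<lambda>\<gamma>. S_const TYPE('k) TYPE('m) p a b \<gamma>) \<and>
         strict_mono_on {\<gamma>. \<gamma> > b \<and> real k + a - p > b - \<gamma>}
           (\<lambda>\<gamma>. S_const TYPE('k) TYPE('m) p a b \<gamma>)"
proof -
  interpret hardy_weights p a b "TYPE('k)" "TYPE('m)"
    by standard (use p ka dab k d in auto)
  have G: "{\<gamma>. \<gamma> > b \<and> real k + a - p > b - \<gamma>} = gammas"
    by (simp add: gammas_def k)
  have "continuous_on gammas (\<lambda>\<gamma>. ennreal (S \<gamma>))"
    by (rule continuous_on_ennreal[OF continuous_on_S])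
  then have "continuous_on gammas (\<lambda>\<gamma>. S_const TYPE('k) TYPE('m) p a b \<gamma>)"
    by (rule continuous_on_eq) (simp add: S_const_eq gammasD)
  moreover have "strict_mono_on gammas (\<lambda>\<gamma>. S_const TYPE('k) TYPE('m) p a b \<gamma>)"
  proof (rule strict_mono_onI)
    fix \<gamma> \<gamma>' assume \<gamma>: "\<gamma> \<in> gammas" "\<gamma>' \<in> gammas" "\<gamma> < \<gamma>'"
    then show "S_const TYPE('k) TYPE('m) p a b \<gamma> < S_const TYPE('k) TYPE('m) p a b \<gamma>'"
      using S_strict_mono[OF \<gamma>(1,3)] S_nonneg by (simp add: S_const_eq gammasD ennreal_less_iff)
  qed
  moreover have "S_const TYPE('k) TYPE('m) p a b \<gamma> = S_sphere_const TYPE('k) TYPE('m) p a b \<gamma>"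
    if "real k + a - p > b - \<gamma> \<and> \<gamma> > b" for \<gamma>
    by (rule S_const_eq_S_sphere_const) (use that k in \<open>simp add: gammas_def\<close>)
  ultimately show ?thesis unfolding G by blast
qed

end
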